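(* Let $m,n$ be coprime positive integers, and let $E_{m,n}$ be the elliptic curve over $\mathbb{Q}$ given by $y^2=x^3-m^2x+n^2$, with discriminant $\Delta_{m,n}=-16(27n^4-4m^6)$. Assume that the $p$-primary part of $\Delta_{m,n}$ is square-free for every prime $p>3$ (i.e. $p^2\nmid \Delta_{m,n}$ for every prime $p>3$). Put $P_0=(0,n)$ and $P_{-1}=(-m,n)$, which are points of $E_{m,n}(\mathbb{Q})$. (1) If $m=1$ and $n\ge 2$, then $\{P_0,P_{-1}\}$ can be extended to a basis for $E_{m,n}(\mathbb{Q})$. (2) If $n=1$ and $m\ge 4$, then $\{P_0,P_{-1},P_2\}$ can be extended to a basis for $E_{m,n}(\mathbb{Q})$, where $P_2=(-1,m)\in E_{m,1}(\mathbb{Q})$.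
   Context: $E_{m,n}(\mathbb{Q})$ is the (finitely generated) Mordell-Weil group of rational points. In the cases $m=1$ or $n=1$ it is known to be torsion-free, so a basis means a $\mathbb{Z}$-basis of the free abelian group $E_{m,n}(\mathbb{Q})$. A set of points "can be extended to a basis" if its (distinct) elements all belong to some common $\mathbb{Z}$-basis of $E_{m,n}(\mathbb{Q})$. *)

theory Defs
  imports
    Complex_Main
    "HOL-Algebra.Generated_Groups"
    "HOL-Algebra.FiniteProduct"
    "HOL-Computational_Algebra.Primes"
begin

section \<open>The group of points of a short Weierstrass curve\<close>

datatype 'a ec_point = Infinity | Point 'a 'a

text \<open>
  Chord-and-tangent addition on \<open>y\<^sup>2 = x\<^sup>3 + a x + b\<close>; the formulas do not involve \<open>b\<close>.
  In the tangent case, both points being on the curve gives \<open>y1 = y2 \<noteq> 0\<close>.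
\<close>

fun ec_add :: "'a::field_char_0 \<Rightarrow> 'a ec_point \<Rightarrow> 'a ec_point \<Rightarrow> 'a ec_point" where
  "ec_add a Infinity Q = Q"
| "ec_add a P Infinity = P"
| "ec_add a (Point x1 y1) (Point x2 y2) =
    (if x1 = x2 \<and> y1 = - y2 then Infinity
     else
       let l = (if x1 = x2 then (3 * x1^2 + a) / (2 * y1) else (y2 - y1) / (x2 - x1));
           x3 = l^2 - x1 - x2
       in Point x3 (l * (x1 - x3) - y1))"

definition ec_points :: "'a::field_char_0 \<Rightarrow> 'a \<Rightarrow> 'a ec_point set" where
  "ec_points a b = insert Infinity {Point x y | x y. y^2 = x^3 + a * x + b}"

definition ec_group :: "'a::field_char_0 \<Rightarrow> 'a \<Rightarrow> 'a ec_point monoid" where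
  "ec_group a b = \<lparr>carrier = ec_points a b, monoid.mult = ec_add a, one = Infinity\<rparr>"

section \<open>Bases of abelian groups\<close>

text \<open>
  The group is written multiplicatively, so a \<open>\<int>\<close>-linear combination
  \<open>\<Sum> c(x) x\<close> is a finite product of powers \<open>x [^] c x\<close>.
\<close>

definition z_independent :: "('a, 'b) monoid_scheme \<Rightarrow> 'a set \<Rightarrow> bool" where
  "z_independent G B \<longleftrightarrow>
     (\<forall>F. \<forall>c :: 'a \<Rightarrow> int. finite F \<and> F \<subseteq> B \<and>
        finprod G (\<lambda>x. x [^]\<^bsub>G\<^esub> c x) F = \<one>\<^bsub>G\<^esub> \<longrightarrow> (\<forall>x\<in>F. c x = 0))"

definition z_basis :: "('a, 'b) monoid_scheme \<Rightarrow> 'a set \<Rightarrow> bool" where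
  "z_basis G B \<longleftrightarrow> B \<subseteq> carrier G \<and> generate G B = carrier G \<and> z_independent G B"

definition extends_to_z_basis :: "('a, 'b) monoid_scheme \<Rightarrow> 'a set \<Rightarrow> bool" where
  "extends_to_z_basis G S \<longleftrightarrow> (\<exists>B. z_basis G B \<and> S \<subseteq> B)"

section \<open>The curves \<open>y\<^sup>2 = x\<^sup>3 - m\<^sup>2 x + n\<^sup>2\<close> over the rationals\<close>

definition mordell_weil :: "int \<Rightarrow> int \<Rightarrow> rat ec_point monoid" where
  "mordell_weil m n = ec_group (- ((of_int m)^2)) ((of_int n)^2)"

text \<open>This is \<open>- 16 (4 a\<^sup>3 + 27 b\<^sup>2)\<close> for \<open>a = - m\<^sup>2\<close>, \<open>b = n\<^sup>2\<close>.\<close>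

definition disc :: "int \<Rightarrow> int \<Rightarrow> int" where
  "disc m n = - 16 * (27 * n^4 - 4 * m^6)"

end

theory Submission
  imports Defs "HOL-Analysis.Harmonic_Numbers"
begin

text \<open>
  Let \<open>q\<close> be the canonical height, a quadratic form on the group of rational points. The hypothesis on the
  discriminant makes the duplication formula \<open>x(2P) = N / D\<close> cancel only powers of 2 and 3, in a controlled way,
  so \<open>q\<close> is pinned down by elementary inequalities between \<open>N\<close>, \<open>D\<close> and the numerator and denominator of \<open>x(P)\<close>.
  This gives a lower bound \<open>gap > 0\<close> for \<open>q\<close> on all points other than infinity (so there is no torsion) and
  upper bounds for \<open>q\<close> on the sums of the given points.

  The given points span nearly a hexagonal lattice if \<open>m = 1\<close>, and nearly a face-centred cubic lattice if
  \<open>n = 1\<close>; the square of its covering radius is smaller than \<open>gap\<close>. If a multiple of a point \<open>P\<close> lies in the span,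
  then subtracting a nearest lattice point from \<open>P\<close> leaves a point of height below \<open>gap\<close>, which is infinity. So the
  span is pure.

  Since only finitely many points have bounded height, the group is countable and a finite independent set with
  pure span can be enlarged by one element to capture any further point; iterating this along an enumeration
  gives a basis, without the weak Mordell--Weil theorem.
\<close>

section \<open>Quadratic forms on abelian groups and bases\<close>

text \<open>For large parameters there is ample room. For \<open>n = 1\<close> the gap is
  \<open>ln m\<close> up to constants and the squared covering radius is at most about half of that;
  for \<open>m = 1\<close> the two are about 1/3 and 1/9 of \<open>ln (n^2)\<close>. The difficulty
  lies in the smallest parameters, where bounded error terms decide, and this shapes the estimates.
  An inequality between T(2P) and 4 T(P) with error c, iterated along doublings, costs only c/3 in
  the comparison of T with \<open>q\<close>. Moreover T may be varied: every function of numerator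
  and denominator that is homogeneous and comparable with the maximum norm belongs to the same
  \<open>q\<close>, so it is chosen for each case, and for \<open>m = 1\<close> separately for lower
  and upper bounds, to make the one-step constants good. The cancelled powers of 2 and 3 enter with
  their exact values.\<close>

context comm_group
begin

section \<open>Integer combinations of finite families\<close>

definition zcomb :: "('a \<Rightarrow> int) \<Rightarrow> 'a set \<Rightarrow> 'a" where
  "zcomb c B = finprod G (\<lambda>x. x [^] c x) B"

text \<open>For a subgroup this says that the quotient is torsion-free, a necessary condition for a
  basis of it to extend to a basis of the whole group.\<close>

definition pure_subgroup :: "'a set \<Rightarrow> bool" where
  "pure_subgroup H \<longleftrightarrow> (\<forall>x\<in>carrier G. \<forall>N::int. N > 0 \<longrightarrow> x [^] N \<in> H \<longrightarrow> x \<in> H)"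

lemma zcomb_closed [simp]: "B \<subseteq> carrier G \<Longrightarrow> zcomb c B \<in> carrier G"
  unfolding zcomb_def by (intro finprod_closed) auto

lemma zcomb_empty [simp]: "zcomb c {} = \<one>"
  by (simp add: zcomb_def)

lemma zcomb_insert:
  assumes "finite B" "g \<notin> B" "insert g B \<subseteq> carrier G"
  shows "zcomb c (insert g B) = g [^] c g \<otimes> zcomb c B"
  unfolding zcomb_def using assms by (subst finprod_insert) auto

lemma zcomb_cong: "B \<subseteq> carrier G \<Longrightarrow> (\<And>b. b \<in> B \<Longrightarrow> c b = d b) \<Longrightarrow> zcomb c B = zcomb d B"
  unfolding zcomb_def by (rule finprod_cong') auto

lemma zcomb_add:
  assumes "B \<subseteq> carrier G"
  shows "zcomb (\<lambda>b. c b + d b) B = zcomb c B \<otimes> zcomb d B"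
proof -
  have "zcomb (\<lambda>b. c b + d b) B = finprod G (\<lambda>x. x [^] c x \<otimes> x [^] d x) B"
    unfolding zcomb_def using assms by (intro finprod_cong') (auto simp: int_pow_mult)
  then show ?thesis
    unfolding zcomb_def using assms by (subst (asm) finprod_multf) auto
qed

lemma zcomb_zero: "B \<subseteq> carrier G \<Longrightarrow> zcomb (\<lambda>_. 0) B = \<one>"
  unfolding zcomb_def by simp

lemma zcomb_uminus:
  assumes "B \<subseteq> carrier G"
  shows "zcomb (\<lambda>b. - c b) B = inv (zcomb c B)"
  using zcomb_add[OF assms, of c "\<lambda>b. - c b"] zcomb_zero[OF assms] assms
  by (metis (no_types, lifting) add.right_inverse inv_comm inv_equality zcomb_closed zcomb_cong)

lemma zcomb_single:
  assumes "finite B" "B \<subseteq> carrier G" "b \<in> B"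
  shows "zcomb (\<lambda>x. if x = b then k else 0) B = b [^] k"
proof -
  obtain B' where B': "B = insert b B'" "b \<notin> B'" using assms(3) by (meson mk_disjoint_insert)
  have "zcomb (\<lambda>x. if x = b then k else 0) B' = zcomb (\<lambda>_. 0) B'"
    using assms B' by (intro zcomb_cong) auto
  then show ?thesis
    using zcomb_insert[of B' b "\<lambda>x. if x = b then k else 0"] assms B' zcomb_zero[of B'] by simp
qed

lemma zcomb_pow:
  assumes "finite B" "B \<subseteq> carrier G"
  shows "zcomb c B [^] (k::int) = zcomb (\<lambda>b. c b * k) B"
  using assms
proof (induction B rule: finite_induct)
  case (insert b B)
  then show ?case by (simp add: zcomb_insert int_pow_distrib int_pow_pow)
qed simp

lemma zcomb_in_generate:
  assumes "finite B" "B \<subseteq> C" "C \<subseteq> carrier G"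
  shows "zcomb c B \<in> generate G C"
  using assms
proof (induction B rule: finite_induct)
  case empty
  then show ?case by (simp add: generate.one)
next
  case (insert b B)
  then have "b [^] c b \<in> generate G C"
    by (intro subgroup_int_pow_closed[OF generate_is_subgroup]) (auto intro: generate.incl)
  moreover have "insert b B \<subseteq> carrier G" using insert.prems by blast
  ultimately show ?case using insert by (simp add: zcomb_insert generate.eng)
qed

lemma generate_eq_zcomb:
  assumes "finite B" "B \<subseteq> carrier G"
  shows "generate G B = range (\<lambda>c. zcomb c B)"
proof (intro equalityI subsetI)
  fix h assume "h \<in> generate G B"
  then show "h \<in> range (\<lambda>c. zcomb c B)"
  proof (induction rule: generate.induct)
    case one
    show ?case using zcomb_zero[OF assms(2)] by (metis rangeI)
  next
    case (incl h)
    then have "zcomb (\<lambda>x. if x = h then 1 else 0) B = h"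
      using zcomb_single[OF assms incl, of 1] assms(2) by auto
    then show ?case by (metis rangeI)
  next
    case (inv h)
    then have "zcomb (\<lambda>x. if x = h then -1 else 0) B = inv h"
      using zcomb_single[OF assms inv, of "-1"] assms(2) int_pow_neg[of h 1] by auto
    then show ?case by (metis rangeI)
  next
    case (eng h1 h2)
    then obtain c d where "h1 = zcomb c B" "h2 = zcomb d B" by auto
    then have "h1 \<otimes> h2 = zcomb (\<lambda>b. c b + d b) B" using zcomb_add[OF assms(2)] by simp
    then show ?case by blast
  qed
next
  fix h assume "h \<in> range (\<lambda>c. zcomb c B)"
  then show "h \<in> generate G B" using zcomb_in_generate[OF assms(1) _ assms(2)] by auto
qed

text \<open>A relation on a subset extends by zero coefficients, so for finite \<open>B\<close> it
  suffices to test relations on all of \<open>B\<close>.\<close>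

lemma z_independent_finite_iff:
  assumes "finite B" "B \<subseteq> carrier G"
  shows "z_independent G B \<longleftrightarrow> (\<forall>c. zcomb c B = \<one> \<longrightarrow> (\<forall>b\<in>B. c b = 0))"
proof
  assume "z_independent G B"
  then show "\<forall>c. zcomb c B = \<one> \<longrightarrow> (\<forall>b\<in>B. c b = 0)"
    using assms unfolding z_independent_def zcomb_def by blast
next
  assume *: "\<forall>c. zcomb c B = \<one> \<longrightarrow> (\<forall>b\<in>B. c b = 0)"
  show "z_independent G B"
    unfolding z_independent_def
  proof (intro allI impI)
    fix F and c :: "'a \<Rightarrow> int"
    assume F: "finite F \<and> F \<subseteq> B \<and> finprod G (\<lambda>x. x [^] c x) F = \<one>"
    have "zcomb (\<lambda>x. if x \<in> F then c x else 0) B = finprod G (\<lambda>x. x [^] c x) F"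
      unfolding zcomb_def using F assms
      by (intro finprod_mono_neutral_cong_right) auto
    then have "zcomb (\<lambda>x. if x \<in> F then c x else 0) B = \<one>" using F by simp
    then have "\<forall>b\<in>B. (\<lambda>x. if x \<in> F then c x else 0) b = 0" using * by blast
    then show "\<forall>x\<in>F. c x = 0" using F by fastforce
  qed
qed

end

section \<open>Quadratic forms and their polar forms\<close>

locale quadratic_form_group = comm_group G for G (structure) +
  fixes q :: "'a \<Rightarrow> real"
  assumes parallelogram: "x \<in> carrier G \<Longrightarrow> y \<in> carrier G \<Longrightarrow> q (x \<otimes> y) + q (x \<otimes> inv y) = 2 * q x + 2 * q y"
    and nonneg: "x \<in> carrier G \<Longrightarrow> q x \<ge> 0"
begin

lemma q_one [simp]: "q \<one> = 0"
  using parallelogram[of \<one> \<one>] by simp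

lemma q_inv [simp]: "x \<in> carrier G \<Longrightarrow> q (inv x) = q x"
  using parallelogram[of \<one> x] by simp

lemma q_mult_le: "x \<in> carrier G \<Longrightarrow> y \<in> carrier G \<Longrightarrow> q (x \<otimes> y) \<le> 2 * q x + 2 * q y"
  using parallelogram[of x y] nonneg[of "x \<otimes> inv y"] by simp

text \<open>The polar form without the factor 1/2, so that
  \<open>pairing x x = 2 * q x\<close>.\<close>

definition pairing :: "'a \<Rightarrow> 'a \<Rightarrow> real" where
  "pairing x y = q (x \<otimes> y) - q x - q y"

lemma q_mult: "q (x \<otimes> y) = q x + q y + pairing x y"
  by (simp add: pairing_def)

lemma pairing_commute: "x \<in> carrier G \<Longrightarrow> y \<in> carrier G \<Longrightarrow> pairing x y = pairing y x"
  by (simp add: pairing_def m_comm)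

text \<open>The argument of Jordan and von Neumann: in a suitable linear combination of four
  instances of the parallelogram law all mixed differences cancel.\<close>

lemma pairing_add:
  assumes "x \<in> carrier G" "y \<in> carrier G" "z \<in> carrier G"
  shows "pairing (x \<otimes> y) z = pairing x z + pairing y z"
proof -
  have 1: "q (x \<otimes> y \<otimes> z) + q (x \<otimes> z \<otimes> inv y) = 2 * q (x \<otimes> z) + 2 * q y"
    using parallelogram[of "x \<otimes> z" y] assms by (simp add: m_ac)
  have 2: "q (x \<otimes> z \<otimes> inv y) + q (x \<otimes> y \<otimes> inv z) = 2 * q x + 2 * q (z \<otimes> inv y)"
    using parallelogram[of x "z \<otimes> inv y"] assms by (simp add: m_ac inv_mult)
  have 3: "q (x \<otimes> y \<otimes> z) + q (x \<otimes> y \<otimes> inv z) = 2 * q (x \<otimes> y) + 2 * q z"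
    using parallelogram[of "x \<otimes> y" z] assms by simp
  have 4: "q (y \<otimes> z) + q (z \<otimes> inv y) = 2 * q y + 2 * q z"
    using parallelogram[of z y] assms by (simp add: m_ac)
  show ?thesis unfolding pairing_def using 1 2 3 4 by linarith
qed

lemma pairing_one [simp]: "x \<in> carrier G \<Longrightarrow> pairing \<one> x = 0"
  by (simp add: pairing_def)

lemma pairing_nat_pow:
  "x \<in> carrier G \<Longrightarrow> y \<in> carrier G \<Longrightarrow> pairing (x [^] (n::nat)) y = n * pairing x y"
  by (induction n) (auto simp: pairing_add algebra_simps)

lemma pairing_inv:
  assumes "x \<in> carrier G" "y \<in> carrier G"
  shows "pairing (inv x) y = - pairing x y"
  using pairing_add[of x "inv x" y] assms by simp

lemma pairing_pow:
  assumes "x \<in> carrier G" "y \<in> carrier G"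
  shows "pairing (x [^] (k::int)) y = k * pairing x y"
proof (cases k rule: int_cases2)
  case (nonneg n)
  then show ?thesis using assms by (simp add: int_pow_int pairing_nat_pow)
next
  case (nonpos n)
  then show ?thesis using assms by (simp add: int_pow_neg_int pairing_nat_pow pairing_inv)
qed

lemma pairing_pow2:
  assumes "x \<in> carrier G" "y \<in> carrier G"
  shows "pairing (x [^] (k::int)) (y [^] (l::int)) = k * l * pairing x y"
  using assms pairing_pow[of x "y [^] l" k] pairing_pow[of y x l] pairing_commute by simp

lemma pairing_self: "x \<in> carrier G \<Longrightarrow> pairing x x = 2 * q x"
  using parallelogram[of x x] by (simp add: pairing_def)

lemma q_pow: "x \<in> carrier G \<Longrightarrow> q (x [^] (k::int)) = k^2 * q x"
  using pairing_self[of "x [^] k"] pairing_self[of x] pairing_pow2[of x x k k]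
  by (simp add: power2_eq_square)

text \<open>The growth like \<open>N^2\<close> is what matters: a point whose \<open>N\<close>-th
  power has coordinates reduced modulo \<open>N\<close> then has height bounded independently of
  \<open>N\<close>.\<close>

lemma q_zcomb_bound:
  assumes "finite B" "B \<subseteq> carrier G"
  obtains C :: real where "\<And>c N::int. (\<forall>b\<in>B. \<bar>c b\<bar> \<le> N) \<Longrightarrow> q (zcomb c B) \<le> N^2 * C"
proof -
  have "\<exists>C::real. \<forall>c. \<forall>N::int. (\<forall>b\<in>B. \<bar>c b\<bar> \<le> N) \<longrightarrow> q (zcomb c B) \<le> N^2 * C"
    using assms
  proof (induction B rule: finite_induct)
    case empty
    then show ?case by (intro exI[of _ 0]) simp
  next
    case (insert b B)
    then obtain C :: real where C: "\<And>c N::int. \<forall>b\<in>B. \<bar>c b\<bar> \<le> N \<Longrightarrow> q (zcomb c B) \<le> N^2 * C" by auto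
    have "q (zcomb c (insert b B)) \<le> N^2 * (2 * q b + 2 * C)"
      if N: "\<forall>b\<in>insert b B. \<bar>c b\<bar> \<le> N" for c and N :: int
    proof -
      have "\<bar>c b\<bar> \<le> \<bar>N\<bar>" using N by auto
      then have "(c b)^2 \<le> N^2" by (simp add: abs_le_square_iff)
      then have "(of_int (c b))^2 \<le> (of_int N :: real)^2"
        by (metis of_int_le_iff of_int_power)
      then have 1: "q (b [^] c b) \<le> N^2 * q b"
        using insert.prems nonneg[of b] by (simp add: q_pow mult_right_mono)
      have "q (zcomb c (insert b B)) \<le> 2 * q (b [^] c b) + 2 * q (zcomb c B)"
        using insert.hyps insert.prems by (simp add: zcomb_insert q_mult_le)
      also have "\<dots> \<le> 2 * (N^2 * q b) + 2 * (N^2 * C)" using 1 C[of c N] N by simp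
      finally show ?thesis by (simp add: algebra_simps)
    qed
    then show ?case by (intro exI[of _ "2 * q b + 2 * C"]) auto
  qed
  then obtain C :: real where "\<forall>c. \<forall>N::int. (\<forall>b\<in>B. \<bar>c b\<bar> \<le> N) \<longrightarrow> q (zcomb c B) \<le> N^2 * C" ..
  then show ?thesis using that[of C] by simp
qed

end

section \<open>Extending pure independent sets when heights have the Northcott property\<close>

locale northcott_group = quadratic_form_group +
  assumes northcott: "finite {x \<in> carrier G. q x \<le> C}"
    and positive: "x \<in> carrier G \<Longrightarrow> x \<noteq> \<one> \<Longrightarrow> q x > 0"
begin

lemma torsion_free: 
  assumes "x \<in> carrier G" "x [^] (k::int) = \<one>" "k \<noteq> 0"
  shows "x = \<one>"
  using q_pow[of x k] positive[of x] assms by fastforce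

lemma countable_carrier: "countable (carrier G)"
proof -
  have "carrier G = (\<Union>n::nat. {x \<in> carrier G. q x \<le> n})"
    using real_arch_simple by auto
  also have "countable \<dots>" by (rule countable_UN) (auto intro: countable_finite northcott)
  finally show ?thesis .
qed

text \<open>Modulo \<open>H\<close>, the points with a multiple in the span of \<open>g\<close> and
  \<open>H\<close> embed into the rationals by \<open>ratio\<close>. Only finitely many ratios lie
  in (0, 1], so there is a least positive one, and a point realising it generates all these points
  modulo \<open>H\<close>. Discreteness of the height thus takes the place of finite
  generation.\<close>

lemma extend_pure_independent:
  assumes B: "finite B" "B \<subseteq> carrier G" "z_independent G B" and pure: "pure_subgroup (generate G B)"
    and g: "g \<in> carrier G"
  obtains B' where "finite B'" "B \<subseteq> B'" "B' \<subseteq> carrier G" "z_independent G B'"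
    "pure_subgroup (generate G B')" "g \<in> generate G B'"
proof (cases "g \<in> generate G B")
  case True
  then show ?thesis using that assms by blast
next
  case False
  define H where "H = generate G B"
  interpret H: subgroup H G unfolding H_def using generate_is_subgroup B(2) .
  have Hpow: "h [^] (k::int) \<in> H" if "h \<in> H" for h k
    using subgroup_int_pow_closed[OF H.subgroup_axioms that] .
  have pureH: "x \<in> H" if "x \<in> carrier G" "x [^] (N::int) \<in> H" "N \<noteq> 0" for x N
  proof (cases "N > 0")
    case True
    then show ?thesis using pure that unfolding H_def pure_subgroup_def by blast
  next
    case False
    have "x [^] (-N) \<in> H" using that by (simp add: int_pow_neg)
    then show ?thesis using pure that False unfolding H_def pure_subgroup_def
      by (metis linorder_neqE_linordered_idom neg_0_less_iff_less)
  qed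
  have g0: "k = 0" if "g [^] (k::int) \<in> H" for k
    using pureH[OF g that] False H_def by blast
  \<comment> \<open>A triple in \<open>S\<close> says that \<open>x\<close> is \<open>k/N\<close>
    times \<open>g\<close> modulo \<open>H\<close>. Since no nontrivial power of \<open>g\<close>
    lies in the pure subgroup \<open>H\<close>, the point alone determines this fraction.\<close>
  define S where "S = {(x,k,N). x \<in> carrier G \<and> N > (0::int) \<and> (\<exists>h\<in>H. x [^] N = g [^] (k::int) \<otimes> h)}"
  define ratio :: "'a \<times> int \<times> int \<Rightarrow> real" where "ratio = (\<lambda>(x,k,N). k / N)"
  have ratio_unique: "ratio (x,k,N) = ratio (x,k',N')" if xk: "(x,k,N) \<in> S" and xk': "(x,k',N') \<in> S" for x k N k' N'
  proof -
    obtain h h' where h: "h \<in> H" "x [^] N = g [^] k \<otimes> h" "h' \<in> H" "x [^] N' = g [^] k' \<otimes> h'"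
      "N > 0" "N' > 0" "x \<in> carrier G"
      using xk xk' by (auto simp: S_def)
    have "g [^] (k * N') \<otimes> h [^] N' = x [^] (N * N')"
      using h g by (simp add: int_pow_pow int_pow_distrib flip: int_pow_pow)
    moreover have "g [^] (k' * N) \<otimes> h' [^] N = x [^] (N' * N)"
      using h g by (simp add: int_pow_pow int_pow_distrib flip: int_pow_pow)
    ultimately have "g [^] (k * N') \<otimes> h [^] N' = g [^] (k' * N) \<otimes> h' [^] N" by (simp add: mult.commute)
    then have "g [^] (k * N' - k' * N) = h' [^] N \<otimes> inv (h [^] N')"
      using g h by (simp add: int_pow_diff) (smt (verit) H.mem_carrier int_pow_closed inv_closed inv_solve_right m_assoc m_closed m_comm)
    then have "g [^] (k * N' - k' * N) \<in> H" using Hpow h by simp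
    then have "k * N' = k' * N" using g0 by force
    then have "real_of_int k * N' = real_of_int k' * N" by (metis of_int_mult)
    then show ?thesis using h by (simp add: ratio_def field_simps)
  qed
  have S_mult: "(x \<otimes> inv (y [^] j), k * M - j * l * N, N * M) \<in> S" if xk: "(x,k,N) \<in> S" and yl: "(y,l,M) \<in> S" 
    for x y j k l N M
  proof -
    obtain h h' where h: "h \<in> H" "x [^] N = g [^] k \<otimes> h" "h' \<in> H" "y [^] M = g [^] l \<otimes> h'"
      "N > 0" "M > 0" "x \<in> carrier G" "y \<in> carrier G"
      using xk yl by (auto simp: S_def)
    have x: "x [^] (N * M) = g [^] (k * M) \<otimes> h [^] M"
      using h g by (simp add: int_pow_distrib flip: int_pow_pow)
    have "(y [^] j) [^] (N * M) = (y [^] M) [^] (j * N)"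
      using h(8) by (simp only: int_pow_pow) (simp add: mult_ac)
    also have "\<dots> = g [^] (j * l * N) \<otimes> h' [^] (j * N)" 
      using h g by (simp add: int_pow_distrib int_pow_pow mult_ac)
    finally have y: "(inv (y [^] j)) [^] (N * M) = inv (g [^] (j * l * N)) \<otimes> inv (h' [^] (j * N))"
      using h g by (simp add: int_pow_inv inv_mult)
    have "(x \<otimes> inv (y [^] j)) [^] (N * M) = g [^] (k * M) \<otimes> h [^] M \<otimes> (inv (g [^] (j * l * N)) \<otimes> inv (h' [^] (j * N)))"
      using x y h g by (simp add: int_pow_distrib)
    also have "\<dots> = g [^] (k * M - j * l * N) \<otimes> (h [^] M \<otimes> inv (h' [^] (j * N)))"
      using h g by (simp add: int_pow_diff m_ac)
    finally show ?thesis using h Hpow by (auto simp: S_def)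
  qed
  have ratio0: "x \<in> H" if "(x,k,N) \<in> S" "ratio (x,k,N) = 0" for x k N
  proof -
    have "k = 0" using that by (auto simp: ratio_def S_def)
    then show ?thesis using that pureH[of x N] by (auto simp: S_def)
  qed
  text \<open>After reducing the \<open>H\<close>-coordinates modulo 1, a ratio in \<open>(0, 1]\<close> is realised by a point of bounded \<open>q\<close>.\<close>
  obtain C :: real where C: "\<And>c N::int. (\<forall>b\<in>B. \<bar>c b\<bar> \<le> N) \<Longrightarrow> q (zcomb c B) \<le> N^2 * C"
    using q_zcomb_bound[OF B(1,2)] by blast
  define C' where "C' = 2 * q g + 2 * C"
  have small: "\<exists>x'. (x',k,N) \<in> S \<and> q x' \<le> C'" if xk: "(x,k,N) \<in> S" and r: "0 < ratio (x,k,N)" "ratio (x,k,N) \<le> 1" for x k N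
  proof -
    obtain h where h: "h \<in> H" "x [^] N = g [^] k \<otimes> h" "N > 0" "x \<in> carrier G" using xk by (auto simp: S_def)
    have k: "0 < k" "k \<le> N" using r h(3) by (auto simp: ratio_def divide_simps split: if_splits)
    obtain c where c: "h = zcomb c B" using h(1) generate_eq_zcomb[OF B(1,2)] by (auto simp: H_def)
    define x' where "x' = x \<otimes> zcomb (\<lambda>b. - (c b div N)) B"
    have x': "x' \<in> carrier G" using h B by (simp add: x'_def)
    have "x' [^] N = g [^] k \<otimes> (zcomb c B \<otimes> zcomb (\<lambda>b. - (c b div N) * N) B)"
      using h g B c by (simp add: x'_def int_pow_distrib zcomb_pow m_assoc)
    also have "zcomb c B \<otimes> zcomb (\<lambda>b. - (c b div N) * N) B = zcomb (\<lambda>b. c b mod N) B"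
      using B by (simp add: minus_div_mult_eq_mod flip: zcomb_add)
    finally have x'N: "x' [^] N = g [^] k \<otimes> zcomb (\<lambda>b. c b mod N) B" .
    have "N^2 * q x' = q (x' [^] N)" using q_pow x' by simp
    also have "\<dots> \<le> 2 * q (g [^] k) + 2 * q (zcomb (\<lambda>b. c b mod N) B)"
      unfolding x'N using g B by (intro q_mult_le) auto
    also have "\<dots> \<le> 2 * (N^2 * q g) + 2 * (N^2 * C)"
    proof -
      have "q (g [^] k) \<le> N^2 * q g" using g k nonneg[OF g] by (simp add: q_pow mult_right_mono power_mono)
      moreover have "q (zcomb (\<lambda>b. c b mod N) B) \<le> N^2 * C" using h(3) by (intro C) (simp add: order_less_imp_le)
      ultimately show ?thesis by simp
    qed
    finally have "N^2 * q x' \<le> N^2 * C'" by (simp add: C'_def algebra_simps)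
    then have "q x' \<le> C'" using h(3) by simp
    moreover have "(x',k,N) \<in> S" 
      using x'N x' h zcomb_in_generate[OF B(1) _ B(2)] by (auto simp: S_def H_def)
    ultimately show ?thesis by blast
  qed
  define R where "R = {r. 0 < r \<and> r \<le> 1 \<and> r \<in> ratio ` S}"
  \<comment> \<open>Choosing a realising point of bounded height for each ratio gives an injection
    into a Northcott set, because a point has only one ratio.\<close>
  have "finite R"
  proof -
    define X where "X = {x \<in> carrier G. q x \<le> C'}"
    have "\<exists>f. \<forall>r\<in>R. f r \<in> X \<and> (\<exists>k N. (f r,k,N) \<in> S \<and> ratio (f r,k,N) = r)"
    proof (rule bchoice, rule ballI)
      fix r assume "r \<in> R"
      then obtain x k N where *: "(x,k,N) \<in> S" "r = ratio (x,k,N)" "0 < r" "r \<le> 1" by (auto simp: R_def)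
      then obtain x' where "(x',k,N) \<in> S" "q x' \<le> C'" using small[of x k N] by auto
      then show "\<exists>x'. x' \<in> X \<and> (\<exists>k N. (x',k,N) \<in> S \<and> ratio (x',k,N) = r)"
        using * by (intro exI[of _ x']) (auto simp: X_def S_def ratio_def)
    qed
    then obtain f where f: "\<And>r. r \<in> R \<Longrightarrow> f r \<in> X \<and> (\<exists>k N. (f r,k,N) \<in> S \<and> ratio (f r,k,N) = r)" by blast
    have "inj_on f R"
      by (rule inj_onI) (metis f ratio_unique)
    moreover have "f ` R \<subseteq> X" using f by blast
    ultimately show ?thesis using northcott[of C'] unfolding X_def by (meson finite_imageD finite_subset)
  qed
  have gS: "(g,1,1) \<in> S" using g by (auto simp: S_def intro!: bexI[of _ \<one>])
  then have "1 \<in> R" by (auto simp: R_def ratio_def intro!: image_eqI[of _ _ "(g,1,1)"])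
  then obtain r0 where r0: "r0 \<in> R" "\<And>r. r \<in> R \<Longrightarrow> r0 \<le> r"
    using Min_in[OF \<open>finite R\<close>] Min_le[OF \<open>finite R\<close>] by blast
  then obtain g' k0 N0 where g': "(g',k0,N0) \<in> S" "r0 = ratio (g',k0,N0)" by (auto simp: R_def)
  have g'c: "g' \<in> carrier G" and N0: "N0 > 0" using g' by (auto simp: S_def)
  have k0: "k0 > 0" using r0(1) g' N0 by (auto simp: R_def ratio_def zero_less_divide_iff)
  have generated: "\<exists>j. x \<otimes> inv (g' [^] (j::int)) \<in> H" if xk: "(x,k,N) \<in> S" for x k N
  proof -
    \<comment> \<open>Euclidean division by the least ratio \<open>r0\<close>: the remainder is a
      ratio in [0, \<open>r0\<close>), hence zero.\<close>
    define j where "j = \<lfloor>ratio (x,k,N) / r0\<rfloor>"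
    let ?y = "(x \<otimes> inv (g' [^] j), k * N0 - j * k0 * N, N * N0)"
    have y: "?y \<in> S" using S_mult[OF xk g'(1)] .
    have r0': "0 < r0" "r0 \<le> 1" using r0 by (auto simp: R_def)
    have N: "N > 0" using xk by (simp add: S_def)
    have ry: "ratio ?y = ratio (x,k,N) - j * r0"
      using N N0 by (simp add: g'(2) ratio_def divide_simps)
    have "j \<le> ratio (x,k,N) / r0" "ratio (x,k,N) / r0 < j + 1" by (auto simp: j_def)
    then have "0 \<le> ratio ?y" "ratio ?y < r0" using r0' unfolding ry by (simp_all add: field_simps)
    then have "ratio ?y = 0" using r0(2)[of "ratio ?y"] r0' y by (force simp: R_def)
    then show ?thesis using ratio0[OF y] by blast
  qed
  define B' where "B' = insert g' B"
  have B'c: "B' \<subseteq> carrier G" "finite B'" using B g'c by (auto simp: B'_def)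
  interpret H': subgroup "generate G B'" G using generate_is_subgroup B'c(1) .
  have HH': "H \<subseteq> generate G B'" unfolding H_def B'_def by (intro mono_generate) auto
  have g'pow: "g' [^] (j::int) \<in> generate G B'" for j
    using subgroup_int_pow_closed[OF H'.subgroup_axioms, of g' j] by (simp add: B'_def generate.incl)
  have S_gen: "x \<in> generate G B'" if xk: "(x,k,N) \<in> S" for x k N
  proof -
    obtain j where j: "x \<otimes> inv (g' [^] (j::int)) \<in> H" using generated[OF xk] by blast
    have "x = x \<otimes> inv (g' [^] j) \<otimes> g' [^] j" using xk g'c by (simp add: S_def m_assoc)
    then show ?thesis using j HH' g'pow H'.m_closed by (metis subsetD)
  qed
  have g'_notin: "c = 0" if c: "g' [^] (c::int) \<in> H" for c
  proof (rule ccontr)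
    assume "c \<noteq> 0"
    then have "g' \<in> H" using pureH g'c c by blast
    then have "(g', 0, 1) \<in> S" using g'c by (auto simp: S_def)
    from ratio_unique[OF this g'(1)] show False using k0 N0 by (simp add: ratio_def)
  qed
  have "g' \<notin> B" using g'_notin[of 1] g'c by (auto simp: H_def generate.incl)
  have split: "zcomb c B' = g' [^] c g' \<otimes> zcomb c B" for c
    using zcomb_insert[OF B(1) \<open>g' \<notin> B\<close>] B'c by (simp add: B'_def)
  have zH: "zcomb c B \<in> H" for c unfolding H_def using zcomb_in_generate[OF B(1) _ B(2)] by blast
  have "z_independent G B'"
    unfolding z_independent_finite_iff[OF B'c(2,1)]
  proof (intro allI impI)
    fix c assume "zcomb c B' = \<one>"
    then have e: "g' [^] c g' \<otimes> zcomb c B = \<one>" using split by simp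
    then have "g' [^] c g' = inv (zcomb c B)" using B g'c by (simp add: inv_equality)
    then have c0: "c g' = 0" using zH g'_notin by (metis H.m_inv_closed)
    then have "zcomb c B = \<one>" using e B by simp
    then show "\<forall>b\<in>B'. c b = 0" using c0 B(3) z_independent_finite_iff[OF B(1,2)] by (auto simp: B'_def)
  qed
  moreover have "pure_subgroup (generate G B')"
    unfolding pure_subgroup_def
  proof (intro ballI allI impI)
    fix x and N :: int assume x: "x \<in> carrier G" "N > 0" "x [^] N \<in> generate G B'"
    then obtain c where c: "x [^] N = zcomb c B'" using generate_eq_zcomb[OF B'c(2,1)] by auto
    \<comment> \<open>Raising to the power \<open>N0\<close> replaces \<open>g'\<close> by a power
      of \<open>g\<close> modulo \<open>H\<close>, so that \<open>x\<close> acquires a ratio and is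
      already known to be generated.\<close>
    obtain h where h: "h \<in> H" "g' [^] N0 = g [^] k0 \<otimes> h" using g' by (auto simp: S_def)
    have "x [^] (N * N0) = (g' [^] c g' \<otimes> zcomb c B) [^] N0"
      using int_pow_pow[OF x(1), of N N0] c split by simp
    also have "\<dots> = (g' [^] N0) [^] c g' \<otimes> zcomb c B [^] N0"
      using g'c B by (simp add: int_pow_distrib int_pow_pow mult.commute)
    also have "\<dots> = g [^] (k0 * c g') \<otimes> (h [^] c g' \<otimes> zcomb c B [^] N0)"
      using g h B by (simp add: int_pow_distrib int_pow_pow m_assoc)
    finally have "(x, k0 * c g', N * N0) \<in> S" using x N0 Hpow h zH by (auto simp: S_def)
    then show "x \<in> generate G B'" using S_gen by blast
  qed
  ultimately show ?thesis
    using that[of B'] B'c S_gen[OF gS] by (auto simp: B'_def)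
qed

theorem extends_to_z_basis_if_pure:
  assumes S: "finite S" "S \<subseteq> carrier G" "z_independent G S" "pure_subgroup (generate G S)"
  shows "extends_to_z_basis G S"
proof -
  define ok where "ok B \<longleftrightarrow> finite B \<and> B \<subseteq> carrier G \<and> z_independent G B \<and> pure_subgroup (generate G B)" for B
  \<comment> \<open>The enumeration may repeat elements, so a finite carrier needs no separate
    treatment.\<close>
  define e where "e = from_nat_into (carrier G)"
  have ne: "carrier G \<noteq> {}" by blast
  have e: "e i \<in> carrier G" for i by (simp add: e_def from_nat_into ne)
  have "\<exists>B. B 0 = S \<and> (\<forall>i. ok (B i)) \<and> (\<forall>i. B i \<subseteq> B (Suc i) \<and> e i \<in> generate G (B (Suc i)))"
  proof -
    have "\<exists>B'. ok B' \<and> B \<subseteq> B' \<and> e i \<in> generate G B'" if "ok B" for B i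
      using extend_pure_independent[of B "e i"] that e unfolding ok_def by metis
    then obtain f where f: "\<And>B i. ok B \<Longrightarrow> ok (f B i) \<and> B \<subseteq> f B i \<and> e i \<in> generate G (f B i)" by metis
    define B where "B = rec_nat S (\<lambda>i B. f B i)"
    have B: "B 0 = S" "B (Suc i) = f (B i) i" for i by (simp_all add: B_def)
    have okB: "ok (B i)" for i
    proof (induction i)
      case 0
      show ?case using S B(1) by (simp add: ok_def)
    next
      case (Suc i)
      then show ?case using f B(2) by simp
    qed
    then show ?thesis using f B by (intro exI[of _ B]) simp
  qed
  then obtain B where B: "B 0 = S" "\<And>i. ok (B i)" "\<And>i. B i \<subseteq> B (Suc i)" "\<And>i. e i \<in> generate G (B (Suc i))" by blast
  have mono: "B i \<subseteq> B j" if "i \<le> j" for i j using lift_Suc_mono_le[of B, OF B(3) that] .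
  define U where "U = (\<Union>i. B i)"
  have Uc: "U \<subseteq> carrier G" using B(2) by (auto simp: U_def ok_def)
  have "generate G U = carrier G"
  proof
    show "generate G U \<subseteq> carrier G" using generate_incl[OF Uc] .
    show "carrier G \<subseteq> generate G U"
    proof
      fix x assume "x \<in> carrier G"
      then obtain i where "x = e i" using from_nat_into_surj[OF countable_carrier] by (metis e_def)
      then show "x \<in> generate G U" using B(4)[of i] mono_generate[of "B (Suc i)" U] by (auto simp: U_def)
    qed
  qed
  moreover have "z_independent G U"
    unfolding z_independent_def
  proof (intro allI impI)
    fix F and c :: "'a \<Rightarrow> int"
    assume F: "finite F \<and> F \<subseteq> U \<and> finprod G (\<lambda>x. x [^] c x) F = \<one>"
    have "\<exists>i. F \<subseteq> B i"
    proof -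
      have "\<forall>x\<in>F. \<exists>i. x \<in> B i" using F by (auto simp: U_def)
      then obtain j where j: "\<And>x. x \<in> F \<Longrightarrow> x \<in> B (j x)" by metis
      have "x \<in> B (Max (j ` F))" if "x \<in> F" for x
        using j[OF that] mono[of "j x" "Max (j ` F)"] F that by auto
      then show ?thesis by blast
    qed
    then show "\<forall>x\<in>F. c x = 0" using B(2) F unfolding ok_def z_independent_def by meson
  qed
  ultimately have "z_basis G U" using Uc by (simp add: z_basis_def)
  then show ?thesis using B(1) by (auto simp: extends_to_z_basis_def U_def)
qed

end

section \<open>Covering arguments\<close>

locale gap_quadratic_group = northcott_group +
  fixes gap :: real
  assumes gap_pos: "gap > 0" and gap: "x \<in> carrier G \<Longrightarrow> x \<noteq> \<one> \<Longrightarrow> gap \<le> q x"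
begin

lemma eq_one_if_q_less: "x \<in> carrier G \<Longrightarrow> q x < gap \<Longrightarrow> x = \<one>"
  using gap[of x] by linarith

text \<open>\<open>cov\<close> is the covering condition at the point with rational coordinates
  \<open>c b / N\<close>, cleared of denominators so that it can be stated inside the group. If
  \<open>d\<close> is a close lattice point, \<open>x\<close> minus that point has height below
  \<open>gap\<close>.\<close>

lemma pure_if_covering:
  assumes B: "finite B" "B \<subseteq> carrier G"
    and cov: "\<And>c N::int. N > 0 \<Longrightarrow> \<exists>d. q (zcomb (\<lambda>b. c b - N * d b) B) < N^2 * gap"
  shows "pure_subgroup (generate G B)"
  unfolding pure_subgroup_def
proof (intro ballI allI impI)
  fix x and N :: int assume x: "x \<in> carrier G" "N > 0" "x [^] N \<in> generate G B"
  then obtain c where c: "x [^] N = zcomb c B" using generate_eq_zcomb[OF B] by auto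
  obtain d where d: "q (zcomb (\<lambda>b. c b - N * d b) B) < N^2 * gap" using cov[OF x(2)] by blast
  define y where "y = x \<otimes> inv (zcomb d B)"
  have y: "y \<in> carrier G" using x B by (simp add: y_def)
  have "y [^] N = zcomb c B \<otimes> zcomb (\<lambda>b. - (d b * N)) B"
    using x B c by (simp add: y_def int_pow_distrib int_pow_inv zcomb_pow zcomb_uminus)
  also have "\<dots> = zcomb (\<lambda>b. c b - N * d b) B"
    using B by (simp add: mult.commute flip: zcomb_add)
  finally have "N^2 * q y < N^2 * gap" using d q_pow[OF y, of N] by simp
  then have "y = \<one>" using x(2) y eq_one_if_q_less by simp
  then have "x = zcomb d B" using x B
    by (metis inv_closed inv_inv inv_equality y_def zcomb_closed)
  then show "x \<in> generate G B" using generate_eq_zcomb[OF B] by simp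
qed

text \<open>A nontrivial relation may be divided by 2 until some coefficient is odd; the sum over the odd
  coefficients is then twice a point.\<close>

lemma independent_if_subset_sums_short:
  assumes B: "finite B" "B \<subseteq> carrier G"
    and sub: "\<And>T. T \<subseteq> B \<Longrightarrow> T \<noteq> {} \<Longrightarrow> zcomb (\<lambda>_. 1) T \<noteq> \<one> \<and> q (zcomb (\<lambda>_. 1) T) < 4 * gap"
  shows "z_independent G B"
proof -
  have "zcomb c B = \<one> \<Longrightarrow> \<forall>b\<in>B. c b = 0" for c
  proof (induction "nat (\<Sum>b\<in>B. \<bar>c b\<bar>)" arbitrary: c rule: less_induct)
    case less
    define T where "T = {b \<in> B. odd (c b)}"
    define h where "h b = c b div 2" for b
    have T: "T \<subseteq> B" by (auto simp: T_def)
    have "zcomb (\<lambda>b. if b \<in> T then 1 else 0) B = zcomb (\<lambda>_. 1) T"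
      unfolding zcomb_def using B T by (intro finprod_mono_neutral_cong_right) auto
    moreover have "zcomb c B = zcomb (\<lambda>b. h b * 2 + (if b \<in> T then 1 else 0)) B"
      using B by (intro zcomb_cong) (auto simp: T_def h_def elim: oddE)
    ultimately have e: "zcomb h B [^] (2::int) \<otimes> zcomb (\<lambda>_. 1) T = \<one>"
      using less.prems B by (simp add: zcomb_add zcomb_pow)
    have hB: "zcomb h B \<in> carrier G" "zcomb (\<lambda>_. 1) T \<in> carrier G" using B T by auto
    show ?case
    proof (cases "T = {}")
      case True
      then have "zcomb h B = \<one>" using e hB torsion_free[of "zcomb h B" 2] by simp
      have ch: "c b = h b * 2" if "b \<in> B" for b using True that by (auto simp: T_def h_def)
      show ?thesis
      proof (rule ccontr)
        assume "\<not> ?thesis"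
        then obtain b where b: "b \<in> B" "c b \<noteq> 0" by blast
        have "(\<Sum>b\<in>B. \<bar>h b\<bar>) < (\<Sum>b\<in>B. \<bar>c b\<bar>)"
        proof (rule sum_strict_mono_ex1[OF B(1)])
          show "\<forall>b\<in>B. \<bar>h b\<bar> \<le> \<bar>c b\<bar>" using ch by (simp add: abs_mult)
          show "\<exists>b\<in>B. \<bar>h b\<bar> < \<bar>c b\<bar>" using b ch[OF b(1)] by (intro bexI[of _ b]) auto
        qed
        moreover have "0 \<le> (\<Sum>b\<in>B. \<bar>h b\<bar>)" by (intro sum_nonneg) simp
        ultimately have "nat (\<Sum>b\<in>B. \<bar>h b\<bar>) < nat (\<Sum>b\<in>B. \<bar>c b\<bar>)" by linarith
        from less.hyps[OF this \<open>zcomb h B = \<one>\<close>] have "\<forall>b\<in>B. h b = 0" .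
        then show False using b ch by simp
      qed
    next
      case False
      have "zcomb (\<lambda>_. 1) T = inv (zcomb h B [^] (2::int))"
        using e hB by (metis inv_comm inv_equality int_pow_closed)
      then have "q (zcomb (\<lambda>_. 1) T) = 4 * q (zcomb h B)"
        using hB q_pow[of "zcomb h B" 2] by simp
      then have "zcomb h B = \<one>" using sub[OF T False] hB eq_one_if_q_less by simp
      then show ?thesis using e hB sub[OF T False] by simp
    qed
  qed
  then show ?thesis using z_independent_finite_iff[OF B] by blast
qed

end

text \<open>The binary quadratic form with values \<open>A\<close>, \<open>B\<close>,
  \<open>D\<close> at (1,0), (0,1), (1,1); it is parametrised by values because these are what
  height bounds control.\<close>

definition qform2 :: "real \<Rightarrow> real \<Rightarrow> real \<Rightarrow> real \<Rightarrow> real \<Rightarrow> real" where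
  "qform2 A B D x y = A*x^2 + B*y^2 + (D-A-B)*x*y"

text \<open>Here \<open>D12\<close>, \<open>D23\<close>, \<open>D13\<close> are the values at
  pairwise sums of basis vectors; the value at (1,1,1) is then
  \<open>D12 + D23 + D13 - A - B - C\<close>.\<close>

definition qform3 :: "real \<Rightarrow> real \<Rightarrow> real \<Rightarrow> real \<Rightarrow> real \<Rightarrow> real \<Rightarrow> real \<Rightarrow> real \<Rightarrow> real \<Rightarrow> real" where
  "qform3 A B C D12 D23 D13 x y z =
     A*x^2 + B*y^2 + C*z^2 + (D12-A-B)*x*y + (D23-B-C)*y*z + (D13-A-C)*x*z"

text \<open>The point with coordinates \<open>x, y\<close> lies in the simplex \<open>0, e1, e1 + e2\<close>; averaging the squared
  distances to the vertices with the barycentric weights gives \<open>\<Sum> w i * w j * q (v i - v j)\<close>.\<close>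

lemma covering2_ordered:
  assumes "0 \<le> y" "y \<le> x" "x \<le> 1" and R: "A \<le> R" "B \<le> R" "D \<le> R" "R/3 < L" "0 \<le> R"
  shows "\<exists>(i::int) (j::int). qform2 A B D (x-i) (y-j) < L"
proof -
  let ?w0 = "1-x" and ?w1 = "x-y" and ?w2 = "y"
  define S where "S = ?w0*?w1 + ?w1*?w2 + ?w0*?w2"
  have "?w0 * qform2 A B D x y + ?w1 * qform2 A B D (x-1) y + ?w2 * qform2 A B D (x-1) (y-1)
      = ?w0*?w1*A + ?w1*?w2*B + ?w0*?w2*D"
    by (simp add: qform2_def power2_eq_square algebra_simps)
  also have "\<dots> \<le> ?w0*?w1*R + ?w1*?w2*R + ?w0*?w2*R"
    using assms by (intro add_mono mult_left_mono) auto
  also have "\<dots> = S*R" by (simp add: S_def algebra_simps)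
  also have "\<dots> \<le> 1/3*R"
  proof (rule mult_right_mono[OF _ \<open>0 \<le> R\<close>])
    have "1 - 3 * S = ((?w0-?w1)^2 + (?w1-?w2)^2 + (?w0-?w2)^2) / 2"
      by (simp add: S_def power2_eq_square field_simps)
    also have "\<dots> \<ge> 0" by simp
    finally show "S \<le> 1/3" by simp
  qed
  finally have *: "?w0 * qform2 A B D x y + ?w1 * qform2 A B D (x-1) y + ?w2 * qform2 A B D (x-1) (y-1) < L"
    using R by simp
  have "qform2 A B D x y < L \<or> qform2 A B D (x-1) y < L \<or> qform2 A B D (x-1) (y-1) < L"
  proof (rule ccontr)
    assume "\<not> ?thesis"
    then have "?w0 * L + ?w1 * L + ?w2 * L
        \<le> ?w0 * qform2 A B D x y + ?w1 * qform2 A B D (x-1) y + ?w2 * qform2 A B D (x-1) (y-1)"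
      using assms by (intro add_mono mult_left_mono) auto
    with * show False by (simp add: algebra_simps)
  qed
  then show ?thesis
  proof (elim disjE)
    assume "qform2 A B D x y < L"
    then show ?thesis by (intro exI[of _ 0]) simp
  next
    assume "qform2 A B D (x-1) y < L"
    then show ?thesis by (intro exI[of _ 1] exI[of _ 0]) simp
  next
    assume "qform2 A B D (x-1) (y-1) < L"
    then show ?thesis by (intro exI[of _ 1]) simp
  qed
qed


lemma qform2_scale: "qform2 A B D (t*x) (t*y) = t^2 * qform2 A B D x y"
  by (simp add: qform2_def power2_eq_square algebra_simps)

lemma qform3_scale: "qform3 A B C D12 D23 D13 (t*x) (t*y) (t*z) = t^2 * qform3 A B C D12 D23 D13 x y z"
  by (simp add: qform3_def power2_eq_square algebra_simps)

lemma qform2_swap: "qform2 A B D x y = qform2 B A D y x"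
  by (simp add: qform2_def algebra_simps)

text \<open>Integer translation moves the point into the unit square. The diagonal cuts the square
  into two triangles exchanged by swapping the coordinates.\<close>

lemma covering2:
  assumes R: "A \<le> R" "B \<le> R" "D \<le> R" "R/3 < L" "0 \<le> R"
  shows "\<exists>(i::int) (j::int). qform2 A B D (x-i) (y-j) < L"
proof -
  have fr: "0 \<le> frac x" "0 \<le> frac y" "frac x \<le> 1" "frac y \<le> 1" for x y :: real
    by (auto simp: frac_lt_1 less_imp_le)
  have "\<exists>(i::int) (j::int). qform2 A B D (frac x - i) (frac y - j) < L"
  proof (cases "frac y \<le> frac x")
    case True
    then show ?thesis using covering2_ordered[OF _ True _ R] fr by blast
  next
    case False
    then have "\<exists>(j::int) (i::int). qform2 B A D (frac y - j) (frac x - i) < L"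
      using covering2_ordered[of "frac x" "frac y" B R A D L] R fr by fastforce
    then show ?thesis by (subst qform2_swap) blast
  qed
  then obtain i j :: int where "qform2 A B D (frac x - i) (frac y - j) < L" by blast
  then show ?thesis
    by (intro exI[of _ "\<lfloor>x\<rfloor> + i"] exI[of _ "\<lfloor>y\<rfloor> + j"]) (simp add: frac_def algebra_simps)
qed

text \<open>One edge of the simplex may be long; \<open>p\<close> is the mean weight of its two endpoints.\<close>

lemma kuhn_simplex_bound:
  assumes w: "w0 \<ge> 0" "w1 \<ge> 0" "w2 \<ge> 0" "w3 \<ge> 0" "w0 + w1 + w2 + w3 = (1::real)"
    and s: "0 \<le> s" "s \<le> l" and K: "\<And>p. 0 \<le> p \<Longrightarrow> p \<le> 1/2 \<Longrightarrow> s/4 + s*p - (3 * s-l)*p^2 < L"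
  shows "s*(w0*w1 + w1*w2 + w2*w3 + w1*w3 + w0*w3) + l*(w0*w2) < L"
proof -
  define p where "p = (w0+w2)/2"
  have q: "1/2 - p = (w1+w3)/2" using w by (simp add: p_def field_simps)
  have p: "0 \<le> p" "p \<le> 1/2" using w q by (auto simp: p_def)
  have 1: "w0*w2 \<le> p^2" 
    using sum_squares_ge_zero[of "w0-w2" 0] by (simp add: p_def power2_eq_square field_simps)
  have 2: "w1*w3 \<le> (1/2-p)^2" unfolding q
    using sum_squares_ge_zero[of "w1-w3" 0] by (simp add: power2_eq_square field_simps)
  have 3: "w0*w1 + w1*w2 + w2*w3 + w0*w3 = 4*p*(1/2-p)"
    unfolding q by (simp add: p_def field_simps)
  have "s*(w0*w1 + w1*w2 + w2*w3 + w1*w3 + w0*w3) + l*(w0*w2)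
      = s*(4*p*(1/2-p)) + s*(w1*w3) + l*(w0*w2)"
    unfolding 3[symmetric] by (simp add: algebra_simps)
  also have "\<dots> \<le> s*(4*p*(1/2-p)) + s*(1/2-p)^2 + l*p^2"
    using mult_left_mono[OF 1, of l] mult_left_mono[OF 2, of s] s by linarith
  also have "\<dots> = s/4 + s*p - (3 * s-l)*p^2" by (simp add: power2_eq_square field_simps)
  finally show ?thesis using K[OF p] by linarith
qed

text \<open>The edges of the simplex \<open>0, e1, e1+e2, e1+e2+e3\<close> have squared lengths
  \<open>A\<close>, \<open>B\<close>, \<open>C\<close>, \<open>D12\<close>, \<open>D23\<close> and
  the form at (1,1,1); the vector \<open>e1+e3\<close> is not an edge. \<open>mixed\<close> allows
  at most one of \<open>D12\<close> and \<open>D23\<close> to exceed \<open>s\<close>, and reversing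
  the order of the vertices exchanges the two possibilities.\<close>

lemma covering3_ordered:
  assumes ord: "0 \<le> z" "z \<le> y" "y \<le> x" "x \<le> 1" and s: "0 \<le> s" "s \<le> l"
    and short: "A \<le> s" "B \<le> s" "C \<le> s" "D12 + D23 + D13 - A - B - C \<le> s"
    and mixed: "D12 \<le> l" "D23 \<le> s \<or> (D12 \<le> s \<and> D23 \<le> l)"
    and K: "\<And>p. 0 \<le> p \<Longrightarrow> p \<le> 1/2 \<Longrightarrow> s/4 + s*p - (3 * s-l)*p^2 < L"
  shows "\<exists>(i::int) (j::int) (k::int). qform3 A B C D12 D23 D13 (x-i) (y-j) (z-k) < L"
proof -
  let ?Q = "qform3 A B C D12 D23 D13"
  let ?w0 = "1-x" and ?w1 = "x-y" and ?w2 = "y-z" and ?w3 = "z"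
  let ?D = "D12 + D23 + D13 - A - B - C"
  let ?avg = "?w0 * ?Q x y z + ?w1 * ?Q (x-1) y z + ?w2 * ?Q (x-1) (y-1) z + ?w3 * ?Q (x-1) (y-1) (z-1)"
  have avg: "?avg = ?w0*?w1*A + ?w1*?w2*B + ?w2*?w3*C + ?w0*?w3*?D + ?w1*?w3*D23 + ?w0*?w2*D12"
    by (simp add: qform3_def power2_eq_square algebra_simps)
  have *: "?avg < L"
  proof (cases "D23 \<le> s")
    case True
    have "?avg \<le> ?w0*?w1 * s + ?w1*?w2 * s + ?w2*?w3 * s + ?w0*?w3 * s + ?w1*?w3 * s + ?w0*?w2*l"
      unfolding avg using ord short mixed True by (intro add_mono mult_left_mono) auto
    then show ?thesis
      using kuhn_simplex_bound[of ?w0 ?w1 ?w2 ?w3 s l L] ord s K by (simp add: algebra_simps)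
  next
    case False
    have "?avg \<le> ?w0*?w1 * s + ?w1*?w2 * s + ?w2*?w3 * s + ?w0*?w3 * s + ?w1*?w3*l + ?w0*?w2 * s"
      unfolding avg using ord short mixed False by (intro add_mono mult_left_mono) auto
    then show ?thesis
      using kuhn_simplex_bound[of ?w3 ?w2 ?w1 ?w0 s l L] ord s K by (simp add: algebra_simps)
  qed
  have "?Q x y z < L \<or> ?Q (x-1) y z < L \<or> ?Q (x-1) (y-1) z < L \<or> ?Q (x-1) (y-1) (z-1) < L"
  proof (rule ccontr)
    assume "\<not> ?thesis"
    then have "?w0 * L + ?w1 * L + ?w2 * L + ?w3 * L \<le> ?avg"
      using ord by (intro add_mono mult_left_mono) auto
    with * show False by (simp add: algebra_simps)
  qed
  then show ?thesis
  proof (elim disjE)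
    assume "?Q x y z < L"
    then show ?thesis by (intro exI[of _ 0]) simp
  next
    assume "?Q (x-1) y z < L"
    then show ?thesis by (intro exI[of _ 1] exI[of _ 0]) simp
  next
    assume "?Q (x-1) (y-1) z < L"
    then show ?thesis by (intro exI[of _ 1] exI[of _ 0]) simp
  next
    assume "?Q (x-1) (y-1) (z-1) < L"
    then show ?thesis by (intro exI[of _ 1]) simp
  qed
qed

lemma qform3_perm:
  "qform3 A B C D12 D23 D13 x y z = qform3 A C B D13 D23 D12 x z y"
  "qform3 A B C D12 D23 D13 x y z = qform3 B A C D12 D13 D23 y x z"
  "qform3 A B C D12 D23 D13 x y z = qform3 B C A D23 D13 D12 y z x"
  "qform3 A B C D12 D23 D13 x y z = qform3 C A B D13 D12 D23 z x y"
  "qform3 A B C D12 D23 D13 x y z = qform3 C B A D23 D12 D13 z y x"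
  by (simp_all add: qform3_def algebra_simps)

text \<open>The six orders of the fractional parts cut the cube into six simplices. The one long
  vector \<open>e1+e3\<close> is an edge of four of them, once in each, and of neither of the other
  two.\<close>

lemma covering3:
  assumes s: "0 \<le> s" "s \<le> l"
    and short: "A \<le> s" "B \<le> s" "C \<le> s" "D12 \<le> s" "D23 \<le> s" "D12 + D23 + D13 - A - B - C \<le> s"
    and long: "D13 \<le> l"
    and K: "\<And>p. 0 \<le> p \<Longrightarrow> p \<le> 1/2 \<Longrightarrow> s/4 + s*p - (3 * s-l)*p^2 < L"
  shows "\<exists>(i::int) (j::int) (k::int). qform3 A B C D12 D23 D13 (x-i) (y-j) (z-k) < L"
proof -
  define X Y Z where XYZ: "X = frac x" "Y = frac y" "Z = frac z"
  have fr: "0 \<le> X" "0 \<le> Y" "0 \<le> Z" "X \<le> 1" "Y \<le> 1" "Z \<le> 1"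
    by (auto simp: XYZ frac_lt_1 less_imp_le)
  note cov = covering3_ordered[OF _ _ _ _ s _ _ _ _ _ _ K]
  consider "Z \<le> Y" "Y \<le> X" | "Y \<le> Z" "Z \<le> X" | "Z \<le> X" "X \<le> Y" | "X \<le> Z" "Z \<le> Y"
    | "Y \<le> X" "X \<le> Z" | "X \<le> Y" "Y \<le> Z" by linarith
  then have "\<exists>(i::int) (j::int) (k::int). qform3 A B C D12 D23 D13 (X-i) (Y-j) (Z-k) < L"
  proof cases
    case 1
    show ?thesis by (rule cov) (use 1 fr short long s in auto)
  next
    case 2
    have "\<exists>(i::int) (k::int) (j::int). qform3 A C B D13 D23 D12 (X-i) (Z-k) (Y-j) < L"
      by (rule cov) (use 2 fr short long s in auto)
    then show ?thesis unfolding qform3_perm(1)[of A B C] by blast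
  next
    case 3
    have "\<exists>(j::int) (i::int) (k::int). qform3 B A C D12 D13 D23 (Y-j) (X-i) (Z-k) < L"
      by (rule cov) (use 3 fr short long s in auto)
    then show ?thesis unfolding qform3_perm(2)[of A B C] by blast
  next
    case 4
    have "\<exists>(j::int) (k::int) (i::int). qform3 B C A D23 D13 D12 (Y-j) (Z-k) (X-i) < L"
      by (rule cov) (use 4 fr short long s in auto)
    then show ?thesis unfolding qform3_perm(3)[of A B C] by blast
  next
    case 5
    have "\<exists>(k::int) (i::int) (j::int). qform3 C A B D13 D12 D23 (Z-k) (X-i) (Y-j) < L"
      by (rule cov) (use 5 fr short long s in auto)
    then show ?thesis unfolding qform3_perm(4)[of A B C] by blast
  next
    case 6
    have "\<exists>(k::int) (j::int) (i::int). qform3 C B A D23 D12 D13 (Z-k) (Y-j) (X-i) < L"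
      by (rule cov) (use 6 fr short long s in auto)
    then show ?thesis unfolding qform3_perm(5)[of A B C] by blast
  qed
  then obtain i j k :: int where "qform3 A B C D12 D23 D13 (X-i) (Y-j) (Z-k) < L" by blast
  then show ?thesis
    by (intro exI[of _ "\<lfloor>x\<rfloor> + i"] exI[of _ "\<lfloor>y\<rfloor> + j"] exI[of _ "\<lfloor>z\<rfloor> + k"])
      (simp add: XYZ frac_def algebra_simps)
qed

context gap_quadratic_group
begin

text \<open>\<open>R/3\<close> is the squared circumradius of an equilateral triangle of squared
  side \<open>R\<close>, the hole of a hexagonal lattice.\<close>

lemma extends_to_z_basis_two:
  assumes v: "v1 \<in> carrier G" "v2 \<in> carrier G" "v1 \<noteq> v2" "v1 \<noteq> \<one>" "v2 \<noteq> \<one>" "v1 \<otimes> v2 \<noteq> \<one>"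
    and R: "q v1 \<le> R" "q v2 \<le> R" "q (v1 \<otimes> v2) \<le> R" "R/3 < gap"
  shows "extends_to_z_basis G {v1, v2}"
proof (rule extends_to_z_basis_if_pure)
  let ?B = "{v1, v2}"
  show B: "finite ?B" "?B \<subseteq> carrier G" using v by auto
  have z: "zcomb c ?B = v1 [^] c v1 \<otimes> v2 [^] c v2" for c
    using v by (simp add: zcomb_insert)
  have R0: "0 \<le> R" using nonneg[OF v(1)] R by linarith
  show "z_independent G ?B"
  proof (rule independent_if_subset_sums_short[OF B])
    fix T assume "T \<subseteq> ?B" "T \<noteq> {}"
    then consider "T = {v1}" | "T = {v2}" | "T = ?B" by blast
    then show "zcomb (\<lambda>_. 1) T \<noteq> \<one> \<and> q (zcomb (\<lambda>_. 1) T) < 4 * gap"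
    proof cases
      case 3
      then show ?thesis using v R gap_pos z[of "\<lambda>_. 1"] by auto
    qed (use v R gap_pos in \<open>auto simp: zcomb_insert\<close>)
  qed
  show "pure_subgroup (generate G ?B)"
  proof (rule pure_if_covering[OF B])
    fix c :: "'a \<Rightarrow> int" and N :: int assume N: "N > 0"
    let ?Q = "qform2 (q v1) (q v2) (q (v1 \<otimes> v2))"
    obtain i j :: int where ij: "?Q (c v1 / N - i) (c v2 / N - j) < gap"
      using covering2[OF R R0] by blast
    define d where "d = (\<lambda>b. if b = v1 then i else j)"
    have "q (zcomb (\<lambda>b. c b - N * d b) ?B) = ?Q (c v1 - N * i) (c v2 - N * j)"
      using v unfolding z by (simp add: q_mult q_pow pairing_pow2 d_def qform2_def)
    also have "\<dots> = ?Q (N * (c v1 / N - i)) (N * (c v2 / N - j))"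
      using N by (simp add: right_diff_distrib)
    also have "\<dots> = N^2 * ?Q (c v1 / N - i) (c v2 / N - j)"
      by (simp add: qform2_scale)
    also have "\<dots> < N^2 * gap" using ij N by simp
    finally show "\<exists>d. q (zcomb (\<lambda>b. c b - N * d b) ?B) < N^2 * gap" by (intro exI[of _ d]) simp
  qed
qed

lemma q_mult3:
  assumes "x \<in> carrier G" "y \<in> carrier G" "z \<in> carrier G"
  shows "q (x \<otimes> y \<otimes> z) = q x + q y + q z + pairing x y + pairing y z + pairing x z"
  using assms by (simp add: q_mult pairing_add)

text \<open>The left-hand side of \<open>K\<close> bounds the squared covering radius. For
  \<open>l = 2 * s\<close> its maximum is \<open>s/2\<close>, at \<open>p = 1/2\<close>: the
  octahedral hole of a face-centred cubic lattice of minimal norm \<open>s\<close>.\<close>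

lemma extends_to_z_basis_three:
  assumes v: "v1 \<in> carrier G" "v2 \<in> carrier G" "v3 \<in> carrier G" "v1 \<noteq> v2" "v2 \<noteq> v3" "v1 \<noteq> v3"
    and nz: "v1 \<noteq> \<one>" "v2 \<noteq> \<one>" "v3 \<noteq> \<one>" "v1 \<otimes> v2 \<noteq> \<one>" "v2 \<otimes> v3 \<noteq> \<one>" "v1 \<otimes> v3 \<noteq> \<one>" "v1 \<otimes> v2 \<otimes> v3 \<noteq> \<one>"
    and short: "q v1 \<le> s" "q v2 \<le> s" "q v3 \<le> s" "q (v1 \<otimes> v2) \<le> s" "q (v2 \<otimes> v3) \<le> s"
      "q (v1 \<otimes> v2 \<otimes> v3) \<le> s"
    and long: "q (v1 \<otimes> v3) \<le> l" "s \<le> l"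
    and K: "\<And>p. 0 \<le> p \<Longrightarrow> p \<le> 1/2 \<Longrightarrow> s/4 + s*p - (3 * s-l)*p^2 < gap"
  shows "extends_to_z_basis G {v1, v2, v3}"
proof (rule extends_to_z_basis_if_pure)
  let ?B = "{v1, v2, v3}"
  show B: "finite ?B" "?B \<subseteq> carrier G" using v by auto
  have z: "zcomb c ?B = v1 [^] c v1 \<otimes> v2 [^] c v2 \<otimes> v3 [^] c v3" for c
    using v by (simp add: zcomb_insert m_assoc)
  have s0: "0 \<le> s" using nonneg[OF v(1)] short by linarith
  \<comment> \<open>At \<open>p = 1/2\<close> the left-hand side of \<open>K\<close> equals
    \<open>l/4\<close>. The same hypothesis therefore controls the long sum in the independence
    argument.\<close>
  have l4: "l < 4 * gap" using K[of "1/2"] by (simp add: power2_eq_square field_simps)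
  show "z_independent G ?B"
  proof (rule independent_if_subset_sums_short[OF B])
    fix T assume T: "T \<subseteq> ?B" "T \<noteq> {}"
    have "Pow ?B = {{}, {v1}, {v2}, {v3}, {v1,v2}, {v2,v3}, {v1,v3}, ?B}"
      by (simp add: Pow_insert insert_commute)
    then have "T \<in> {{v1}, {v2}, {v3}, {v1,v2}, {v2,v3}, {v1,v3}, ?B}"
      using T by (metis PowI insert_iff)
    then consider "T = {v1}" | "T = {v2}" | "T = {v3}" | "T = {v1,v2}" | "T = {v2,v3}" | "T = {v1,v3}" | "T = ?B"
      by (elim insertE emptyE)
    then show "zcomb (\<lambda>_. 1) T \<noteq> \<one> \<and> q (zcomb (\<lambda>_. 1) T) < 4 * gap"
      by cases (use v nz short long l4 in \<open>auto simp: zcomb_insert m_assoc\<close>)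
  qed
  show "pure_subgroup (generate G ?B)"
  proof (rule pure_if_covering[OF B])
    fix c :: "'a \<Rightarrow> int" and N :: int assume N: "N > 0"
    let ?Q = "qform3 (q v1) (q v2) (q v3) (q (v1 \<otimes> v2)) (q (v2 \<otimes> v3)) (q (v1 \<otimes> v3))"
    have sum: "q (v1 \<otimes> v2) + q (v2 \<otimes> v3) + q (v1 \<otimes> v3) - q v1 - q v2 - q v3 \<le> s"
      using short(6) v by (simp add: q_mult3 pairing_def)
    obtain i j k :: int where ijk: "?Q (c v1 / N - i) (c v2 / N - j) (c v3 / N - k) < gap"
      using covering3[OF s0 long(2) short(1-5) sum long(1) K] by blast
    define d where "d = (\<lambda>b. if b = v1 then i else if b = v2 then j else k)"
    have "q (zcomb (\<lambda>b. c b - N * d b) ?B) = ?Q (c v1 - N * i) (c v2 - N * j) (c v3 - N * k)"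
      using v unfolding z by (simp add: q_mult3 q_pow pairing_pow2 d_def qform3_def) (simp add: pairing_def)
    also have "\<dots> = ?Q (N * (c v1 / N - i)) (N * (c v2 / N - j)) (N * (c v3 / N - k))"
      using N by (simp add: right_diff_distrib)
    also have "\<dots> = N^2 * ?Q (c v1 / N - i) (c v2 / N - j) (c v3 / N - k)"
      by (simp add: qform3_scale)
    also have "\<dots> < N^2 * gap" using ijk N by simp
    finally show "\<exists>d. q (zcomb (\<lambda>b. c b - N * d b) ?B) < N^2 * gap" by (intro exI[of _ d]) simp
  qed
qed

end

section \<open>Canonical heights\<close>

text \<open>Tate's limit of \<open>h\<close> at the multiples 2^k x, divided by 4^k. The
  parallelogram law is assumed as an upper estimate; in the limit its constant disappears, and
  applying it to the sum and difference of \<open>x\<close> and \<open>y\<close>, whose own sum and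
  difference are the doubles of \<open>x\<close> and \<open>y\<close>, gives the reverse
  inequality.\<close>

lemma (in comm_group) canonical_height_exists:
  fixes h :: "'a \<Rightarrow> real"
  assumes nonneg: "\<And>x. x \<in> carrier G \<Longrightarrow> 0 \<le> h x"
    and double: "\<And>x. x \<in> carrier G \<Longrightarrow> \<bar>h (x \<otimes> x) - 4 * h x\<bar> \<le> C"
    and sub: "\<And>x y. x \<in> carrier G \<Longrightarrow> y \<in> carrier G \<Longrightarrow> h (x \<otimes> y) + h (x \<otimes> inv y) \<le> 2 * h x + 2 * h y + C"
  obtains q where "quadratic_form_group G q" "\<And>x. x \<in> carrier G \<Longrightarrow> \<bar>q x - h x\<bar> \<le> C"
proof -
  define a where "a x k = h (x [^] (2^k::nat)) / 4^k" for x and k :: nat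
  define d where "d x k = a x (Suc k) - a x k" for x k
  have C0: "0 \<le> C" using double[of \<one>] by fastforce
  have a_bound: "norm (d x k) \<le> C / 4 * (1/4)^k" if x: "x \<in> carrier G" for x k
  proof -
    let ?y = "x [^] (2^k::nat)"
    have "x [^] (2^Suc k::nat) = ?y \<otimes> ?y" using x by (simp add: nat_pow_mult mult_2)
    then have "d x k = (h (?y \<otimes> ?y) - 4 * h ?y) / 4^Suc k" by (simp add: d_def a_def field_simps)
    then show ?thesis using double[of ?y] x by (simp add: field_simps power_one_over)
  qed
  have geo: "(\<lambda>k. C / 4 * (1/4::real)^k) sums (C / 3)"
    using sums_mult[OF geometric_sums[of "1/4::real"], of "C/4"] by simp
  define q where "q x = h x + suminf (d x)" for x
  have lim: "a x \<longlonglongrightarrow> q x" and close: "\<bar>q x - h x\<bar> \<le> C / 3" if x: "x \<in> carrier G" for x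
  proof -
    have s: "summable (d x)"
      using summable_comparison_test[OF _ sums_summable[OF geo], of "d x"] a_bound[OF x] by blast
    have "(\<lambda>n. a x 0 + (\<Sum>k<n. d x k)) \<longlonglongrightarrow> a x 0 + suminf (d x)"
      by (intro tendsto_intros summable_LIMSEQ[OF s])
    moreover have "(\<lambda>n. a x 0 + (\<Sum>k<n. d x k)) = a x" by (simp add: d_def sum_lessThan_telescope)
    moreover have "a x 0 = h x" using x by (simp add: a_def)
    ultimately show "a x \<longlonglongrightarrow> q x" by (simp add: q_def)
    show "\<bar>q x - h x\<bar> \<le> C / 3"
      using norm_suminf_le[OF a_bound[OF x] sums_summable[OF geo]] sums_unique[OF geo] by (simp add: q_def)
  qed
  have q0: "0 \<le> q x" if x: "x \<in> carrier G" for x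
    by (rule LIMSEQ_le_const[OF lim[OF x]]) (use nonneg x in \<open>auto simp: a_def\<close>)
  have q2: "q (x \<otimes> x) = 4 * q x" if x: "x \<in> carrier G" for x
  proof (rule LIMSEQ_unique[OF lim])
    have "a (x \<otimes> x) = (\<lambda>k. 4 * a x (Suc k))"
      using x by (simp add: a_def fun_eq_iff nat_pow_mult mult_2 pow_mult_distrib[OF refl x x])
    then show "a (x \<otimes> x) \<longlonglongrightarrow> 4 * q x"
      using tendsto_mult_left[OF LIMSEQ_Suc[OF lim[OF x]], of 4] by simp
  qed (use x in auto)
  have le: "q (x \<otimes> y) + q (x \<otimes> inv y) \<le> 2 * q x + 2 * q y" if x: "x \<in> carrier G" and y: "y \<in> carrier G" for x y
  proof (rule LIMSEQ_le)
    show "(\<lambda>k. a (x \<otimes> y) k + a (x \<otimes> inv y) k) \<longlonglongrightarrow> q (x \<otimes> y) + q (x \<otimes> inv y)"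
      using x y by (intro tendsto_intros lim) auto
    have "(\<lambda>k. C * (1/4)^k) \<longlonglongrightarrow> C * 0" by (intro tendsto_intros LIMSEQ_realpow_zero) auto
    then show "(\<lambda>k. 2 * a x k + 2 * a y k + C * (1/4)^k) \<longlonglongrightarrow> 2 * q x + 2 * q y"
      using x y tendsto_add[OF tendsto_add[OF tendsto_mult_left[OF lim[OF x], of 2] tendsto_mult_left[OF lim[OF y], of 2]]]
      by fastforce
    have "a (x \<otimes> y) k + a (x \<otimes> inv y) k \<le> 2 * a x k + 2 * a y k + C * (1/4)^k" for k
    proof -
      let ?x = "x [^] (2^k::nat)" and ?y = "y [^] (2^k::nat)"
      have "(h (?x \<otimes> ?y) + h (?x \<otimes> inv ?y)) / 4^k \<le> (2 * h ?x + 2 * h ?y + C) / 4^k"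
        using sub x y by (intro divide_right_mono) auto
      moreover have "(x \<otimes> y) [^] (2^k::nat) = ?x \<otimes> ?y" "(x \<otimes> inv y) [^] (2^k::nat) = ?x \<otimes> inv ?y"
        using x y by (simp_all add: nat_pow_distrib nat_pow_inv)
      ultimately show ?thesis by (simp add: a_def add_divide_distrib power_one_over)
    qed
    then show "\<exists>N. \<forall>k\<ge>N. a (x \<otimes> y) k + a (x \<otimes> inv y) k \<le> 2 * a x k + 2 * a y k + C * (1/4)^k" by blast
  qed
  have "quadratic_form_group G q"
  proof unfold_locales
    fix x y assume x: "x \<in> carrier G" and y: "y \<in> carrier G"
    have xx: "(x \<otimes> y) \<otimes> (x \<otimes> inv y) = x \<otimes> x" using x y 
      by (metis inv_closed m_assoc m_closed m_comm r_inv r_one)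
    have yy: "(x \<otimes> y) \<otimes> inv (x \<otimes> inv y) = y \<otimes> y" using x y
      by (simp add: inv_mult) (metis inv_closed m_assoc m_closed m_comm r_inv r_one)
    have "4 * q x + 4 * q y \<le> 2 * q (x \<otimes> y) + 2 * q (x \<otimes> inv y)"
      using le[of "x \<otimes> y" "x \<otimes> inv y"] x y unfolding xx yy by (simp add: q2)
    then show "q (x \<otimes> y) + q (x \<otimes> inv y) = 2 * q x + 2 * q y" using le[OF x y] by linarith
  qed (use q0 in auto)
  moreover have "\<bar>q x - h x\<bar> \<le> C" if "x \<in> carrier G" for x using close[OF that] C0 by linarith
  ultimately show ?thesis using that by blast
qed

section \<open>Bounding the canonical height by one-step inequalities\<close>

context quadratic_form_group
begin

lemma q_double: "x \<in> carrier G \<Longrightarrow> q (x \<otimes> x) = 4 * q x"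
  using pairing_self[of x] by (simp add: q_mult)

text \<open>A positive value would grow at least like 4^k along repeated doubling, against the bound
  \<open>K\<close>.\<close>

lemma nonpos_if_quadrupling:
  assumes quad: "\<And>x. x \<in> carrier G \<Longrightarrow> 4 * f x \<le> f (x \<otimes> x)" and bd: "\<And>x. x \<in> carrier G \<Longrightarrow> f x \<le> (K::real)"
    and x: "x \<in> carrier G"
  shows "f x \<le> 0"
proof (rule ccontr)
  assume "\<not> f x \<le> 0"
  have iter: "4^k * f x \<le> f (x [^] (2^k::nat))" for k
  proof (induction k)
    case (Suc k)
    have "4^Suc k * f x \<le> 4 * f (x [^] (2^k::nat))" using Suc by simp
    also have "\<dots> \<le> f (x [^] (2^k::nat) \<otimes> x [^] (2^k::nat))" using quad x by simp
    also have "x [^] (2^k::nat) \<otimes> x [^] (2^k::nat) = x [^] (2^Suc k::nat)" using x by (simp add: nat_pow_mult mult_2)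
    finally show ?case .
  qed (use x in simp)
  obtain k where "K / f x < 4^k" using real_arch_pow[of 4 "K / f x"] by auto
  then have "K < 4^k * f x" using \<open>\<not> f x \<le> 0\<close> by (simp add: field_simps)
  then show False using iter[of k] bd[of "x [^] (2^k::nat)"] x by simp
qed

text \<open>The shift \<open>c/3\<close> absorbs the error, as
  \<open>4 * (T - c/3) = (4 * T - c) - c/3\<close>. The constant \<open>K\<close> leaves no trace in
  the result.\<close>

lemma q_ge_if_doubling:
  assumes "\<And>x. x \<in> carrier G \<Longrightarrow> T x \<le> q x + K" "\<And>x. x \<in> carrier G \<Longrightarrow> 4 * T x - c \<le> T (x \<otimes> x)" "x \<in> carrier G"
  shows "T x - c/3 \<le> q x"
  using nonpos_if_quadrupling[of "\<lambda>x. T x - c/3 - q x" "K - c/3" x] assms q_double by fastforce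

lemma q_le_if_doubling:
  assumes "\<And>x. x \<in> carrier G \<Longrightarrow> q x \<le> T x + K" "\<And>x. x \<in> carrier G \<Longrightarrow> T (x \<otimes> x) \<le> 4 * T x + c" "x \<in> carrier G"
  shows "q x \<le> T x + c/3"
  using nonpos_if_quadrupling[of "\<lambda>x. q x - T x - c/3" "K - c/3" x] assms q_double by fastforce

end

section \<open>The group law\<close>

fun ec_neg :: "'a::field_char_0 ec_point \<Rightarrow> 'a ec_point" where
  "ec_neg Infinity = Infinity"
| "ec_neg (Point x y) = Point x (- y)"

text \<open>The line \<open>y = l x + k\<close> meets the curve in \<open>x1, x2, x3\<close>, counted with multiplicity; this covers chords
  and tangents alike and is symmetric in the three points.\<close>

definition ec_line :: "'a::field_char_0 \<Rightarrow> 'a \<Rightarrow> 'a \<Rightarrow> 'a \<Rightarrow> 'a \<Rightarrow> 'a \<Rightarrow> 'a \<Rightarrow> bool" where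
  "ec_line a b l k x1 x2 x3 \<longleftrightarrow>
     x1 + x2 + x3 = l^2 \<and> x1*x2 + x1*x3 + x2*x3 = a - 2*l*k \<and> x1*x2*x3 = k^2 - b"

lemma Infinity_on_curve [simp]: "Infinity \<in> ec_points a b"
  by (simp add: ec_points_def)

lemma Point_on_curve [simp]: "Point x y \<in> ec_points a b \<longleftrightarrow> y^2 = x^3 + a*x + b"
  by (auto simp: ec_points_def)

lemma ec_neg_neg [simp]: "ec_neg (ec_neg P) = P"
  by (cases P) auto

lemma ec_neg_on_curve [simp]: "ec_neg P \<in> ec_points a b \<longleftrightarrow> P \<in> ec_points a b"
  by (cases P) auto

lemma ec_add_Infinity_right [simp]: "ec_add a P Infinity = P"
  by (cases P) auto

lemma ec_add_neg [simp]: "ec_add a P (ec_neg P) = Infinity"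
  by (cases P) auto

lemma ec_add_neg' [simp]: "ec_add a (ec_neg P) P = Infinity"
  by (cases P) auto

lemma ec_line_perm:
  assumes "ec_line a b l k x1 x2 x3"
  shows "ec_line a b l k x2 x1 x3" "ec_line a b l k x3 x1 x2" "ec_line a b l k x3 x2 x1"
  using assms by (auto simp: ec_line_def algebra_simps)

lemma ec_line_neg: "ec_line a b l k x1 x2 x3 \<Longrightarrow> ec_line a b (-l) (-k) x1 x2 x3"
  by (simp add: ec_line_def)

lemma ec_line_cubic:
  assumes "ec_line a b l k x1 x2 x3"
  shows "x^3 + a*x + b - (l*x + k)^2 = (x - x1)*(x - x2)*(x - x3)"
proof -
  have a: "a = x1*x2 + x1*x3 + x2*x3 + 2*l*k" and b: "b = k^2 - x1*x2*x3" 
    and l: "l^2 = x1 + x2 + x3"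
    using assms by (auto simp: ec_line_def)
  have "x^3 + a*x + b - (l*x + k)^2 = x^3 + a*x + b - (l^2*x^2 + 2*l*k*x + k^2)"
    by Groebner_Basis.algebra
  then show ?thesis unfolding l a b by Groebner_Basis.algebra
qed

lemma ec_line_on_curve:
  assumes "ec_line a b l k x1 x2 x3"
  shows "Point x1 (l*x1+k) \<in> ec_points a b"
  using ec_line_cubic[OF assms, of x1] by simp

text \<open>The discriminant is a polynomial combination of the cubic and its derivative.\<close>

lemma no_singular_point:
  fixes a b x :: "'a::field_char_0"
  assumes "4*a^3 + 27*b^2 \<noteq> 0" "x^3 + a*x + b = 0" "3*x^2 + a = 0"
  shows False
proof -
  have "4*a^3 + 27*b^2 = (3*x^2+4*a)*(3*x^2+a)^2 - 27*(x^3+a*x-b)*(x^3+a*x+b)"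
    by Groebner_Basis.algebra
  with assms show False by simp
qed

lemma ec_line_tangent:
  assumes "ec_line a b l k x x x3"
  shows "3*x^2 + a = 2*l*(l*x+k)"
proof -
  have "a = x*x + x*x3 + x*x3 + 2*l*k" "x3 = l^2 - 2*x"
    using assms by (auto simp: ec_line_def algebra_simps)
  then show ?thesis by Groebner_Basis.algebra
qed

lemma ec_add_line:
  assumes ns: "4*a^3 + 27*b^2 \<noteq> 0" and L: "ec_line a b l k x1 x2 x3"
  shows "ec_add a (Point x1 (l*x1+k)) (Point x2 (l*x2+k)) = Point x3 (- (l*x3+k))"
proof -
  have x3: "l^2 - x1 - x2 = x3" using L by (auto simp: ec_line_def algebra_simps)
  have neg: "l*(x1 - x3) - (l*x1+k) = - (l*x3+k)" by Groebner_Basis.algebra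
  show ?thesis
  proof (cases "x1 = x2")
    case False
    have s: "(l*x2+k - (l*x1+k)) / (x2 - x1) = l" using False by (simp add: field_simps)
    show ?thesis using False by (simp only: ec_add.simps Let_def s x3 neg simp_thms if_False)
  next
    case True
    have T: "3*x1^2 + a = 2*l*(l*x1+k)" using ec_line_tangent L True by metis
    \<comment> \<open>A point with \<open>y = 0\<close> where the line is tangent would be a double
      root of the cubic.\<close>
    have y0: "l*x1+k \<noteq> 0"
    proof
      assume y: "l*x1+k = 0"
      then have "x1^3 + a*x1 + b = 0" using ec_line_on_curve[OF L] by simp
      with no_singular_point[OF ns] T y show False by auto
    qed
    then have "l*x1+k \<noteq> - (l*x1+k)" by (metis add.inverse_inverse eq_neg_iff_add_eq_0 mult_2 mult_eq_0_iff zero_neq_numeral)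
    moreover have "2*l*y/(2*y) = l" if "y \<noteq> 0" for y :: 'a using that by simp
    from this[OF y0] have s: "(3*x1^2+a) / (2*(l*x1+k)) = l" unfolding T .
    moreover have "l^2 - x1 - x1 = x3" using x3 True by simp
    ultimately show ?thesis using True by (simp only: ec_add.simps Let_def s neg[unfolded True] simp_thms if_False if_True)
  qed
qed

lemma ec_line_exists:
  assumes P: "Point x1 y1 \<in> ec_points a b" and Q: "Point x2 y2 \<in> ec_points a b"
    and ne: "Point x1 y1 \<noteq> ec_neg (Point x2 y2)"
  obtains l k x3 where "ec_line a b l k x1 x2 x3" "y1 = l*x1+k" "y2 = l*x2+k"
proof -
  have p: "y1^2 = x1^3 + a*x1 + b" and q: "y2^2 = x2^3 + a*x2 + b" using P Q by auto
  show ?thesis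
  proof (cases "x1 = x2")
    case False
    define l where "l = (y2-y1)/(x2-x1)"
    define k where "k = y1 - l*x1"
    have y1: "y1 = l*x1+k" by (simp add: k_def)
    have "l*(x2-x1) = y2 - y1" using False by (simp add: l_def)
    then have y2: "y2 = l*x2+k" by (simp add: k_def algebra_simps)
    have "(x1-x2) * (x1*x2 + (x1+x2)*(l^2-x1-x2) - (a - 2*l*k)) = 0"
      using p q unfolding y1 y2 by Groebner_Basis.algebra
    then have e2: "x1*x2 + (x1+x2)*(l^2-x1-x2) = a - 2*l*k" using False by simp
    have "x1*x2*(l^2-x1-x2) = k^2-b" using p e2 unfolding y1 by Groebner_Basis.algebra
    then have "ec_line a b l k x1 x2 (l^2-x1-x2)" using e2 by (simp add: ec_line_def algebra_simps)
    then show ?thesis using that y1 y2 by blast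
  next
    case True
    have "(y1-y2)*(y1+y2) = 0" using p q True by Groebner_Basis.algebra
    moreover have "y1 + y2 \<noteq> 0" using ne True by (simp add: add_eq_0_iff2)
    ultimately have y: "y2 = y1" "y1 \<noteq> 0" by auto
    define l where "l = (3*x1^2+a)/(2*y1)"
    define k where "k = y1 - l*x1"
    have y1: "y1 = l*x1+k" by (simp add: k_def)
    have "2*l*y1 = 3*x1^2+a" using y by (simp add: l_def)
    then have e2: "x1*x1 + (x1+x1)*(l^2-x1-x1) = a - 2*l*k" unfolding y1 by Groebner_Basis.algebra
    have "x1*x1*(l^2-x1-x1) = k^2-b" using p e2 unfolding y1 by Groebner_Basis.algebra
    then have "ec_line a b l k x1 x1 (l^2-x1-x1)" using e2 by (simp add: ec_line_def algebra_simps)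
    then show ?thesis using that y1 y True by metis
  qed
qed

lemma ec_add_cases:
  assumes ns: "4*a^3 + 27*b^2 \<noteq> 0" and "P \<in> ec_points a b" "Q \<in> ec_points a b"
  obtains "P = Infinity" | "Q = Infinity" | "P = ec_neg Q"
  | l k x1 x2 x3 where "ec_line a b l k x1 x2 x3" "P = Point x1 (l*x1+k)" "Q = Point x2 (l*x2+k)"
      "ec_add a P Q = Point x3 (- (l*x3+k))"
proof (cases P)
  case Infinity
  then show ?thesis using that by blast
next
  case P: (Point x1 y1)
  show ?thesis
  proof (cases Q)
    case Infinity
    then show ?thesis using that by blast
  next
    case Q: (Point x2 y2)
    show ?thesis
    proof (cases "P = ec_neg Q")
      case True
      then show ?thesis using that by blast
    next
      case False
      then obtain l k x3 where "ec_line a b l k x1 x2 x3" "y1 = l*x1+k" "y2 = l*x2+k"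
        using ec_line_exists[of x1 y1 a b x2 y2] assms P Q by blast
      then show ?thesis using that(4) ec_add_line[OF ns] P Q by metis
    qed
  qed
qed

lemma ec_add_closed:
  assumes ns: "4*a^3 + 27*b^2 \<noteq> 0" and "P \<in> ec_points a b" "Q \<in> ec_points a b"
  shows "ec_add a P Q \<in> ec_points a b"
proof (cases rule: ec_add_cases[OF assms])
  case (4 l k x1 x2 x3)
  then show ?thesis using ec_line_on_curve[OF ec_line_neg[OF ec_line_perm(2)[OF 4(1)]]] by simp
qed (use assms in auto)

lemma ec_add_commute:
  assumes ns: "4*a^3 + 27*b^2 \<noteq> 0" and "P \<in> ec_points a b" "Q \<in> ec_points a b"
  shows "ec_add a P Q = ec_add a Q P"
proof (cases rule: ec_add_cases[OF assms])
  case (4 l k x1 x2 x3)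
  then show ?thesis using ec_add_line[OF ns ec_line_perm(1)[OF 4(1)]] by simp
qed auto

text \<open>The one instance of associativity that follows directly from the symmetry of
  \<open>ec_line\<close>, by negating the line and permuting its points. It makes translations
  injective, which the general proof uses.\<close>

lemma ec_add_cancel:
  assumes ns: "4*a^3 + 27*b^2 \<noteq> 0" and "P \<in> ec_points a b" "Q \<in> ec_points a b"
  shows "ec_add a (ec_add a P Q) (ec_neg Q) = P"
proof (cases rule: ec_add_cases[OF assms])
  case (4 l k x1 x2 x3)
  then show ?thesis
    using ec_add_line[OF ns ec_line_neg[OF ec_line_perm(3)[OF 4(1)]]] by simp
qed auto

lemma ec_add_distinct:
  assumes "x1 \<noteq> x2" "(y2 - y1) / (x2 - x1) = l"
  shows "ec_add a (Point x1 y1) (Point x2 y2) = Point (l^2 - x1 - x2) (l*(x1 - (l^2 - x1 - x2)) - y1)"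
  using assms(1) by (simp only: ec_add.simps Let_def assms(2) simp_thms if_False)

text \<open>With \<open>r\<close> the vertical distance of \<open>Z\<close> to the line \<open>y = l x + k\<close> through \<open>A\<close> and \<open>B\<close> and \<open>t = r / (x3 - x2)\<close>,
  the three further chords have slopes \<open>l + t\<close>, \<open>s\<close> and \<open>s - t\<close>, where \<open>s = (x3 - x1) / t - l\<close>.\<close>

lemma ec_add_assoc_line:
  fixes a :: "'a::field_char_0"
  assumes L: "ec_line a b l k x1 x2 x4"
    and Z: "Point x3 y3 \<in> ec_points a b"
    and r: "y3 \<noteq> l*x3 + k"
    and d2: "x3 \<noteq> x2" and d4: "x3 \<noteq> x4"
    and BZ: "ec_add a (Point x2 (l*x2+k)) (Point x3 y3) = Point x5 y5" and d5: "x5 \<noteq> x1"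
  shows "ec_add a (Point x4 (- (l*x4+k))) (Point x3 y3)
       = ec_add a (Point x1 (l*x1+k)) (ec_add a (Point x2 (l*x2+k)) (Point x3 y3))"
proof -
  define t where "t = (y3 - (l*x3+k)) / (x3 - x2)"
  define s where "s = (x3 - x1) / t - l"
  have t0: "t \<noteq> 0" using r d2 by (simp add: t_def)
  have y3: "y3 = t*(x3-x2) + (l*x3+k)" using d2 by (simp add: t_def)
  have ty: "y3 - (l*x3+k) = t*(x3-x2)" using y3 by simp
  have d1: "x3 - x1 = t*(s + l)" using t0 by (simp add: s_def)
  have l2: "l^2 = x1 + x2 + x4" using L by (simp add: ec_line_def)
  have Z': "(y3 - (l*x3+k)) * (y3 + (l*x3+k)) = (x3-x1)*(x3-x2)*(x3-x4)"
    using ec_line_cubic[OF L, of x3] Z by (simp add: algebra_simps power2_eq_square)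
  have "t * (x3-x2) * (y3 + (l*x3+k)) = t*(x3-x2)*((s+l)*(x3-x4))"
    using Z' unfolding ty d1 by (simp only: mult_ac)
  then have ys: "y3 + (l*x3+k) = (s+l)*(x3-x4)" using t0 d2 by simp
  have m4: "(y3 - (-(l*x4+k))) / (x3 - x4) = s"
  proof -
    have "y3 + (l*x4+k) = s*(x3-x4)" using ys by Groebner_Basis.algebra
    then show ?thesis using d4 by (simp add: field_simps)
  qed
  have m2: "(y3 - (l*x2+k)) / (x3 - x2) = l + t"
  proof -
    have "y3 - (l*x2+k) = (l+t)*(x3-x2)" using y3 by Groebner_Basis.algebra
    then show ?thesis using d2 by (simp add: field_simps)
  qed
  have P5: "x5 = (l+t)^2 - x2 - x3" "y5 = (l+t)*(x2-x5) - (l*x2+k)"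
    using ec_add_distinct[OF d2[symmetric] m2, of a] BZ by auto
  have m5: "(y5 - (l*x1+k)) / (x5 - x1) = s - t"
  proof -
    have "y5 - (l*x1+k) = (s-t)*(x5-x1)" using P5 y3 d1 l2 ys by Groebner_Basis.algebra
    then show ?thesis using d5 by (simp add: field_simps)
  qed
  have x: "s^2 - x4 - x3 = (s-t)^2 - x1 - x5"
    using P5 d1 l2 by Groebner_Basis.algebra
  have y: "s*(x4 - (s^2-x4-x3)) + (l*x4+k) = (s-t)*(x1 - ((s-t)^2-x1-x5)) - (l*x1+k)"
    unfolding x[symmetric] using d1 l2 ys ty by Groebner_Basis.algebra
  show ?thesis
    unfolding BZ ec_add_distinct[OF d4[symmetric] m4] ec_add_distinct[OF d5[symmetric] m5]
    using x y by simp
qed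


section \<open>Associativity: generic triples, translation over the complex numbers, descent to the
  rationals\<close>

lemma infinite_complex_curve: "infinite (ec_points a (b::complex))"
proof -
  have "range (\<lambda>x::complex. Point x (csqrt (x^3+a*x+b))) \<subseteq> ec_points a b"
    by (auto simp: power2_csqrt)
  moreover have "inj (\<lambda>x::complex. Point x (csqrt (x^3+a*x+b)))"
    by (rule injI) simp
  ultimately show ?thesis
    using infinite_super range_inj_infinite finite_imageD infinite_UNIV_char_0 by metis
qed

lemma ec_add_eq_iff:
  assumes ns: "4*a^3 + 27*b^2 \<noteq> 0" and "P \<in> ec_points a b" "Q \<in> ec_points a b" "R \<in> ec_points a b"
  shows "ec_add a P Q = R \<longleftrightarrow> P = ec_add a R (ec_neg Q)"
  using ec_add_cancel[OF ns assms(2,3)] ec_add_cancel[OF ns assms(4), of "ec_neg Q"] assms by auto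

text \<open>For given \<open>A\<close> and \<open>B\<close> the excluded \<open>Z\<close> are
  finitely many: those for which two of the points on the chords of \<open>ec_add_assoc_line\<close>
  share an x-coordinate, namely Z = B, A + B or B + Z = A up to sign, and Z = A, which would put
  \<open>Z\<close> on the first line.\<close>

lemma ec_add_assoc_generic:
  assumes ns: "4*a^3 + 27*b^2 \<noteq> 0"
    and A: "A \<in> ec_points a b" and B: "B \<in> ec_points a b" and Z: "Z \<in> ec_points a b"
    and gen: "Z \<noteq> Infinity" "Z \<noteq> B" "Z \<noteq> ec_neg B" "Z \<noteq> ec_add a A B" "Z \<noteq> ec_neg (ec_add a A B)"
      "Z \<noteq> A" "Z \<noteq> ec_add a A (ec_neg B)" "Z \<noteq> ec_add a (ec_neg A) (ec_neg B)"
  shows "ec_add a (ec_add a A B) Z = ec_add a A (ec_add a B Z)"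
proof (cases rule: ec_add_cases[OF ns A B])
  case 3
  have "ec_add a A (ec_add a B Z) = ec_add a (ec_add a Z B) (ec_neg B)"
    using ec_add_commute[OF ns] A B Z 3 ec_add_closed[OF ns] by (metis ec_neg_on_curve)
  then show ?thesis using 3 ec_add_cancel[OF ns Z B] by simp
next
  case (4 l k x1 x2 x4)
  obtain x3 y3 where Z': "Z = Point x3 y3" using gen by (cases Z) auto
  have on: "y3^2 = x3^3 + a*x3 + b" using Z Z' by simp
  have xne: "x3 \<noteq> x" if "Point x y \<in> ec_points a b" "Z \<noteq> Point x y" "Z \<noteq> Point x (-y)" for x y
  proof
    assume "x3 = x"
    then have "(y3-y)*(y3+y) = 0" using that(1) on by (simp add: algebra_simps power2_eq_square)
    then show False using that(2,3) Z' \<open>x3 = x\<close> by (auto simp: add_eq_0_iff2)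
  qed
  have d2: "x3 \<noteq> x2" using xne[of x2 "l*x2+k"] 4 B gen by simp
  have d4: "x3 \<noteq> x4" using xne[of x4 "-(l*x4+k)"] 4 ec_add_closed[OF ns A B] gen by simp
  have r: "y3 \<noteq> l*x3+k"
  proof
    assume r: "y3 = l*x3+k"
    then have "(x3-x1)*(x3-x2)*(x3-x4) = 0"
      using ec_line_cubic[OF 4(1), of x3] on by simp
    then have "x3 = x1" using d2 d4 by simp
    then show False using gen Z' r 4 by simp
  qed
  have BZ: "ec_add a B Z \<in> ec_points a b" using ec_add_closed[OF ns B Z] .
  have BZ': "ec_add a B Z = ec_add a Z B" using ec_add_commute[OF ns B Z] .
  show ?thesis
  proof (cases "ec_add a B Z")
    case Infinity
    then have "Z = ec_neg B" using ec_add_eq_iff[OF ns Z B, of Infinity] BZ' by simp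
    then show ?thesis using gen by simp
  next
    case (Point x5 y5)
    have "x5 \<noteq> x1"
    proof
      assume "x5 = x1"
      then have "(y5-(l*x1+k))*(y5+(l*x1+k)) = 0" using BZ A 4 Point by (simp add: algebra_simps power2_eq_square)
      then have "ec_add a Z B = A \<or> ec_add a Z B = ec_neg A"
        using BZ' Point 4 \<open>x5 = x1\<close> by (auto simp: add_eq_0_iff2)
      then show False using ec_add_eq_iff[OF ns Z B, of A] ec_add_eq_iff[OF ns Z B, of "ec_neg A"] A gen by auto
    qed
    then show ?thesis
      using ec_add_assoc_line[OF 4(1) _ r d2 d4] Z Z' 4 Point by simp
  qed
qed auto

text \<open>An auxiliary \<open>Z\<close> is added: ((P+Q)+S)+Z = (P+Q)+(S+Z) = P+(Q+(S+Z)) =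
  P+((Q+S)+Z) = (P+(Q+S))+Z, where each step is a generic instance, and then \<open>Z\<close> is
  cancelled. Infinitely many points are needed to avoid \<open>F\<close>, and the rational points
  may be too few.\<close>

lemma ec_add_assoc_complex:
  fixes a b :: complex
  assumes ns: "4*a^3 + 27*b^2 \<noteq> 0"
    and P: "P \<in> ec_points a b" and Q: "Q \<in> ec_points a b" and S: "S \<in> ec_points a b"
  shows "ec_add a (ec_add a P Q) S = ec_add a P (ec_add a Q S)"
proof -
  note cl = ec_add_closed[OF ns] and co = ec_add_commute[OF ns]
  define bad where "bad A B = {Infinity, B, ec_neg B, ec_add a A B, ec_neg (ec_add a A B), A,
    ec_add a A (ec_neg B), ec_add a (ec_neg A) (ec_neg B)}" for A B
  have assoc: "ec_add a (ec_add a A B) Z = ec_add a A (ec_add a B Z)"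
    if "A \<in> ec_points a b" "B \<in> ec_points a b" "Z \<in> ec_points a b" "Z \<notin> bad A B" for A B Z
    using ec_add_assoc_generic[OF ns that(1-3)] that(4) by (simp add: bad_def)
  define F where "F = bad (ec_add a P Q) S \<union> (\<lambda>W. ec_add a W (ec_neg S)) ` bad P Q \<union> bad Q S \<union> bad P (ec_add a Q S)"
  have "finite F" by (simp add: F_def bad_def)
  then obtain Z where Z: "Z \<in> ec_points a b" "Z \<notin> F"
    using infinite_complex_curve[of a b] by (meson finite_subset subsetI)
  have "ec_add a S Z \<notin> bad P Q"
  proof
    assume "ec_add a S Z \<in> bad P Q"
    moreover have "Z = ec_add a (ec_add a S Z) (ec_neg S)" using co Z S ec_add_cancel[OF ns Z(1) S] by simp
    ultimately show False using Z by (auto simp: F_def)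
  qed
  then have "ec_add a (ec_add a (ec_add a P Q) S) Z = ec_add a (ec_add a P (ec_add a Q S)) Z"
    using assoc Z P Q S cl by (simp add: F_def)
  then show ?thesis using ec_add_cancel[OF ns _ Z(1)] cl P Q S by metis
qed

fun ec_of_rat :: "rat ec_point \<Rightarrow> complex ec_point" where
  "ec_of_rat Infinity = Infinity"
| "ec_of_rat (Point x y) = Point (of_rat x) (of_rat y)"

lemma ec_of_rat_on_curve: "P \<in> ec_points a b \<Longrightarrow> ec_of_rat P \<in> ec_points (of_rat a) (of_rat b)"
  by (cases P) (auto simp flip: of_rat_power of_rat_mult of_rat_add)

lemma ec_of_rat_inj: "ec_of_rat P = ec_of_rat Q \<longleftrightarrow> P = Q"
  by (cases P; cases Q) auto

lemma ec_of_rat_add: "ec_of_rat (ec_add a P Q) = ec_add (of_rat a) (ec_of_rat P) (ec_of_rat Q)"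
proof (cases P; cases Q)
  fix x1 y1 x2 y2 assume "P = Point x1 y1" "Q = Point x2 y2"
  moreover have "of_rat y1 = - (of_rat y2 :: complex) \<longleftrightarrow> y1 = - y2"
    by (metis of_rat_eq_iff of_rat_minus)
  ultimately show ?thesis
    by (simp add: Let_def of_rat_add of_rat_diff of_rat_mult of_rat_divide of_rat_power of_rat_minus)
qed auto

lemma ec_add_assoc:
  fixes a b :: rat
  assumes ns: "4*a^3 + 27*b^2 \<noteq> 0"
    and P: "P \<in> ec_points a b" and Q: "Q \<in> ec_points a b" and S: "S \<in> ec_points a b"
  shows "ec_add a (ec_add a P Q) S = ec_add a P (ec_add a Q S)"
proof -
  have "of_rat (4*a^3 + 27*b^2) \<noteq> (0::complex)" using ns by simp
  then have "4*(of_rat a)^3 + 27*(of_rat b)^2 \<noteq> (0::complex)"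
    by (simp add: of_rat_add of_rat_mult of_rat_power)
  from ec_add_assoc_complex[OF this] have "ec_of_rat (ec_add a (ec_add a P Q) S) = ec_of_rat (ec_add a P (ec_add a Q S))"
    using P Q S ec_of_rat_on_curve by (simp add: ec_of_rat_add)
  then show ?thesis by (simp add: ec_of_rat_inj)
qed

lemma ec_group_comm_group:
  fixes a b :: rat
  assumes ns: "4*a^3 + 27*b^2 \<noteq> 0"
  shows "comm_group (ec_group a b)"
proof (rule comm_groupI)
  fix P assume "P \<in> carrier (ec_group a b)"
  then show "\<exists>Q\<in>carrier (ec_group a b). Q \<otimes>\<^bsub>ec_group a b\<^esub> P = \<one>\<^bsub>ec_group a b\<^esub>"
    by (intro bexI[of _ "ec_neg P"]) (auto simp: ec_group_def)
qed (use ec_add_closed[OF ns] ec_add_assoc[OF ns] ec_add_commute[OF ns] in \<open>auto simp: ec_group_def\<close>)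

section \<open>Cancellation in the duplication formula\<close>

text \<open>Together with \<open>xden\<close> this is the projective x-coordinate in lowest terms;
  \<open>Infinity\<close> is 1/0, so homogeneous identities hold there as well.\<close>

definition xnum :: "rat ec_point \<Rightarrow> int" where
  "xnum P = (case P of Infinity \<Rightarrow> 1 | Point x y \<Rightarrow> fst (quotient_of x))"

definition xden :: "rat ec_point \<Rightarrow> int" where
  "xden P = (case P of Infinity \<Rightarrow> 0 | Point x y \<Rightarrow> snd (quotient_of x))"

lemma xnum_Infinity [simp]: "xnum Infinity = 1" and xden_Infinity [simp]: "xden Infinity = 0"
  by (simp_all add: xnum_def xden_def)

lemma coprime_xnum_xden: "coprime (xnum P) (xden P)"
  by (cases P) (auto simp: xnum_def xden_def quotient_of_coprime prod.collapse)

lemma xden_nonneg: "xden P \<ge> 0"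
  by (cases P) (auto simp: xden_def quotient_of_denom_pos' less_imp_le)

lemma xden_Point_pos: "xden (Point x y) > 0"
  by (simp add: xden_def quotient_of_denom_pos')

lemma xcoord_eq: "x = of_int (xnum (Point x y)) / of_int (xden (Point x y))"
  by (simp add: xnum_def xden_def quotient_of_div)

lemma xcoord_of_int [simp]: "xnum (Point (of_int k) y) = k" "xden (Point (of_int k) y) = 1"
  by (simp_all add: xnum_def xden_def)

text \<open>With \<open>x = u/w\<close>, the homogenised numerator of the x-coordinate of 2P;
  \<open>dup_den\<close> is the denominator, four times the homogenised \<open>y^2\<close>.\<close>

definition dup_num :: "int \<Rightarrow> int \<Rightarrow> int \<Rightarrow> int \<Rightarrow> int" where
  "dup_num m n u w = (u^2 + m^2*w^2)^2 - 8*n^2*u*w^3"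

definition cubic :: "int \<Rightarrow> int \<Rightarrow> int \<Rightarrow> int \<Rightarrow> int" where
  "cubic m n u w = u^3 - m^2*u*w^2 + n^2*w^3"

definition dup_den :: "int \<Rightarrow> int \<Rightarrow> int \<Rightarrow> int \<Rightarrow> int" where
  "dup_den m n u w = 4*w*cubic m n u w"

text \<open>Whether the point with \<open>x = u / w\<close> reduces to the singular point modulo 2, respectively 3.\<close>

definition sing2 :: "int \<Rightarrow> int \<Rightarrow> int \<Rightarrow> bool" where
  "sing2 m u w \<longleftrightarrow> (if odd m then odd u \<and> odd w else even u)"

definition sing3 :: "int \<Rightarrow> int \<Rightarrow> int \<Rightarrow> bool" where
  "sing3 m u w \<longleftrightarrow> 3 dvd m \<and> 3 dvd (u + w)"

definition cancel :: "int \<Rightarrow> int \<Rightarrow> int \<Rightarrow> int" where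
  "cancel m u w = (if sing2 m u w then 4 else 1) * (if sing3 m u w then 9 else 1)"

lemma square_mod3: "\<not> 3 dvd x \<Longrightarrow> 3 dvd x^2 - (1::int)"
proof -
  assume "\<not> 3 dvd x"
  then have "x mod 3 = 1 \<or> x mod 3 = 2" by presburger
  then have "3 dvd x - 1 \<or> 3 dvd x + 1" by presburger
  moreover have "x^2 - 1 = (x-1)*(x+1)" by (simp add: power2_eq_square algebra_simps)
  ultimately show ?thesis by auto
qed

lemma cube_mod3: "3 dvd x^3 - (x::int)"
proof (cases "3 dvd x")
  case False
  have "x^3 - x = x * (x^2 - 1)" by (simp add: eval_nat_numeral algebra_simps)
  then show ?thesis using square_mod3[OF False] by simp
next
  case True
  have "x^3 - x = x * (x^2 - 1)" by (simp add: eval_nat_numeral algebra_simps)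
  then show ?thesis using True by simp
qed

lemma prime_3_dvd_power: "3 dvd x^k \<Longrightarrow> 3 dvd (x::int)"
  using prime_dvd_power[of "3::int"] by simp

section \<open>The common factor of the two duplication polynomials\<close>

locale squarefree_curve =
  fixes m n :: int
  assumes m_pos: "m > 0" and n_pos: "n > 0" and coprime_mn: "coprime m n" and one: "m = 1 \<or> n = 1"
    and squarefree: "\<And>p :: int. prime p \<Longrightarrow> p > 3 \<Longrightarrow> \<not> p^2 dvd disc m n"
begin

lemma odd_n_if_even_m: "even m \<Longrightarrow> odd n"
  using one by auto

lemma n_one_if_3_dvd_m: "3 dvd m \<Longrightarrow> n = 1"
  using one by auto

text \<open>If \<open>p\<close> divides both, the point is singular modulo \<open>p\<close>; as \<open>w * cubic\<close> is a square, \<open>p\<^sup>2\<close> divides both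
  the cubic and the square of its derivative, hence the discriminant.\<close>

lemma large_prime_not_dvd:
  assumes cop: "coprime u w" and sq: "w * cubic m n u w = s^2" and p: "prime p" "p > 3"
    and N: "p dvd dup_num m n u w" and D: "p dvd dup_den m n u w"
  shows False
proof -
  define F' where "F' = 3*u^2 - m^2*w^2"
  have pw: "\<not> p dvd w"
  proof
    assume pw: "p dvd w"
    have "dup_num m n u w = u^4 + w * (2*u^2*m^2*w + m^4*w^3 - 8*n^2*u*w^2)"
      by (simp add: dup_num_def eval_nat_numeral algebra_simps)
    then have "p dvd u^4" using N pw by (metis dvd_add_left_iff dvd_mult2)
    then have "p dvd u" using p prime_dvd_power by blast
    then show False using pw cop p by (meson coprime_common_divisor not_prime_unit)
  qed
  have "\<not> p dvd 4"
  proof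
    assume "p dvd 4"
    then have "p dvd 2" using p(1) prime_dvd_power[of p 2 2] by simp
    then show False using p(2) by (auto dest: zdvd_imp_le)
  qed
  then have "p dvd cubic m n u w" using D p(1) pw by (auto simp: dup_den_def prime_dvd_mult_iff)
  then have "p dvd s^2" unfolding sq[symmetric] by simp
  then have "p dvd s" using p(1) prime_dvd_power by blast
  then have "p^2 dvd w * cubic m n u w" unfolding sq by simp
  moreover have "coprime (p^2) w" using p(1) pw prime_imp_coprime by auto
  ultimately have F: "p^2 dvd cubic m n u w" by (simp add: coprime_dvd_mult_right_iff)
  have "dup_num m n u w = F'^2 - 8*u*cubic m n u w"
    by (simp add: dup_num_def cubic_def F'_def eval_nat_numeral algebra_simps)
  then have "p dvd F'^2" using N \<open>p dvd cubic m n u w\<close>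
    by (metis diff_add_cancel dvd_add dvd_mult)
  then have "p dvd F'" using p(1) prime_dvd_power by blast
  then have "p^2 dvd F'^2" by simp
  \<comment> \<open>The identity of \<open>no_singular_point\<close>, homogenised; both terms on the
    right are divisible by \<open>p^2\<close>.\<close>
  have "(27*n^4 - 4*m^6)*w^6 = (3*u^2-4*m^2*w^2)*F'^2 - 27*(u^3-m^2*u*w^2-n^2*w^3)*cubic m n u w"
    unfolding F'_def cubic_def by Groebner_Basis.algebra
  then have "p^2 dvd (27*n^4 - 4*m^6)*w^6" using F \<open>p^2 dvd F'^2\<close> by simp
  moreover have "coprime (p^2) (w^6)" using \<open>coprime (p^2) w\<close> by simp
  ultimately have "p^2 dvd 27*n^4 - 4*m^6" by (simp add: coprime_dvd_mult_left_iff)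
  then have "p^2 dvd disc m n" unfolding disc_def by (rule dvd_mult)
  then show False using squarefree p by blast
qed

text \<open>At a point singular modulo 2 the common factor 4 is exact: for odd \<open>m\<close>
  because \<open>dup_num\<close> is 4 modulo 8, for even \<open>m\<close> because
  \<open>w * cubic m n u w\<close>, a quarter of \<open>dup_den\<close>, is odd. The last parts also
  decide whether 2P is again singular.\<close>

lemma dup_parity:
  assumes "coprime u w"
  shows "\<not> sing2 m u w \<Longrightarrow> odd (dup_num m n u w)"
    and "sing2 m u w \<Longrightarrow> 4 dvd dup_num m n u w"
    and "sing2 m u w \<Longrightarrow> odd m \<Longrightarrow> odd (dup_num m n u w div 4)"
    and "sing2 m u w \<Longrightarrow> even m \<Longrightarrow> even (dup_num m n u w div 4)"
    and "sing2 m u w \<Longrightarrow> even m \<Longrightarrow> odd (w * cubic m n u w)"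
    and "sing2 m u w \<Longrightarrow> odd m \<Longrightarrow> odd n \<Longrightarrow> odd (w * cubic m n u w)"
proof -
  have uw: "\<not> (even u \<and> even w)" using assms by (meson coprime_common_divisor odd_one)
  show "odd (dup_num m n u w)" if "\<not> sing2 m u w"
    using that uw by (auto simp: dup_num_def sing2_def split: if_splits)
  have c1: "dup_num m n u w mod 8 = 4" if "odd u" "odd w" "odd m"
  proof -
    have "odd (m*w)" using that by simp
    then obtain b where b: "m*w = 2*b+1" by (rule oddE)
    have "odd u" using that by simp
    then obtain a where a: "u = 2*a+1" by (rule oddE)
    note abc = a b
    have "dup_num m n u w = 8 * (2*a*(a+1)*a*(a+1) + 2*b*(b+1)*b*(b+1) + 4*a*(a+1)*b*(b+1) + 2*a*(a+1) + 2*b*(b+1) - n^2*u*w^3) + 4"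
    proof -
      have "dup_num m n u w = ((2*a+1)^2 + (2*b+1)^2)^2 - 8*(n^2*u*w^3)"
        unfolding dup_num_def abc[symmetric] by (simp add: power_mult_distrib)
      also have "((2*a+1)^2 + (2*b+1)^2)^2 = 8 * (2*a*(a+1)*a*(a+1) + 2*b*(b+1)*b*(b+1) + 4*a*(a+1)*b*(b+1) + 2*a*(a+1) + 2*b*(b+1)) + 4"
        by (simp add: eval_nat_numeral algebra_simps)
      finally show ?thesis by simp
    qed
    then show ?thesis by presburger
  qed
  have c2: "8 dvd dup_num m n u w" if "even u" "even m"
  proof -
    have ev: "even u" "even m" using that by simp_all
    obtain a where a: "u = 2*a" using ev(1) by (rule evenE)
    obtain b where b: "m = 2*b" using ev(2) by (rule evenE)
    note ab = a b
    have "dup_num m n u w = 8 * (2*(a^2+b^2*w^2)^2 - n^2*u*w^3)"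
      unfolding dup_num_def ab by (simp add: eval_nat_numeral algebra_simps)
    then show ?thesis by simp
  qed
  show "4 dvd dup_num m n u w" if "sing2 m u w"
    using that c1 c2 by (auto simp: sing2_def split: if_splits) presburger+
  show "odd (dup_num m n u w div 4)" if "sing2 m u w" "odd m"
    using that c1 by (simp add: sing2_def) presburger
  show "even (dup_num m n u w div 4)" if "sing2 m u w" "even m"
    using that c2 by (simp add: sing2_def) presburger
  show "odd (w * cubic m n u w)" if "sing2 m u w" "even m"
    using that uw odd_n_if_even_m by (auto simp: sing2_def cubic_def)
  show "odd (w * cubic m n u w)" if "sing2 m u w" "odd m" "odd n"
    using that by (auto simp: sing2_def cubic_def)
qed

text \<open>Modulo 3 the curve is the cuspidal cubic \<open>y^2 = (x+1)^3\<close>. Its smooth points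
  form a group of order 3, where 2P = -P, so doubling preserves the x-coordinate up to the common
  factor \<open>(u+w)^3\<close>.\<close>

lemma dup_mod3:
  assumes "3 dvd m"
  shows "3 dvd dup_num m n u w - u*(u+w)^3" "3 dvd dup_den m n u w - w*(u+w)^3"
proof -
  obtain k where k: "m = 3*k" using assms by blast
  have n: "n = 1" using n_one_if_3_dvd_m[OF assms] .
  have "dup_num m n u w - u*(u+w)^3 = 3 * (6*k^2*u^2*w^2 + 27*k^4*w^4 - 3*u*w^3 - u^3*w - u^2*w^2)"
    by (simp add: dup_num_def k n eval_nat_numeral algebra_simps)
  then show "3 dvd dup_num m n u w - u*(u+w)^3" by simp
  have "dup_den m n u w - w*(u+w)^3 = 3 * (w*u^3 + w^4 - w^2*u^2 - w^3*u - 12*k^2*u*w^3)"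
    by (simp add: dup_den_def cubic_def k n eval_nat_numeral algebra_simps)
  then show "3 dvd dup_den m n u w - w*(u+w)^3" by simp
qed

lemma coprime_not_3_dvd: "coprime u (w::int) \<Longrightarrow> \<not> (3 dvd u \<and> 3 dvd w)"
  by (metis coprime_common_divisor dvd_refl numeral_One numeral_eq_one_iff semiring_norm(86) zdvd1_eq abs_numeral)

text \<open>If 3 does not divide \<open>m\<close>, a common factor 3 forces 3 to divide
  \<open>n\<close> and then makes -1 a square modulo 3.\<close>

lemma dup_mod3_nonsing:
  assumes cop: "coprime u w" and ns: "\<not> sing3 m u w"
    and N: "3 dvd dup_num m n u w" and D: "3 dvd dup_den m n u w"
  shows False
proof (cases "3 dvd m")
  case True
  have "3 dvd u*(u+w)^3" "3 dvd w*(u+w)^3"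
    using dup_mod3[OF True, of u w] N D by (metis dvd_diffD1 dvd_diff_right_iff)+
  moreover have "\<not> 3 dvd (u+w)^3" using ns True prime_3_dvd_power by (auto simp: sing3_def)
  ultimately have "3 dvd u" "3 dvd w" using prime_dvd_mult_iff[of "3::int"] by simp_all
  then show False using coprime_not_3_dvd[OF cop] by blast
next
  case False
  have nw: "\<not> 3 dvd w"
  proof
    assume w: "3 dvd w"
    have "dup_num m n u w = u^4 + w * (2*u^2*m^2*w + m^4*w^3 - 8*n^2*u*w^2)"
      by (simp add: dup_num_def eval_nat_numeral algebra_simps)
    then have "3 dvd u^4" using N w by (metis dvd_add_left_iff dvd_mult2)
    then show False using w coprime_not_3_dvd[OF cop] prime_3_dvd_power by blast
  qed
  have m2: "3 dvd m^2 - 1" and w2: "3 dvd w^2 - 1" using square_mod3 False nw by auto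
  have "3 dvd w * cubic m n u w"
    using D prime_dvd_mult_iff[of "3::int" 4 "w * cubic m n u w"] by (simp add: dup_den_def mult.assoc)
  then have F: "3 dvd cubic m n u w" using nw prime_dvd_mult_iff[of "3::int"] by simp
  have "n^2*w^3 = cubic m n u w - (u^3 - u) + u*w^2*(m^2-1) + u*(w^2-1)"
    by (simp add: cubic_def algebra_simps)
  then have "3 dvd n^2*w^3" using F cube_mod3[of u] m2 w2 by (simp add: dvd_diff dvd_add)
  then have n: "3 dvd n" using nw prime_dvd_mult_iff[of "3::int"] prime_3_dvd_power by auto
  have "(u^2 + m^2*w^2)^2 = dup_num m n u w + n*(8*n*u*w^3)" by (simp add: dup_num_def power2_eq_square)
  then have "3 dvd (u^2 + m^2*w^2)^2" using N n by simp
  then have 1: "3 dvd u^2 + m^2*w^2" by (rule prime_3_dvd_power)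
  have "3 dvd (u^2 + m^2*w^2) - (m^2-1)*w^2 - (w^2-1)"
    by (rule dvd_diff[OF dvd_diff[OF 1 dvd_mult2[OF m2]] w2])
  also have "(u^2 + m^2*w^2) - (m^2-1)*w^2 - (w^2-1) = u^2 + 1" by (simp add: algebra_simps)
  finally have 2: "3 dvd u^2 + 1" .
  show False
  proof (cases "3 dvd u")
    case True
    then have "3 dvd u^2" by (simp add: power2_eq_square)
    then show False using 2 by presburger
  next
    case False
    then show False using 2 square_mod3[OF False] by presburger
  qed
qed

text \<open>Both claims hold because \<open>N1 + D1\<close> is 1 modulo 3. The last one says that 2P
  avoids the cusp \<open>x = -1\<close>.\<close>

lemma dup_mod3_sing:
  assumes cop: "coprime u w" and sing: "sing3 m u w"
  obtains N1 D1 where "dup_num m n u w = 9 * N1" "dup_den m n u w = 9 * D1"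
    "\<not> (3 dvd N1 \<and> 3 dvd D1)" "\<not> 3 dvd N1 + D1"
proof -
  obtain k where k: "m = 3*k" using sing by (auto simp: sing3_def)
  have n: "n = 1" using n_one_if_3_dvd_m k by simp
  obtain t where "u + w = 3*t" using sing by (auto simp: sing3_def)
  then have u: "u = 3*t - w" by simp
  have nw: "\<not> 3 dvd w" using coprime_not_3_dvd[OF cop] u by auto
  define N1 where "N1 = u*(t-w)*(3*t^2+w^2) + 2*k^2*u^2*w^2 + 9*k^4*w^4"
  define D1 where "D1 = 4*w*(t*(3*t^2-3*t*w+w^2) - k^2*u*w^2)"
  have 1: "dup_num m n u w = 9 * N1" 
    by (simp add: dup_num_def N1_def u k n eval_nat_numeral algebra_simps)
  have 2: "dup_den m n u w = 9 * D1" 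
    by (simp add: dup_den_def cubic_def D1_def u k n eval_nat_numeral algebra_simps)
  obtain c where c: "w^2 = 3*c + 1" using square_mod3[OF nw] by (metis add_diff_cancel_right' diff_add_cancel dvdE)
  have "3 dvd N1 - (1 - w*t + 2*k^2)"
  proof -
    have "N1 - (1 - w*t + 2*k^2) = 3 * (t*(t-w)*(3*t^2+w^2) - w*(t-w)*t^2 + 2*k^2*w^2*(3*t^2-2*t*w) + 3*k^4*w^4
        - w*t*c + c*(w^2+1) + 2*k^2*c*(w^2+1))"
      using c unfolding N1_def u by Groebner_Basis.algebra
    then show ?thesis by simp
  qed
  moreover have "3 dvd D1 - (w*t + k^2)"
  proof -
    have "D1 - (w*t + k^2) = 3 * (4*w*t*(t^2-t*w) - 4*w^3*k^2*t + w*t*(w^2+c) + k^2*(w^4 + c*(w^2+1)))"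
      using c unfolding D1_def u by Groebner_Basis.algebra
    then show ?thesis by simp
  qed
  ultimately have "\<not> (3 dvd N1 \<and> 3 dvd D1)" "\<not> 3 dvd N1 + D1" by presburger+
  then show ?thesis using that 1 2 by blast
qed

lemma cancel_pos: "cancel m u w > 0"
  by (simp add: cancel_def)

text \<open>Square-freeness of the discriminant is what excludes primes above 3; at 2 and 3 the
  exact power is read off from congruences.\<close>

lemma gcd_dup:
  assumes cop: "coprime u w" and sq: "w * cubic m n u w = s^2"
  shows "gcd (dup_num m n u w) (dup_den m n u w) = cancel m u w"
proof -
  let ?N = "dup_num m n u w" and ?D = "dup_den m n u w"
  have D4: "?D = 4 * (w * cubic m n u w)" by (simp add: dup_den_def)
  have dvd3: "(if sing3 m u w then 9 else 1) dvd ?N" "(if sing3 m u w then 9 else 1) dvd ?D"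
    using dup_mod3_sing[OF cop] by (metis dvd_triv_left one_dvd)+
  have dvd2: "(if sing2 m u w then 4 else 1) dvd ?N" "(if sing2 m u w then 4 else 1) dvd ?D"
    using dup_parity[OF cop] D4 by auto
  have "coprime (4::int) 9" by code_simp
  then have "coprime (if sing2 m u w then 4 else 1 :: int) (if sing3 m u w then 9 else 1)" by simp
  then have dvd: "cancel m u w dvd ?N" "cancel m u w dvd ?D"
    unfolding cancel_def using dvd2 dvd3 by (blast intro: divides_mult)+
  then obtain N1 D1 where ND: "?N = cancel m u w * N1" "?D = cancel m u w * D1" by (auto elim!: dvdE)
  have "coprime N1 D1"
  proof (rule ccontr)
    assume "\<not> coprime N1 D1"
    then have "\<exists>p. prime p \<and> p dvd gcd N1 D1"
    proof (cases "gcd N1 D1 = 0")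
      case True
      then show ?thesis by (intro exI[of _ 2]) simp
    next
      case False
      then show ?thesis using \<open>\<not> coprime N1 D1\<close> prime_divisor_exists[of "gcd N1 D1"]
        by (auto simp: coprime_iff_gcd_eq_1)
    qed
    then obtain p where p: "prime p" "p dvd N1" "p dvd D1" by auto
    then have pND: "p dvd ?N" "p dvd ?D" using ND by simp_all
    have "p > 1" using p(1) prime_gt_1_int by blast
    then consider "p = 2" | "p = 3" | "p > 3" by linarith
    then show False
    proof cases
      case 1
      show False
      proof (cases "sing2 m u w")
        case True
        define g3 :: int where "g3 = (if sing3 m u w then 9 else 1)"
        have "?N = 4 * (g3 * N1)" "4 * (w * cubic m n u w) = 4 * (g3 * D1)" 
          using ND True D4 by (simp_all add: cancel_def g3_def)
        then have "?N div 4 = g3 * N1" "w * cubic m n u w = g3 * D1" by simp_all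
        then have "even (?N div 4)" "even (w * cubic m n u w)" using p 1 by simp_all
        then show False using dup_parity[OF cop] True by blast
      next
        case False
        then show False using dup_parity(1)[OF cop False] pND 1 by simp
      qed
    next
      case 2
      show False
      proof (cases "sing3 m u w")
        case True
        then obtain N' D' where *: "?N = 9 * N'" "?D = 9 * D'" "\<not> (3 dvd N' \<and> 3 dvd D')"
          using dup_mod3_sing[OF cop] by metis
        then have "N' = (if sing2 m u w then 4 else 1) * N1" "D' = (if sing2 m u w then 4 else 1) * D1"
          using ND True by (auto simp: cancel_def split: if_splits)
        then have "3 dvd N'" "3 dvd D'" using p 2 by simp_all
        then show False using * by blast
      next
        case False
        then show False using dup_mod3_nonsing[OF cop False] pND 2 by simp
      qed
    next
      case 3
      then show False using large_prime_not_dvd[OF cop sq p(1) 3] pND by blast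
    qed
  qed
  then have "gcd ?N ?D = \<bar>cancel m u w\<bar>" unfolding ND by (simp add: gcd_mult_distrib_int[symmetric])
  then show ?thesis using cancel_pos[of u w] by simp
qed

text \<open>Meant for the reduced coordinates of P and 2P; coprimality of \<open>u'\<close> and
  \<open>w'\<close> makes the factor of proportionality an integer, of either sign. Singularity
  modulo 2 is never gained by doubling and is kept if \<open>n\<close> is odd; modulo 3 the double
  is never singular.\<close>

lemma dup_reduced:
  assumes cop: "coprime u w" and sq: "w * cubic m n u w = s^2"
    and cop': "coprime u' w'" and cross: "dup_num m n u w * w' = dup_den m n u w * u'"
  obtains g where "dup_num m n u w = g * u'" "dup_den m n u w = g * w'" "\<bar>g\<bar> = cancel m u w"
    and "sing2 m u' w' \<Longrightarrow> sing2 m u w" and "odd n \<Longrightarrow> sing2 m u w \<Longrightarrow> sing2 m u' w'"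
    and "\<not> sing3 m u' w'"
proof -
  let ?N = "dup_num m n u w" and ?D = "dup_den m n u w"
  have "u' dvd ?N"
    using cross cop' by (metis coprime_dvd_mult_left_iff dvd_triv_right)
  then obtain g0 where N0: "?N = g0 * u'" by (metis dvdE mult.commute)
  obtain g where N: "?N = g * u'" and D: "?D = g * w'"
  proof (cases "u' = 0")
    case True
    then have "\<bar>w'\<bar> = 1" using cop' by simp
    then have "w' * w' = 1" by (metis abs_mult_self_eq mult_1)
    then have "?D = (?D * w') * w'" by (simp add: mult.assoc)
    moreover have "?N = (?D * w') * u'" using N0 True by simp
    ultimately show ?thesis using that by blast
  next
    case False
    have "?D * u' = (g0 * w') * u'" using cross unfolding N0 by (simp only: mult_ac)
    then have "?D = g0 * w'" using False mult_right_cancel by blast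
    then show ?thesis using that N0 by blast
  qed
  have "gcd ?N ?D = \<bar>g\<bar>" unfolding N D using cop' by (simp add: gcd_mult_distrib_int[symmetric])
  then have g: "\<bar>g\<bar> = cancel m u w" using gcd_dup[OF cop sq] by simp
  have D4: "?D = 4 * (w * cubic m n u w)" by (simp add: dup_den_def)
  note par = dup_parity[OF cop]
  show ?thesis
  proof (rule that[OF N D g])
    assume s: "sing2 m u' w'"
    show "sing2 m u w"
    proof (rule ccontr)
      assume "\<not> sing2 m u w"
      then have "odd (g * u')" using par(1) N by simp
      moreover from this have "even w'" using D D4 by (metis dvd_triv_left even_mult_iff even_numeral)
      ultimately show False using s by (auto simp: sing2_def split: if_splits)
    qed
  next
    assume n: "odd n" and s: "sing2 m u w"
    define g3 :: int where "g3 = (if sing3 m u w then 9 else 1)"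
    have "\<bar>g\<bar> = 4 * g3" using g s by (simp add: cancel_def g3_def)
    then have "g = 4 * (sgn g * g3)" by (metis mult.assoc mult.commute mult_sgn_abs)
    then obtain h where h: "g = 4 * h" "odd h"
      using \<open>\<bar>g\<bar> = 4 * g3\<close> by (auto simp: g3_def sgn_if split: if_splits)
    have "?N div 4 = h * u'" "w * cubic m n u w = h * w'" using N D D4 h by simp_all
    then show "sing2 m u' w'" using par(3-6)[OF s] n h(2) 
      by (cases "odd m") (simp_all add: sing2_def)
  next
    show "\<not> sing3 m u' w'"
    proof
      assume s': "sing3 m u' w'"
      then have m: "3 dvd m" and s'': "3 dvd u' + w'" by (auto simp: sing3_def)
      have sum: "?N + ?D = g * (u' + w')" using N D by (simp add: algebra_simps)
      show False
      proof (cases "sing3 m u w")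
        case True
        define g2 :: int where "g2 = (if sing2 m u w then 4 else 1)"
        obtain N1 D1 where 1: "?N = 9 * N1" "?D = 9 * D1" "\<not> 3 dvd N1 + D1"
          using dup_mod3_sing[OF cop True] by metis
        have "\<bar>g\<bar> = 9 * g2" using g True by (simp add: cancel_def g2_def)
        then have "g = 9 * (sgn g * g2)" by (metis mult.assoc mult.commute mult_sgn_abs)
        then have "9 * (N1 + D1) = 9 * (sgn g * g2 * (u' + w'))" using sum 1 by (metis distrib_left mult.assoc)
        then have "N1 + D1 = sgn g * g2 * (u' + w')" by simp
        then show False using 1(3) s'' by simp
      next
        case False
        then have "\<not> 3 dvd (u+w)^4" using prime_3_dvd_power m by (auto simp: sing3_def)
        moreover have "(u+w)^4 = ?N + ?D - (?N - u*(u+w)^3) - (?D - w*(u+w)^3)"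
          by (simp add: eval_nat_numeral algebra_simps)
        moreover have "3 dvd ?N + ?D" using sum s'' by simp
        ultimately show False using dup_mod3[OF m, of u w] by (metis dvd_diff)
      qed
    qed
  qed
qed

end

section \<open>The naive height\<close>

lemma xcoordE:
  obtains "P = Infinity"
  | x y where "P = Point x y" "xden P > 0" "x = of_int (xnum P) / of_int (xden P)"
  using xcoord_eq xden_Point_pos by (cases P) auto

lemma rational_square_root_int:
  assumes "(r::rat)^2 = of_int k"
  obtains s :: int where "r = of_int s"
proof -
  obtain p d where pd: "quotient_of r = (p, d)" by force
  then have d: "d > 0" "coprime p d" "r = of_int p / of_int d"
    using quotient_of_denom_pos quotient_of_coprime quotient_of_div by blast+
  have "(of_int (p^2) :: rat) = of_int (k * d^2)"
    using assms d by (simp add: field_simps)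
  then have "p^2 = k * d^2" using of_int_eq_iff by blast
  then have "d^2 dvd p^2" by simp
  then have "d dvd p" by simp
  then have "d = 1" using d by (metis coprime_common_divisor dvd_refl zdvd1_eq abs_of_pos)
  then show ?thesis using that d by simp
qed

text \<open>The x-coordinates of P+Q and P-Q differ only in the sign of \<open>2*y1*y2\<close>, so
  their sum and product depend on \<open>x1\<close> and \<open>x2\<close> alone.\<close>

lemma chord_sum_prod:
  fixes a b :: "'a::field_char_0"
  assumes P: "y1^2 = x1^3 + a*x1 + b" and Q: "y2^2 = x2^3 + a*x2 + b" and ne: "x1 \<noteq> x2"
    and x3: "x3 = ((y2 - y1)/(x2 - x1))^2 - x1 - x2" and x4: "x4 = ((-y2 - y1)/(x2 - x1))^2 - x1 - x2"
  shows "(x3 + x4) * (x1-x2)^2 = 2*((x1+x2)*(x1*x2+a) + 2*b)"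
    and "x3 * x4 * (x1-x2)^2 = (x1*x2-a)^2 - 4*b*(x1+x2)"
proof -
  define A where "A = (x1+x2)*(x1*x2+a) + 2*b"
  have d: "(x2-x1)^2 \<noteq> 0" using ne by simp
  have "x3 * (x2-x1)^2 = (y2-y1)^2 - (x1+x2)*(x2-x1)^2"
    unfolding x3 power_divide using d by (simp add: left_diff_distrib) (simp add: algebra_simps)
  then have 3: "x3 * (x1-x2)^2 = A - 2*y1*y2" using P Q unfolding A_def by Groebner_Basis.algebra
  have "x4 * (x2-x1)^2 = (-y2-y1)^2 - (x1+x2)*(x2-x1)^2"
    unfolding x4 power_divide using d by (simp add: left_diff_distrib) (simp add: algebra_simps)
  then have 4: "x4 * (x1-x2)^2 = A + 2*y1*y2" using P Q unfolding A_def by Groebner_Basis.algebra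
  show "(x3 + x4) * (x1-x2)^2 = 2*((x1+x2)*(x1*x2+a) + 2*b)" 
    using 3 4 by (simp add: distrib_right A_def)
  have "(x1-x2)^2 * (x3 * x4 * (x1-x2)^2) = (A - 2*y1*y2) * (A + 2*y1*y2)"
    unfolding 3[symmetric] 4[symmetric] by (simp add: mult_ac)
  also have "\<dots> = A^2 - 4 * y1^2 * y2^2" by (simp add: power2_eq_square algebra_simps)
  also have "\<dots> = (x1-x2)^2 * ((x1*x2-a)^2 - 4*b*(x1+x2))"
    unfolding P Q A_def by Groebner_Basis.algebra
  finally show "x3 * x4 * (x1-x2)^2 = (x1*x2-a)^2 - 4*b*(x1+x2)" using ne by simp
qed

text \<open>The three bounded numbers are the coefficients of
  \<open>(w1 X + u1) (w2 X + u2)\<close>: the height of a product of linear polynomials controls the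
  product of their heights.\<close>

lemma max_mult_le:
  fixes u1 w1 u2 w2 c :: int
  assumes "\<bar>w1*w2\<bar> \<le> c" "\<bar>u1*w2 + u2*w1\<bar> \<le> c" "\<bar>u1*u2\<bar> \<le> c"
  shows "max \<bar>u1\<bar> \<bar>w1\<bar> * max \<bar>u2\<bar> \<bar>w2\<bar> \<le> 2 * c"
proof -
  have mixed: "\<bar>u1\<bar> * \<bar>w2\<bar> \<le> 2 * c"
    if "\<bar>w1\<bar> \<le> \<bar>u1\<bar>" "\<bar>u1*w2 + u2*w1\<bar> \<le> c" "\<bar>u1*u2\<bar> \<le> c" for u1 w1 u2 w2 :: int
  proof -
    have "\<bar>u2*w1\<bar> \<le> \<bar>u1*u2\<bar>"
      using mult_left_mono[OF that(1), of "\<bar>u2\<bar>"] by (simp add: abs_mult mult.commute)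
    moreover have "\<bar>u1*w2\<bar> \<le> \<bar>u1*w2 + u2*w1\<bar> + \<bar>u2*w1\<bar>" by linarith
    ultimately show ?thesis using that by (simp add: abs_mult)
  qed
  have c0: "0 \<le> c" using assms(1) by linarith
  consider "\<bar>w1\<bar> \<le> \<bar>u1\<bar>" "\<bar>w2\<bar> \<le> \<bar>u2\<bar>" | "\<bar>u1\<bar> \<le> \<bar>w1\<bar>" "\<bar>u2\<bar> \<le> \<bar>w2\<bar>"
    | "\<bar>w1\<bar> \<le> \<bar>u1\<bar>" "\<bar>u2\<bar> \<le> \<bar>w2\<bar>" | "\<bar>u1\<bar> \<le> \<bar>w1\<bar>" "\<bar>w2\<bar> \<le> \<bar>u2\<bar>" by linarith
  then show ?thesis
  proof cases
    case 1
    then show ?thesis using assms(3) c0 by (simp add: max_def abs_mult)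
  next
    case 2
    then show ?thesis using assms(1) c0 by (simp add: max_def abs_mult)
  next
    case 3
    then show ?thesis using mixed[OF 3(1) assms(2,3)] by (simp add: max_absorb1 max_absorb2)
  next
    case 4
    have "\<bar>u2*w1 + u1*w2\<bar> \<le> c" using assms(2) by (subst add.commute)
    moreover have "\<bar>u2*u1\<bar> \<le> c" using assms(3) by (subst mult.commute)
    ultimately have "\<bar>u2\<bar> * \<bar>w1\<bar> \<le> 2 * c" using mixed[OF 4(2)] by blast
    moreover have "max \<bar>u1\<bar> \<bar>w1\<bar> = \<bar>w1\<bar>" "max \<bar>u2\<bar> \<bar>w2\<bar> = \<bar>u2\<bar>" using 4 by simp_all
    ultimately show ?thesis by (simp only: mult.commute)
  qed
qed

text \<open>Gauss's lemma for the same two linear polynomials.\<close>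

lemma coprime_product_coeffs:
  fixes u1 w1 u2 w2 :: int
  assumes "coprime u1 w1" "coprime u2 w2"
  shows "coprime (w1*w2) (gcd (u1*w2 + u2*w1) (u1*u2))"
proof (rule ccontr)
  let ?d = "gcd (w1*w2) (gcd (u1*w2 + u2*w1) (u1*u2))"
  assume "\<not> ?thesis"
  then have "\<not> is_unit ?d" by (simp only: is_unit_gcd not_False_eq_True)
  moreover have "?d \<noteq> 0"
    using assms by auto
  ultimately obtain p where "p dvd ?d" "prime p" using prime_divisor_exists by blast
  then have p: "prime p" "p dvd w1*w2" "p dvd u1*w2 + u2*w1" "p dvd u1*u2" by simp_all
  have no: "False" if "p dvd u" "p dvd w" "coprime u w" for u w :: int
    using that p(1) by (meson coprime_common_divisor not_prime_unit)
  have step: False if "p dvd u1" "coprime u1 w1" "coprime u2 w2" "p dvd w1*w2" "p dvd u1*w2 + u2*w1" for u1 w1 u2 w2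
  proof -
    have "\<not> p dvd w1" using that no by blast
    then have "p dvd w2" using that(4) p(1) by (simp add: prime_dvd_mult_iff)
    then have "p dvd u2*w1" using that(5) by (metis dvd_add_right_iff dvd_mult)
    then have "p dvd u2" using \<open>\<not> p dvd w1\<close> p(1) by (simp add: prime_dvd_mult_iff)
    then show False using that(3) \<open>p dvd w2\<close> no by blast
  qed
  have "p dvd u1 \<or> p dvd u2" using p by (simp add: prime_dvd_mult_iff)
  then show False
  proof
    assume "p dvd u1"
    then show False using step[of u1 w1 u2 w2] assms p by blast
  next
    assume "p dvd u2"
    then show False using step[of u2 w2 u1 w1] assms p by (simp add: mult.commute add.commute)
  qed
qed

definition naive :: "rat ec_point \<Rightarrow> int" where
  "naive P = max \<bar>xnum P\<bar> \<bar>xden P\<bar>"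

lemma naive_Infinity [simp]: "naive Infinity = 1"
  by (simp add: naive_def)

lemma naive_ge_1: "naive P \<ge> 1"
proof -
  have "\<not> (xnum P = 0 \<and> xden P = 0)" using coprime_xnum_xden[of P] by auto
  then show ?thesis unfolding naive_def by linarith
qed

lemma xnum_ec_neg [simp]: "xnum (ec_neg P) = xnum P" and xden_ec_neg [simp]: "xden (ec_neg P) = xden P"
  by (cases P; simp add: xnum_def xden_def)+

lemma naive_ec_neg [simp]: "naive (ec_neg P) = naive P"
  by (simp add: naive_def)

lemma finite_naive_le: "finite {P \<in> ec_points a b. naive P \<le> N}"
proof -
  define X where "X = (\<lambda>(u,w). of_int u / of_int w :: rat) ` ({-N..N} \<times> {-N..N})"
  have fin: "finite {y. y^2 = c}" for c :: rat
  proof (cases "\<exists>z. z^2 = c")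
    case True
    then obtain z where "z^2 = c" by blast
    then have "{y. y^2 = c} \<subseteq> {z, -z}" by (auto simp: power2_eq_iff)
    then show ?thesis by (rule finite_subset) simp
  qed simp
  have "{P \<in> ec_points a b. naive P \<le> N} \<subseteq> insert Infinity (\<Union>x\<in>X. Point x ` {y. y^2 = x^3 + a*x + b})"
  proof
    fix P assume P: "P \<in> {P \<in> ec_points a b. naive P \<le> N}"
    show "P \<in> insert Infinity (\<Union>x\<in>X. Point x ` {y. y^2 = x^3 + a*x + b})"
    proof (cases P rule: xcoordE)
      case (2 x y)
      have "xnum P \<in> {-N..N}" "xden P \<in> {-N..N}" using P by (auto simp: naive_def)
      then have "x \<in> X" unfolding X_def 2(3) by (intro image_eqI[of _ _ "(xnum P, xden P)"]) auto
      moreover have "y^2 = x^3 + a*x + b" using P 2(1) by simp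
      ultimately show ?thesis unfolding 2(1) by blast
    qed simp
  qed
  moreover have "finite (insert Infinity (\<Union>x\<in>X. Point x ` {y. y^2 = x^3 + a*x + b}))"
    by (simp add: X_def fin)
  ultimately show ?thesis by (rule finite_subset)
qed

section \<open>Integral equations for the coordinates of P and 2P\<close>

context squarefree_curve
begin

abbreviation coefA :: rat where "coefA \<equiv> - ((of_int m)^2)"
abbreviation coefB :: rat where "coefB \<equiv> (of_int n)^2"
abbreviation pts :: "rat ec_point set" where "pts \<equiv> ec_points coefA coefB"

lemma nonsingular: "4*coefA^3 + 27*coefB^2 \<noteq> 0"
proof -
  have "27*n^4 - 4*m^6 \<noteq> 0"
  proof (cases "m = 1")
    case True
    have "n^4 \<ge> 1" using n_pos by simp
    then show ?thesis using True by simp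
  next
    case False
    then have "n = 1" using one by simp
    have "27 - 4*k \<noteq> 0" for k :: int by presburger
    then show ?thesis using \<open>n = 1\<close> by simp
  qed
  moreover have "4*coefA^3 + 27*coefB^2 = of_int (27*n^4 - 4*m^6)"
    by (simp add: eval_nat_numeral)
  ultimately show ?thesis by (metis of_int_eq_0_iff)
qed

lemma carrier_mw [simp]: "carrier (mordell_weil m n) = pts"
  and mult_mw [simp]: "monoid.mult (mordell_weil m n) = ec_add coefA"
  and one_mw [simp]: "monoid.one (mordell_weil m n) = Infinity"
  by (simp_all add: mordell_weil_def ec_group_def)

lemma mw_comm_group: "comm_group (mordell_weil m n)"
  unfolding mordell_weil_def by (rule ec_group_comm_group[OF nonsingular])

lemma inv_mw: "P \<in> pts \<Longrightarrow> inv\<^bsub>mordell_weil m n\<^esub> P = ec_neg P"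
  using group.inv_equality[OF comm_group.axioms(2)[OF mw_comm_group], of "ec_neg P" P] by simp

lemma cubic_eq:
  assumes "Point x y \<in> pts" "x = of_int u / of_int w" "w > 0"
  shows "y^2 = of_int (cubic m n u w) / of_int w^3"
proof -
  have id: "(u/w)^3 - m^2*(u/w) + n^2 = (u^3 - m^2*u*w^2 + n^2*w^3) / w^3" if "w \<noteq> 0" for u w m n :: rat
    using that by (simp add: field_simps eval_nat_numeral)
  have "y^2 = (of_int u/of_int w)^3 - of_int m^2 * (of_int u/of_int w) + of_int n^2"
    using assms(1) unfolding Point_on_curve assms(2) by simp
  also have "\<dots> = (of_int u^3 - of_int m^2 * of_int u * of_int w^2 + of_int n^2 * of_int w^3) / of_int w^3"
    using assms(3) by (intro id) simp
  finally show ?thesis by (simp add: cubic_def)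
qed

text \<open>The left-hand side is the square of the rational number \<open>w^2 * y\<close>, and a
  rational number with integral square is an integer.\<close>

lemma cubic_square:
  assumes "P \<in> pts"
  obtains s where "xden P * cubic m n (xnum P) (xden P) = s^2"
proof (cases P rule: xcoordE)
  case 1
  then show ?thesis using that[of 0] by simp
next
  case (2 x y)
  let ?u = "xnum P" and ?w = "xden P"
  have y2: "y^2 = of_int (cubic m n ?u ?w) / of_int ?w^3" using assms 2(1) by (intro cubic_eq[OF _ 2(3,2)]) simp
  have "(w^2)^2 * (F / w^3) = w * F" if "w \<noteq> 0" for w F :: rat
    using that by (simp add: field_simps eval_nat_numeral)
  then have e: "(of_int ?w^2 * y)^2 = of_int (?w * cubic m n ?u ?w)"
    unfolding power_mult_distrib y2 using 2(2) by simp
  then obtain s :: int where "of_int ?w^2 * y = of_int s" using rational_square_root_int by blast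
  then have "(of_int (s^2) :: rat) = of_int (?w * cubic m n ?u ?w)" using e by simp
  then have "s^2 = ?w * cubic m n ?u ?w" using of_int_eq_iff by blast
  then show ?thesis using that by metis
qed

text \<open>Stated by cross-multiplication in order to include \<open>P = Infinity\<close> and
  points with \<open>y = 0\<close>, where both denominators vanish.\<close>

lemma dup_cross:
  assumes P: "P \<in> pts"
  shows "dup_num m n (xnum P) (xden P) * xden (ec_add coefA P P)
       = dup_den m n (xnum P) (xden P) * xnum (ec_add coefA P P)"
proof (cases P rule: xcoordE)
  case 1
  then show ?thesis by (simp add: dup_den_def)
next
  case (2 x y)
  define u w where uw: "u = xnum P" "w = xden P"
  have w: "w > 0" "x = of_int u / of_int w" using 2(2,3) unfolding uw .
  have y2: "y^2 = of_int (cubic m n u w) / of_int w^3" using P 2(1) by (intro cubic_eq[OF _ w(2,1)]) simp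
  show ?thesis
  proof (cases "y = 0")
    case True
    then have "cubic m n u w = 0" using y2 w(1) by simp
    moreover have "xden (ec_add coefA P P) = 0" using True unfolding 2(1) by simp
    ultimately show ?thesis unfolding uw[symmetric] by (simp add: dup_den_def)
  next
    case False
    define F where "F = cubic m n u w"
    have F0: "F \<noteq> 0" using y2 False w(1) F_def by auto
    define x' where "x' = ((3*x^2 + coefA) / (2*y))^2 - x - x"
    have "y \<noteq> - y" using False by simp
    then have PP: "ec_add coefA P P = Point x' (((3*x^2 + coefA) / (2*y)) * (x - x') - y)"
      unfolding 2(1) by (simp add: Let_def x'_def)
    have "x' = ((3*x^2 + coefA)^2 - 8*x*y^2) / (4*y^2)"
      using False by (simp add: x'_def power_divide field_simps)
    also have "\<dots> = of_int (dup_num m n u w) / of_int (dup_den m n u w)"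
    proof -
      have "(3*x^2 + coefA)^2 - 8*x*y^2 = of_int (dup_num m n u w) / of_int w^4"
        unfolding y2 w(2) using w(1) by (simp add: dup_num_def cubic_def field_simps eval_nat_numeral)
      moreover have "4*y^2 = of_int (dup_den m n u w) / of_int w^4"
        unfolding y2 using w(1) by (simp add: dup_den_def field_simps eval_nat_numeral)
      ultimately show ?thesis using w(1) by simp
    qed
    finally have x': "x' = of_int (dup_num m n u w) / of_int (dup_den m n u w)" .
    have D0: "dup_den m n u w \<noteq> 0" using F0 w(1) by (simp add: dup_den_def F_def)
    let ?Q = "ec_add coefA P P"
    have Q: "xden ?Q > 0" "x' = of_int (xnum ?Q) / of_int (xden ?Q)"
      unfolding PP by (rule xden_Point_pos, rule xcoord_eq)
    have "(of_int (dup_num m n u w * xden ?Q) :: rat) = of_int (dup_den m n u w * xnum ?Q)"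
      using x' Q D0 by (simp add: field_simps)
    then show ?thesis unfolding uw using of_int_eq_iff by blast
  qed
qed

lemma double_coords:
  assumes P: "P \<in> pts"
  defines "u \<equiv> xnum P" and "w \<equiv> xden P" and "u' \<equiv> xnum (ec_add coefA P P)" and "w' \<equiv> xden (ec_add coefA P P)"
  obtains g where "dup_num m n u w = g * u'" "dup_den m n u w = g * w'" "\<bar>g\<bar> = cancel m u w"
    and "sing2 m u' w' \<Longrightarrow> sing2 m u w" and "odd n \<Longrightarrow> sing2 m u w \<Longrightarrow> sing2 m u' w'"
    and "\<not> sing3 m u' w'"
proof -
  obtain s where s: "w * cubic m n u w = s^2" using cubic_square[OF P] unfolding u_def w_def by blast
  show ?thesis
    using dup_reduced[OF _ s, of u' w'] dup_cross[OF P] coprime_xnum_xden that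
    unfolding u_def w_def u'_def w'_def by metis
qed

end

text \<open>Each such \<open>M\<close> differs from the naive height by a bounded factor, hence
  leads to the same canonical height; only its one-step constants under duplication depend on the
  choice.\<close>

definition height_function :: "(int \<Rightarrow> int \<Rightarrow> real) \<Rightarrow> bool" where
  "height_function M \<longleftrightarrow> (\<forall>g u w. M (g*u) (g*w) = \<bar>of_int g\<bar> * M u w)
     \<and> (\<exists>c>0. \<forall>u w. c * of_int (max \<bar>u\<bar> \<bar>w\<bar>) \<le> M u w) \<and> (\<exists>c>0. \<forall>u w. M u w \<le> c * of_int (max \<bar>u\<bar> \<bar>w\<bar>))"

lemma height_function_pos:
  assumes "height_function M"
  shows "M (xnum P) (xden P) > 0"
proof -
  obtain c where c: "c > 0" "c * of_int (naive P) \<le> M (xnum P) (xden P)"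
    using assms unfolding height_function_def naive_def by blast
  have "0 < c * of_int (naive P)" using c naive_ge_1[of P] by simp
  then show ?thesis using c by linarith
qed

lemma height_function_naive:
  assumes "height_function M"
  obtains C where "\<And>P. \<bar>ln (M (xnum P) (xden P)) - ln (of_int (naive P))\<bar> \<le> C"
proof -
  obtain c d where c: "c > 0" "\<And>P. c * of_int (naive P) \<le> M (xnum P) (xden P)"
    and d: "d > 0" "\<And>P. M (xnum P) (xden P) \<le> d * of_int (naive P)"
    using assms unfolding height_function_def naive_def by blast
  have "\<bar>ln (M (xnum P) (xden P)) - ln (of_int (naive P))\<bar> \<le> \<bar>ln c\<bar> + \<bar>ln d\<bar>" for P
  proof -
    have n: "(0::real) < of_int (naive P)" using naive_ge_1[of P] by simp
    note M = height_function_pos[OF assms, of P]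
    have "ln (c * of_int (naive P)) \<le> ln (M (xnum P) (xden P))" using c n M by simp
    moreover have "ln (M (xnum P) (xden P)) \<le> ln (d * of_int (naive P))" using d n M by simp
    ultimately show ?thesis using c(1) d(1) n by (simp add: ln_mult)
  qed
  then show ?thesis using that by blast
qed

section \<open>Size estimates and the approximate parallelogram law\<close>

context squarefree_curve
begin

text \<open>The factor 9 comes from \<open>poly_bounds\<close> and a further 2 from
  \<open>max_mult_le\<close>. The value has no influence on the final bounds, where only the
  existence of a constant counts.\<close>

definition size_const :: int where "size_const = 18 * (1 + m^2 + n^2)^2"

text \<open>These are the homogenised coefficients of \<open>chord_sum_prod\<close>; for equal
  points the last two become \<open>dup_den\<close> and \<open>dup_num\<close>.\<close>

lemma poly_bounds:
  fixes u1 w1 u2 w2 H1 H2 :: int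
  assumes "\<bar>u1\<bar> \<le> H1" "\<bar>w1\<bar> \<le> H1" "\<bar>u2\<bar> \<le> H2" "\<bar>w2\<bar> \<le> H2"
  defines "K \<equiv> 9 * (1 + m^2 + n^2)^2 * (H1 * H2)^2"
  shows "\<bar>(u1*w2 - u2*w1)^2\<bar> \<le> K"
    and "\<bar>2*((u1*w2 + u2*w1)*(u1*u2 - m^2*w1*w2) + 2*n^2*w1^2*w2^2)\<bar> \<le> K"
    and "\<bar>(u1*u2 + m^2*w1*w2)^2 - 4*n^2*w1*w2*(u1*w2 + u2*w1)\<bar> \<le> K"
proof -
  define H where "H = H1 * H2"
  define k where "k = 1 + m^2 + n^2"
  have K: "K = 9 * k^2 * H^2" by (simp add: K_def H_def k_def)
  have prod: "\<bar>a * b\<bar> \<le> A * B" if "\<bar>a\<bar> \<le> A" "\<bar>b\<bar> \<le> B" for a b A B :: int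
    unfolding abs_mult using that by (intro mult_mono) auto
  have p: "\<bar>u1*w2\<bar> \<le> H" "\<bar>u2*w1\<bar> \<le> H" "\<bar>u1*u2\<bar> \<le> H" "\<bar>w1*w2\<bar> \<le> H"
    unfolding H_def using prod assms(1-4) by (simp_all add: mult.commute[of u2])
  have H0: "0 \<le> H" using p by linarith
  have k1: "k \<ge> 1" by (simp add: k_def)
  have kk: "k \<le> k^2" "1 \<le> k^2" using k1 self_le_power[of k 2] one_le_power[of k 2] by simp_all
  have mn: "m^2 \<ge> 0" "n^2 \<ge> 0" by auto
  have le: "c * H^2 \<le> K" if "c \<le> 9 * k^2" for c
    unfolding K using that by (intro mult_right_mono) auto
  have sum: "\<bar>u1*w2 + u2*w1\<bar> \<le> 2*H" "\<bar>u1*w2 - u2*w1\<bar> \<le> 2*H" using p by linarith+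
  have "\<bar>(u1*w2 - u2*w1)^2\<bar> \<le> 4 * H^2"
    using prod[OF sum(2) sum(2)] by (simp add: power2_eq_square)
  then show "\<bar>(u1*w2 - u2*w1)^2\<bar> \<le> K" using le[of 4] kk by linarith
  have mw: "\<bar>m^2*(w1*w2)\<bar> \<le> m^2 * H" using p mn by (intro prod) auto
  have ww: "\<bar>(w1*w2)*(w1*w2)\<bar> \<le> H * H" using prod[OF p(4) p(4)] .
  have nw: "\<bar>n^2*((w1*w2)*(w1*w2))\<bar> \<le> n^2 * (H * H)" by (rule prod[OF _ ww]) (simp add: mn)
  have 1: "\<bar>(u1*w2 + u2*w1)*(u1*u2 - m^2*(w1*w2))\<bar> \<le> (2*H) * (H + m^2*H)"
    using p mw by (intro prod[OF sum(1)]) linarith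
  have "\<bar>2*((u1*w2 + u2*w1)*(u1*u2 - m^2*(w1*w2)) + 2*(n^2*((w1*w2)*(w1*w2))))\<bar>
      \<le> 2*((2*H) * (H + m^2*H) + 2*(n^2*(H*H)))"
  proof -
    have "\<bar>2*(a + 2*b)\<bar> \<le> 2*(A + 2*B)" if "\<bar>a\<bar> \<le> A" "\<bar>b\<bar> \<le> B" for a b A B :: int
      using that unfolding distrib_left by linarith
    then show ?thesis using 1 nw by blast
  qed
  also have "\<dots> = 4 * k * H^2" by (simp add: k_def power2_eq_square algebra_simps)
  also have "\<dots> \<le> K" using kk by (intro le) linarith
  finally show "\<bar>2*((u1*w2 + u2*w1)*(u1*u2 - m^2*w1*w2) + 2*n^2*w1^2*w2^2)\<bar> \<le> K"
    by (simp add: power2_eq_square mult_ac)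
  have 2: "\<bar>(u1*u2 + m^2*(w1*w2))*(u1*u2 + m^2*(w1*w2))\<bar> \<le> (H + m^2*H)*(H + m^2*H)"
    using p mw by (intro prod) linarith+
  have 3: "\<bar>n^2*((w1*w2)*(u1*w2 + u2*w1))\<bar> \<le> n^2*(H*(2*H))"
    by (rule prod[OF _ prod[OF p(4) sum(1)]]) (simp add: mn)
  have "\<bar>(u1*u2 + m^2*(w1*w2))*(u1*u2 + m^2*(w1*w2)) - 4*(n^2*((w1*w2)*(u1*w2 + u2*w1)))\<bar>
      \<le> (H + m^2*H)*(H + m^2*H) + 4*(n^2*(H*(2*H)))"
    using 2 3 by linarith
  also have "\<dots> = ((1+m^2)^2 + 8*n^2) * H^2" by (simp add: power2_eq_square algebra_simps)
  also have "\<dots> \<le> K"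
  proof (rule le)
    have "(1+m^2)^2 \<le> k^2" unfolding k_def using mn by (intro power_mono) auto
    moreover have "8*n^2 \<le> 8*k" using mn by (simp add: k_def)
    ultimately show "(1+m^2)^2 + 8*n^2 \<le> 9*k^2" using kk by linarith
  qed
  finally show "\<bar>(u1*u2 + m^2*w1*w2)^2 - 4*n^2*w1*w2*(u1*w2 + u2*w1)\<bar> \<le> K"
    by (simp add: power2_eq_square mult_ac)
qed

lemma dup_bound:
  assumes "\<bar>u\<bar> \<le> H" "\<bar>w\<bar> \<le> H"
  shows "\<bar>dup_num m n u w\<bar> \<le> size_const * H^4" "\<bar>dup_den m n u w\<bar> \<le> size_const * H^4"
proof -
  note b = poly_bounds[OF assms assms]
  have "\<bar>dup_num m n u w\<bar> \<le> 9 * (1 + m^2 + n^2)^2 * (H * H)^2"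
    using b(3) by (simp add: dup_num_def eval_nat_numeral algebra_simps)
  then show "\<bar>dup_num m n u w\<bar> \<le> size_const * H^4"
    by (simp add: size_const_def eval_nat_numeral algebra_simps)
  have "\<bar>dup_den m n u w\<bar> \<le> 9 * (1 + m^2 + n^2)^2 * (H * H)^2"
    using b(2) by (simp add: dup_den_def cubic_def eval_nat_numeral algebra_simps)
  then show "\<bar>dup_den m n u w\<bar> \<le> size_const * H^4"
    by (simp add: size_const_def eval_nat_numeral algebra_simps)
qed

lemma cancel_le: "cancel m u w \<le> 36"
  by (simp add: cancel_def)

lemma cancel_ge_1: "cancel m u w \<ge> 1"
  by (simp add: cancel_def)

lemma naive_double_le:
  assumes P: "P \<in> pts"
  shows "naive (ec_add coefA P P) \<le> size_const * naive P^4"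
proof -
  obtain g where g: "dup_num m n (xnum P) (xden P) = g * xnum (ec_add coefA P P)"
    "dup_den m n (xnum P) (xden P) = g * xden (ec_add coefA P P)" "\<bar>g\<bar> = cancel m (xnum P) (xden P)"
    using double_coords[OF P] by metis
  have "1 \<le> \<bar>g\<bar>" using g(3) cancel_ge_1 by metis
  then have "\<bar>x\<bar> \<le> \<bar>g * x\<bar>" for x by (simp add: abs_mult mult_le_cancel_right1)
  then have "\<bar>xnum (ec_add coefA P P)\<bar> \<le> \<bar>dup_num m n (xnum P) (xden P)\<bar>"
    "\<bar>xden (ec_add coefA P P)\<bar> \<le> \<bar>dup_den m n (xnum P) (xden P)\<bar>" unfolding g(1,2) by blast+
  moreover have "\<bar>xnum P\<bar> \<le> naive P" "\<bar>xden P\<bar> \<le> naive P" by (simp_all add: naive_def)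
  ultimately show ?thesis
    using dup_bound[of "xnum P" "naive P" "xden P"] unfolding naive_def[of "ec_add _ _ _"] by linarith
qed

text \<open>For distinct x-coordinates the coefficients of the product polynomial of P+Q and P-Q are
  proportional to \<open>W\<close>, \<open>T\<close>, \<open>Z\<close>. The former are primitive, so
  the factor \<open>t\<close> is a nonzero integer and they are no larger than the latter. Equal
  x-coordinates reduce to doubling.\<close>

lemma naive_parallelogram:
  assumes P: "P \<in> pts" and Q: "Q \<in> pts"
  shows "naive (ec_add coefA P Q) * naive (ec_add coefA P (ec_neg Q)) \<le> size_const * (naive P * naive Q)^2"
proof -
  have k1: "1 \<le> size_const"
  proof -
    have "1 + m^2 + n^2 \<ge> 1" by simp
    then have "1 \<le> (1 + m^2 + n^2)^2" by (simp add: one_le_power)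
    then show ?thesis unfolding size_const_def by linarith
  qed
  have triv: "naive R * naive R \<le> size_const * (naive R)^2" for R
    using mult_right_mono[OF k1, of "naive R * naive R"] by (simp add: power2_eq_square)
  have dbl: "naive (ec_add coefA R R) \<le> size_const * (naive R * naive R)^2" if "R \<in> pts" for R
    using naive_double_le[OF that] by (simp add: eval_nat_numeral mult_ac)
  show ?thesis
  proof (cases P rule: xcoordE)
    case 1
    then show ?thesis using triv[of Q] by simp
  next
    case Px: (2 x1 y1)
    show ?thesis
    proof (cases Q rule: xcoordE)
      case 1
      then show ?thesis using triv[of P] by simp
    next
      case Qx: (2 x2 y2)
      have on: "y1^2 = x1^3 + coefA*x1 + coefB" "y2^2 = x2^3 + coefA*x2 + coefB"
        using P Q unfolding Px(1) Qx(1) by simp_all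
      show ?thesis
      proof (cases "x1 = x2")
        case True
        then have "(y1 - y2) * (y1 + y2) = 0" using on by (simp add: algebra_simps power2_eq_square)
        then have "P = Q \<or> P = ec_neg Q"
          unfolding Px(1) Qx(1) using True by (auto simp: add_eq_0_iff2)
        then show ?thesis
        proof
          assume "P = Q"
          then show ?thesis using dbl[OF Q] by simp
        next
          assume PQ: "P = ec_neg Q"
          have "naive (ec_add coefA (ec_neg Q) (ec_neg Q)) \<le> size_const * (naive Q * naive Q)^2"
            using dbl[of "ec_neg Q"] Q by simp
          then show ?thesis unfolding PQ by simp
        qed
      next
        case False
        let ?R = "ec_add coefA P Q" and ?S = "ec_add coefA P (ec_neg Q)"
        define u1 w1 u2 w2 where uw: "u1 = xnum P" "w1 = xden P" "u2 = xnum Q" "w2 = xden Q"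
        define x3 x4 where x34: "x3 = ((y2 - y1)/(x2 - x1))^2 - x1 - x2" "x4 = ((-y2 - y1)/(x2 - x1))^2 - x1 - x2"
        obtain y3 where R: "?R = Point x3 y3" unfolding Px(1) Qx(1) x34 using ec_add_distinct[OF False refl] by blast
        obtain y4 where S: "?S = Point x4 y4"
          unfolding Px(1) Qx(1) x34 ec_neg.simps using ec_add_distinct[OF False refl] by blast
        define u3 w3 u4 w4 where uw': "u3 = xnum ?R" "w3 = xden ?R" "u4 = xnum ?S" "w4 = xden ?S"
        have x1: "x1 = of_int u1 / of_int w1" "w1 > 0" and x2: "x2 = of_int u2 / of_int w2" "w2 > 0"
          using Px(2,3) Qx(2,3) unfolding uw by auto
        have x3: "x3 = of_int u3 / of_int w3" "w3 > 0" and x4: "x4 = of_int u4 / of_int w4" "w4 > 0"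
          unfolding uw' R S by (rule xcoord_eq xden_Point_pos)+
        define W where "W = (u1*w2 - u2*w1)^2"
        define T where "T = 2*((u1*w2 + u2*w1)*(u1*u2 - m^2*w1*w2) + 2*n^2*w1^2*w2^2)"
        define Z where "Z = (u1*u2 + m^2*w1*w2)^2 - 4*n^2*w1*w2*(u1*w2 + u2*w1)"
        define c where "c = (of_int w1 * of_int w2 :: rat)^2"
        have c: "c \<noteq> 0" using x1 x2 by (simp add: c_def)
        have W: "(x1-x2)^2 * c = of_int W"
        proof -
          have "(x1 - x2) * (of_int w1 * of_int w2) = of_int (u1*w2 - u2*w1)"
            unfolding x1(1) x2(1) using x1(2) x2(2) by (simp add: field_simps)
          then show ?thesis unfolding c_def W_def by (metis of_int_power power_mult_distrib)
        qed
        have e: "(u1/w1 + u2/w2) * (u1/w1*(u2/w2) + a) * (w1*w2)^2 = (u1*w2 + u2*w1)*(u1*u2 + a*w1*w2)"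
           "(u1/w1*(u2/w2) - a)^2 * (w1*w2)^2 = (u1*u2 - a*w1*w2)^2"
           "b*(u1/w1 + u2/w2) * (w1*w2)^2 = b*w1*w2*(u1*w2 + u2*w1)"
          if "w1 \<noteq> 0" "w2 \<noteq> 0" for u1 w1 u2 w2 a b :: rat
          using that by (simp_all add: field_simps eval_nat_numeral)
        have T: "2*((x1+x2)*(x1*x2+coefA) + 2*coefB) * c = of_int T"
          using e(1)[of "of_int w1" "of_int w2" "of_int u1" "of_int u2" coefA] x1(2) x2(2)
          unfolding x1(1) x2(1) c_def T_def by (simp add: distrib_right mult.assoc) (simp add: power_mult_distrib)
        have Z: "((x1*x2-coefA)^2 - 4*coefB*(x1+x2)) * c = of_int Z"
          using e(2)[of "of_int w1" "of_int w2" "of_int u1" "of_int u2" coefA]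
            e(3)[of "of_int w1" "of_int w2" "4*coefB" "of_int u1" "of_int u2"] x1(2) x2(2)
          unfolding x1(1) x2(1) c_def Z_def by (simp add: left_diff_distrib mult.assoc)
        note sp = chord_sum_prod[OF on False x34]
        have "(x3 + x4) * of_int W = of_int T"
          using sp(1) unfolding W[symmetric] T[symmetric] by (metis mult.assoc)
        then have "(of_int ((u3*w4 + u4*w3) * W) :: rat) = of_int (T * (w3*w4))"
          unfolding x3(1) x4(1) using x3(2) x4(2) by (simp add: field_simps)
        then have sW: "(u3*w4 + u4*w3) * W = T * (w3*w4)" using of_int_eq_iff by blast
        have "(x3 * x4) * of_int W = of_int Z"
          using sp(2) unfolding W[symmetric] Z[symmetric] by (metis mult.assoc)
        then have "(of_int ((u3*u4) * W) :: rat) = of_int (Z * (w3*w4))"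
          unfolding x3(1) x4(1) using x3(2) x4(2) by (simp add: field_simps)
        then have pW: "(u3*u4) * W = Z * (w3*w4)" using of_int_eq_iff by blast
        have cop: "coprime (w3*w4) (gcd (u3*w4 + u4*w3) (u3*u4))"
          unfolding uw' by (intro coprime_product_coeffs coprime_xnum_xden)
        have "w3*w4 dvd (u3*w4 + u4*w3) * W" "w3*w4 dvd (u3*u4) * W" unfolding sW pW by simp_all
        then have "w3*w4 dvd gcd ((u3*w4 + u4*w3) * W) ((u3*u4) * W)" by simp
        then have "w3*w4 dvd W * gcd (u3*w4 + u4*w3) (u3*u4)"
          by (metis gcd_mult_distrib_int mult.commute dvd_abs_iff abs_mult abs_gcd_int)
        then have "w3*w4 dvd W" using cop by (simp add: coprime_dvd_mult_left_iff)
        then obtain t where t: "W = w3*w4*t" by blast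
        have w34: "w3*w4 \<noteq> 0" using x3(2) x4(2) by simp
        have "of_int W \<noteq> (0::rat)" unfolding W[symmetric] using c False by simp
        then have "t \<noteq> 0" using t by auto
        then have "1 \<le> \<bar>t\<bar>" by linarith
        then have t1: "\<bar>x\<bar> \<le> \<bar>x * t\<bar>" for x :: int by (simp add: abs_mult mult_le_cancel_left1)
        have "(w3*w4) * ((u3*w4 + u4*w3) * t) = (w3*w4) * T" "(w3*w4) * ((u3*u4) * t) = (w3*w4) * Z"
          using sW pW unfolding t by (simp_all only: mult_ac)
        then have tt: "(u3*w4 + u4*w3) * t = T" "(u3*u4) * t = Z" using w34 by simp_all
        let ?K = "9 * (1 + m^2 + n^2)^2 * (naive P * naive Q)^2"
        have "\<bar>u1\<bar> \<le> naive P" "\<bar>w1\<bar> \<le> naive P" "\<bar>u2\<bar> \<le> naive Q" "\<bar>w2\<bar> \<le> naive Q"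
          by (auto simp: uw naive_def)
        from poly_bounds[OF this] have "\<bar>W\<bar> \<le> ?K" "\<bar>T\<bar> \<le> ?K" "\<bar>Z\<bar> \<le> ?K"
          by (simp_all add: W_def T_def Z_def)
        then have "\<bar>w3*w4\<bar> \<le> ?K" "\<bar>u3*w4 + u4*w3\<bar> \<le> ?K" "\<bar>u3*u4\<bar> \<le> ?K"
          unfolding t tt[symmetric] by (blast intro: order_trans[OF t1])+
        from max_mult_le[OF this] show ?thesis by (simp add: naive_def uw' size_const_def)
      qed
    qed
  qed
qed


lemma height_function_double:
  assumes M: "height_function M" and P: "P \<in> pts"
  defines "M' \<equiv> \<lambda>P. M (xnum P) (xden P)"
  shows "M (dup_num m n (xnum P) (xden P)) (dup_den m n (xnum P) (xden P))
       = of_int (cancel m (xnum P) (xden P)) * M' (ec_add coefA P P)"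
proof -
  obtain g where g: "dup_num m n (xnum P) (xden P) = g * xnum (ec_add coefA P P)"
    "dup_den m n (xnum P) (xden P) = g * xden (ec_add coefA P P)" "\<bar>g\<bar> = cancel m (xnum P) (xden P)"
    using double_coords[OF P] by metis
  have "\<bar>of_int g\<bar> = (of_int (cancel m (xnum P) (xden P)) :: real)" using g(3) by (metis of_int_abs)
  then show ?thesis using M unfolding height_function_def M'_def g(1,2) by simp
qed

text \<open>The upper half of the doubling estimate is \<open>naive_double_le\<close>. The lower
  half needs that little cancels, and that the two polynomials are not both small, which is
  \<open>low\<close>.\<close>

lemma canonical_height:
  assumes M: "height_function M" and \<kappa>: "\<kappa> > 0"
    and low: "\<And>P. P \<in> pts \<Longrightarrow> \<kappa> * M (xnum P) (xden P)^4 \<le> M (dup_num m n (xnum P) (xden P)) (dup_den m n (xnum P) (xden P))"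
  obtains q C where "quadratic_form_group (mordell_weil m n) q"
    "\<And>P. P \<in> pts \<Longrightarrow> \<bar>q P - ln (of_int (naive P))\<bar> \<le> C"
proof -
  obtain C0 where C0: "\<And>P. \<bar>ln (M (xnum P) (xden P)) - ln (of_int (naive P))\<bar> \<le> C0"
    using height_function_naive[OF M] by blast
  define h where "h P = ln (real_of_int (naive P))" for P
  have h0: "0 \<le> h P" for P unfolding h_def using naive_ge_1[of P] by simp
  have npos: "(0::real) < of_int (naive P)" for P using naive_ge_1[of P] by simp
  have kpos: "(0::real) < of_int size_const"
  proof -
    have "1 + m^2 + n^2 > 0" by (smt (verit) zero_le_power2)
    then have "size_const > 0" by (simp add: size_const_def)
    then show ?thesis by simp
  qed
  \<comment> \<open>\<open>C0\<close> is used once for 2P and four times for P; \<open>ln 36\<close>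
    bounds the cancelled factor.\<close>
  define C where "C = \<bar>ln (of_int size_const)\<bar> + \<bar>ln \<kappa>\<bar> + 5 * C0 + ln 36"
  have C0': "0 \<le> C0" using C0[of Infinity] by linarith
  have dbl: "\<bar>h (ec_add coefA P P) - 4 * h P\<bar> \<le> C" if P: "P \<in> pts" for P
  proof -
    let ?Q = "ec_add coefA P P"
    have "real_of_int (naive ?Q) \<le> of_int size_const * of_int (naive P)^4"
      using naive_double_le[OF P] by (metis of_int_le_iff of_int_mult of_int_power)
    then have "h ?Q \<le> ln (of_int size_const * of_int (naive P)^4)"
      unfolding h_def by (intro ln_mono npos)
    also have "\<dots> = ln (of_int size_const) + 4 * h P"
      using npos[of P] kpos by (simp add: ln_mult ln_realpow h_def)
    finally have up: "h ?Q - 4 * h P \<le> ln (of_int size_const)" by simp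
    let ?c = "cancel m (xnum P) (xden P)"
    have c: "1 \<le> ?c" "?c \<le> 36" using cancel_ge_1 cancel_le by blast+
    note MP = height_function_pos[OF M, of P] and MQ = height_function_pos[OF M, of ?Q]
    have "ln (\<kappa> * M (xnum P) (xden P)^4) \<le> ln (of_int ?c * M (xnum ?Q) (xden ?Q))"
      using low[OF P] height_function_double[OF M P] \<kappa> MP MQ c(1) by simp
    then have "ln \<kappa> + 4 * ln (M (xnum P) (xden P)) \<le> ln (of_int ?c) + ln (M (xnum ?Q) (xden ?Q))"
      using \<kappa> MP MQ c(1) by (simp add: ln_mult ln_realpow)
    moreover have "ln (real_of_int ?c) \<le> ln 36" using c by simp
    ultimately have "4 * h P - h ?Q \<le> ln 36 - ln \<kappa> + 5 * C0"
      using C0[of P] C0[of ?Q] unfolding h_def by linarith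
    moreover have "0 \<le> ln (36::real)" by simp
    ultimately show ?thesis using up C0' unfolding C_def by linarith
  qed
  have par: "h (ec_add coefA P Q) + h (ec_add coefA P (inv\<^bsub>mordell_weil m n\<^esub> Q)) \<le> 2 * h P + 2 * h Q + C"
    if P: "P \<in> pts" and Q: "Q \<in> pts" for P Q
  proof -
    let ?R = "ec_add coefA P Q" and ?S = "ec_add coefA P (ec_neg Q)"
    have "real_of_int (naive ?R) * of_int (naive ?S) \<le> of_int size_const * (of_int (naive P) * of_int (naive Q))^2"
      using naive_parallelogram[OF P Q] by (metis of_int_le_iff of_int_mult of_int_power)
    then have "ln (real_of_int (naive ?R) * of_int (naive ?S)) \<le> ln (of_int size_const * (of_int (naive P) * of_int (naive Q))^2)"
      by (intro ln_mono mult_pos_pos npos)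
    then have "h ?R + h ?S \<le> ln (of_int size_const) + 2 * (h P + h Q)"
      using npos[of P] npos[of Q] npos[of ?R] npos[of ?S] kpos by (simp add: ln_mult ln_realpow h_def)
    moreover have "ln (of_int size_const) \<le> C"
    proof -
      have "0 \<le> ln (36::real)" by simp
      then show ?thesis using C0' unfolding C_def by linarith
    qed
    ultimately show ?thesis unfolding inv_mw[OF Q] distrib_left by linarith
  qed
  obtain q where q: "quadratic_form_group (mordell_weil m n) q" "\<And>P. P \<in> pts \<Longrightarrow> \<bar>q P - h P\<bar> \<le> C"
    using comm_group.canonical_height_exists[OF mw_comm_group, of h C] h0 dbl par by auto
  then show ?thesis using that unfolding h_def by blast
qed

text \<open>The total effect on the canonical height of the factors 4 and 9 cancelled under repeated doubling: singularity
  modulo 2 may persist, giving \<open>\<Sum>k\<ge>1. ln 4 / 4 ^ k\<close>, whereas the double of a point is never singular modulo 3.\<close>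

definition correction :: "int \<Rightarrow> int \<Rightarrow> real" where
  "correction u w = (if sing2 m u w then ln 4 / 3 else 0) + (if sing3 m u w then ln 9 / 4 else 0)"

lemma ln_cancel: "ln (of_int (cancel m u w)) = (if sing2 m u w then ln 4 else 0) + (if sing3 m u w then ln 9 else (0::real))"
proof -
  have "ln (36::real) = ln 4 + ln 9" using ln_mult[of 4 "9::real"] by simp
  then show ?thesis by (simp add: cancel_def)
qed

text \<open>The two values of \<open>correction\<close> are the solutions of this recursion:
  \<open>4 * (ln 4 / 3) = ln 4 / 3 + ln 4\<close> if singularity persists, and
  \<open>4 * (ln 9 / 4) = ln 9\<close> if it is lost at once. For even \<open>n\<close> it may also
  be lost modulo 2, which leaves an inequality.\<close>

lemma correction_double:
  assumes P: "P \<in> pts"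
  defines "Q \<equiv> ec_add coefA P P"
  shows "correction (xnum Q) (xden Q) + ln (of_int (cancel m (xnum P) (xden P))) \<le> 4 * correction (xnum P) (xden P)"
    and "odd n \<Longrightarrow> correction (xnum Q) (xden Q) + ln (of_int (cancel m (xnum P) (xden P))) = 4 * correction (xnum P) (xden P)"
proof -
  have s: "sing2 m (xnum Q) (xden Q) \<Longrightarrow> sing2 m (xnum P) (xden P)"
    "odd n \<Longrightarrow> sing2 m (xnum P) (xden P) \<Longrightarrow> sing2 m (xnum Q) (xden Q)" "\<not> sing3 m (xnum Q) (xden Q)"
    using double_coords[OF P] unfolding Q_def by metis+
  show "correction (xnum Q) (xden Q) + ln (of_int (cancel m (xnum P) (xden P))) \<le> 4 * correction (xnum P) (xden P)"
    using s by (auto simp: ln_cancel correction_def)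
  assume "odd n"
  then show "correction (xnum Q) (xden Q) + ln (of_int (cancel m (xnum P) (xden P))) = 4 * correction (xnum P) (xden P)"
    using s by (auto simp: ln_cancel correction_def)
qed

lemma correction_nonneg: "0 \<le> correction u w"
  and correction_le: "correction u w \<le> ln 4 / 3 + ln 9 / 4"
  by (simp_all add: correction_def)

lemma ln_height_double:
  assumes M: "height_function M" and P: "P \<in> pts"
  defines "Q \<equiv> ec_add coefA P P"
  shows "ln (M (dup_num m n (xnum P) (xden P)) (dup_den m n (xnum P) (xden P)))
    = ln (of_int (cancel m (xnum P) (xden P))) + ln (M (xnum Q) (xden Q))"
  using height_function_double[OF M P] height_function_pos[OF M, of Q] cancel_ge_1[of "xnum P" "xden P"]
  unfolding Q_def by (simp add: ln_mult)

text \<open>Subtracting \<open>correction\<close> absorbs the cancelled factors, so that \<kappa> is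
  the only one-step error.\<close>

lemma height_ge:
  assumes q: "quadratic_form_group (mordell_weil m n) q" and C: "\<And>P. P \<in> pts \<Longrightarrow> \<bar>q P - ln (of_int (naive P))\<bar> \<le> C"
    and M: "height_function M" and \<kappa>: "\<kappa> > 0"
    and low: "\<And>P. P \<in> pts \<Longrightarrow> \<kappa> * M (xnum P) (xden P)^4 \<le> M (dup_num m n (xnum P) (xden P)) (dup_den m n (xnum P) (xden P))"
    and P: "P \<in> pts"
  shows "ln (M (xnum P) (xden P)) - correction (xnum P) (xden P) + ln \<kappa> / 3 \<le> q P"
proof -
  define T where "T P = ln (M (xnum P) (xden P)) - correction (xnum P) (xden P)" for P
  obtain C0 where C0: "\<And>P. \<bar>ln (M (xnum P) (xden P)) - ln (of_int (naive P))\<bar> \<le> C0"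
    using height_function_naive[OF M] by blast
  have "4 * T P - (- ln \<kappa>) \<le> T (ec_add coefA P P)" if P: "P \<in> pts" for P
  proof -
    note MP = height_function_pos[OF M, of P]
    have pos: "0 < \<kappa> * M (xnum P) (xden P)^4" using \<kappa> MP by simp
    then have "ln (\<kappa> * M (xnum P) (xden P)^4) \<le> ln (M (dup_num m n (xnum P) (xden P)) (dup_den m n (xnum P) (xden P)))"
      using low[OF P] ln_mono by fastforce
    then have "ln \<kappa> + 4 * ln (M (xnum P) (xden P)) \<le> ln (M (dup_num m n (xnum P) (xden P)) (dup_den m n (xnum P) (xden P)))"
      using \<kappa> MP by (simp add: ln_mult ln_realpow)
    then show ?thesis using correction_double(1)[OF P] ln_height_double[OF M P] unfolding T_def by argo
  qed
  moreover have "T P \<le> q P + (C + C0)" if "P \<in> pts" for P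
    using C[OF that] C0[of P] correction_nonneg[of "xnum P" "xden P"] unfolding T_def by linarith
  ultimately have "T P - (- ln \<kappa>)/3 \<le> q P"
    using quadratic_form_group.q_ge_if_doubling[OF q, of T "C + C0" "- ln \<kappa>" P] P by simp
  then show ?thesis by (simp add: T_def)
qed

text \<open>The first bound ignores the cancellation, which can only lower the height of 2P. The
  second exploits it and so needs equality in \<open>correction_double\<close>.\<close>

lemma height_le:
  assumes q: "quadratic_form_group (mordell_weil m n) q" and C: "\<And>P. P \<in> pts \<Longrightarrow> \<bar>q P - ln (of_int (naive P))\<bar> \<le> C"
    and M: "height_function M" and \<kappa>: "\<kappa> > 0"
    and up: "\<And>P. P \<in> pts \<Longrightarrow> M (dup_num m n (xnum P) (xden P)) (dup_den m n (xnum P) (xden P)) \<le> \<kappa> * M (xnum P) (xden P)^4"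
    and P: "P \<in> pts"
  shows "q P \<le> ln (M (xnum P) (xden P)) + ln \<kappa> / 3"
    and "odd n \<Longrightarrow> q P \<le> ln (M (xnum P) (xden P)) - correction (xnum P) (xden P) + ln \<kappa> / 3"
proof -
  obtain C0 where C0: "\<And>P. \<bar>ln (M (xnum P) (xden P)) - ln (of_int (naive P))\<bar> \<le> C0"
    using height_function_naive[OF M] by blast
  have dbl: "ln (of_int (cancel m (xnum P) (xden P))) + ln (M (xnum (ec_add coefA P P)) (xden (ec_add coefA P P)))
      \<le> ln \<kappa> + 4 * ln (M (xnum P) (xden P))" if P: "P \<in> pts" for P
  proof -
    note MP = height_function_pos[OF M, of P]
    have "0 < M (dup_num m n (xnum P) (xden P)) (dup_den m n (xnum P) (xden P))"
      using height_function_double[OF M P] height_function_pos[OF M] cancel_ge_1[of "xnum P" "xden P"] by simp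
    then have "ln (M (dup_num m n (xnum P) (xden P)) (dup_den m n (xnum P) (xden P))) \<le> ln (\<kappa> * M (xnum P) (xden P)^4)"
      using up[OF P] ln_mono by fastforce
    then show ?thesis using \<kappa> MP ln_height_double[OF M P] by (simp add: ln_mult ln_realpow)
  qed
  show "q P \<le> ln (M (xnum P) (xden P)) + ln \<kappa> / 3"
  proof -
    have "ln (M (xnum (ec_add coefA P P)) (xden (ec_add coefA P P))) \<le> 4 * ln (M (xnum P) (xden P)) + ln \<kappa>"
      if P: "P \<in> pts" for P
    proof -
      have "0 \<le> ln (real_of_int (cancel m (xnum P) (xden P)))" using cancel_ge_1[of "xnum P" "xden P"] by simp
      then show ?thesis using dbl[OF P] by linarith
    qed
    moreover have "q P \<le> ln (M (xnum P) (xden P)) + (C + C0)" if "P \<in> pts" for P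
      using C[OF that] C0[of P] by linarith
    ultimately show ?thesis
      using quadratic_form_group.q_le_if_doubling[OF q, of "\<lambda>P. ln (M (xnum P) (xden P))" "C + C0" "ln \<kappa>" P] P by simp
  qed
  assume n: "odd n"
  define T where "T P = ln (M (xnum P) (xden P)) - correction (xnum P) (xden P)" for P
  have "T (ec_add coefA P P) \<le> 4 * T P + ln \<kappa>" if P: "P \<in> pts" for P
    using dbl[OF P] correction_double(2)[OF P n] unfolding T_def by argo
  moreover have "q P \<le> T P + (C + C0 + (ln 4 / 3 + ln 9 / 4))" if "P \<in> pts" for P
    using C[OF that] C0[of P] correction_le[of "xnum P" "xden P"] unfolding T_def by linarith
  ultimately have "q P \<le> T P + ln \<kappa> / 3"
    using quadratic_form_group.q_le_if_doubling[OF q, of T "C + C0 + (ln 4 / 3 + ln 9 / 4)" "ln \<kappa>" P] P by simp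
  then show "q P \<le> ln (M (xnum P) (xden P)) - correction (xnum P) (xden P) + ln \<kappa> / 3" by (simp add: T_def)
qed

lemma gap_quadratic_group_mw:
  assumes q: "quadratic_form_group (mordell_weil m n) q" and C: "\<And>P. P \<in> pts \<Longrightarrow> \<bar>q P - ln (of_int (naive P))\<bar> \<le> C"
    and gap: "gap > 0" "\<And>P. P \<in> pts \<Longrightarrow> P \<noteq> Infinity \<Longrightarrow> gap \<le> q P"
  shows "gap_quadratic_group (mordell_weil m n) q gap"
proof -
  interpret quadratic_form_group "mordell_weil m n" q by (rule q)
  show ?thesis
  proof unfold_locales
    fix B
    have "{P \<in> pts. q P \<le> B} \<subseteq> {P \<in> pts. naive P \<le> \<lfloor>exp (B + C)\<rfloor>}"
    proof
      fix P assume P: "P \<in> {P \<in> pts. q P \<le> B}"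
      then have "ln (of_int (naive P)) \<le> B + C" using C[of P] by fastforce
      moreover have "exp (ln (real_of_int (naive P))) = of_int (naive P)" using naive_ge_1[of P] by simp
      ultimately have "real_of_int (naive P) \<le> exp (B + C)" by (metis exp_le_cancel_iff)
      then show "P \<in> {P \<in> pts. naive P \<le> \<lfloor>exp (B + C)\<rfloor>}" using P by (simp add: le_floor_iff)
    qed
    then show "finite {x \<in> carrier (mordell_weil m n). q x \<le> B}"
      using finite_subset[OF _ finite_naive_le] by simp
  qed (use gap in \<open>force+\<close>)
qed

end

section \<open>The case m = 1\<close>

lemma height_function_max:
  assumes c: "c > 0"
  shows "height_function (\<lambda>u w. max \<bar>of_int u\<bar> (c * \<bar>of_int w\<bar>))"
  unfolding height_function_def
proof (intro conjI allI)
  fix g u w :: int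
  have "max \<bar>of_int (g*u)\<bar> (c * \<bar>of_int (g*w)\<bar>) = max (\<bar>of_int g\<bar> * \<bar>of_int u\<bar>) (\<bar>of_int g\<bar> * (c * \<bar>of_int w :: real\<bar>))"
    by (simp add: abs_mult mult_ac)
  then show "max \<bar>of_int (g*u)\<bar> (c * \<bar>of_int (g*w)\<bar>) = \<bar>of_int g\<bar> * max \<bar>of_int u\<bar> (c * \<bar>of_int w :: real\<bar>)"
    by (simp add: max_mult_distrib_left)
next
  have "min 1 c * of_int (max \<bar>u\<bar> \<bar>w\<bar>) \<le> max \<bar>of_int u\<bar> (c * \<bar>of_int w\<bar>)" for u w :: int
  proof (cases "\<bar>w\<bar> \<le> \<bar>u\<bar>")
    case True
    have "min 1 c * of_int \<bar>u\<bar> \<le> 1 * of_int \<bar>u\<bar>" by (intro mult_right_mono) auto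
    then show ?thesis using True by (simp add: max.coboundedI1)
  next
    case False
    have "min 1 c * of_int \<bar>w\<bar> \<le> c * of_int \<bar>w\<bar>" by (intro mult_right_mono) auto
    then show ?thesis using False by (simp add: max.coboundedI2)
  qed
  then show "\<exists>d>0. \<forall>u w. d * of_int (max \<bar>u\<bar> \<bar>w\<bar>) \<le> max \<bar>of_int u\<bar> (c * \<bar>of_int w\<bar>)"
    using c by (intro exI[of _ "min 1 c"]) auto
next
  have "max \<bar>of_int u\<bar> (c * \<bar>of_int w\<bar>) \<le> max 1 c * of_int (max \<bar>u\<bar> \<bar>w\<bar>)" for u w :: int
  proof (rule max.boundedI)
    have "1 * of_int \<bar>u\<bar> \<le> max 1 c * of_int (max \<bar>u\<bar> \<bar>w\<bar>)" by (intro mult_mono) auto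
    then show "\<bar>of_int u\<bar> \<le> max 1 c * of_int (max \<bar>u\<bar> \<bar>w\<bar>)" by simp
    have "c * of_int \<bar>w\<bar> \<le> max 1 c * of_int (max \<bar>u\<bar> \<bar>w\<bar>)" using c by (intro mult_mono) auto
    then show "c * \<bar>of_int w\<bar> \<le> max 1 c * of_int (max \<bar>u\<bar> \<bar>w\<bar>)" by simp
  qed
  then show "\<exists>d>0. \<forall>u w. max \<bar>of_int u\<bar> (c * \<bar>of_int w\<bar>) \<le> d * of_int (max \<bar>u\<bar> \<bar>w\<bar>)"
    using c by (intro exI[of _ "max 1 c"]) auto
qed

text \<open>With \<open>t = c w\<close> and \<open>e = 1 / c\<^sup>2\<close> the two duplication polynomials depend on \<open>n\<close> only through \<open>e\<close>.\<close>

lemma dup_scaled_lower: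
  fixes u t e :: real
  assumes e: "0 \<le> e" "e \<le> 191/1000" and t: "t \<ge> 0"
  shows "94/100 * (max \<bar>u\<bar> t)^4 \<le> max \<bar>(u^2 + e*t^2)^2 - 8/3*u*t^3\<bar> \<bar>4*t*(u^3 - e*u*t^2 + t^3/3)\<bar>"
proof (cases "\<bar>u\<bar> \<le> t")
  case ut: True
  show ?thesis
  proof (cases "t = 0")
    case True
    then show ?thesis using ut by simp
  next
    case False
    define x where "x = u / t"
    have u: "u = x * t" using False by (simp add: x_def)
    have x1: "\<bar>x\<bar> \<le> 1" using ut t False by (simp add: x_def)
    have "94/100 \<le> (x^2 + e)^2 - 8/3*x \<or> 94/100 \<le> 4*(x^3 - e*x + 1/3)"
    proof (cases "x \<ge> 0")
      case True
      \<comment> \<open>The tangent bound for the cube at \<open>d\<close>. The value 26/100 is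
        close to \<open>sqrt (e/3)\<close>, the minimum of \<open>x^3 - e*x\<close>, for the largest
        \<open>e\<close>, and its slope \<open>3*d^2\<close> exceeds \<open>e\<close>.\<close>
      have "x^3 + 2*d^3 - 3*d^2*x = (x - d)^2*(x + 2*d)" for d
        by (simp add: eval_nat_numeral algebra_simps)
      from this[of "26/100"] have "x^3 + 2*(26/100)^3 - 3*(26/100)^2*x = (x - 26/100)^2*(x + 2*(26/100))" .
      also have "\<dots> \<ge> 0" using True by simp
      finally have 1: "3*(26/100)^2*x - 2*(26/100)^3 \<le> x^3" by simp
      have "e*x \<le> 191/1000*x" using True e by (intro mult_right_mono)
      then have "94/100 \<le> 4*(x^3 - e*x + 1/3)" using 1 True by (simp add: power_divide)
      then show ?thesis ..
    next
      case x: False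
      \<comment> \<open>Down to -46/100 the denominator is still large enough; further left the term
        \<open>- 8/3*x\<close> suffices.\<close>
      show ?thesis
      proof (cases "x \<ge> -46/100")
        case True
        have "(-x)^3 \<le> (46/100)^3" using True x by (intro power_mono) auto
        then have "-(97336/1000000) \<le> x^3" by (simp add: power_divide)
        moreover have "e*x \<le> 0" using e x by (simp add: mult_nonneg_nonpos)
        ultimately have "94/100 \<le> 4*(x^3 - e*x + 1/3)" by simp
        then show ?thesis ..
      next
        case False
        have "0 \<le> (x^2 + e)^2" by simp
        then have "94/100 \<le> (x^2 + e)^2 - 8/3*x" using False by linarith
        then show ?thesis ..
      qed
    qed
    then have "94/100 \<le> \<bar>(x^2 + e)^2 - 8/3*x\<bar> \<or> 94/100 \<le> \<bar>4*(x^3 - e*x + 1/3)\<bar>"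
      by (meson abs_ge_self order_trans)
    then have "94/100*t^4 \<le> \<bar>(x^2 + e)^2 - 8/3*x\<bar>*t^4 \<or> 94/100*t^4 \<le> \<bar>4*(x^3 - e*x + 1/3)\<bar>*t^4"
      using mult_right_mono[of "94/100" _ "t^4"] by auto
    moreover have "\<bar>(x^2 + e)^2 - 8/3*x\<bar>*t^4 = \<bar>(u^2 + e*t^2)^2 - 8/3*u*t^3\<bar>"
    proof -
      have "((x^2 + e)^2 - 8/3*x)*t^4 = (u^2 + e*t^2)^2 - 8/3*u*t^3"
        unfolding u by (simp add: eval_nat_numeral algebra_simps)
      then show ?thesis by (metis abs_mult abs_of_nonneg zero_le_even_power' even_numeral zero_le_power t)
    qed
    moreover have "\<bar>4*(x^3 - e*x + 1/3)\<bar>*t^4 = \<bar>4*t*(u^3 - e*u*t^2 + t^3/3)\<bar>"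
    proof -
      have "(4*(x^3 - e*x + 1/3))*t^4 = 4*t*(u^3 - e*u*t^2 + t^3/3)"
        unfolding u by (simp add: eval_nat_numeral algebra_simps)
      then show ?thesis by (metis abs_mult abs_of_nonneg zero_le_power t)
    qed
    moreover have "max \<bar>u\<bar> t = t" using ut by simp
    ultimately show ?thesis by (simp only: le_max_iff_disj)
  qed
next
  case ut: False
  then have u0: "u \<noteq> 0" using t by auto
  define r where "r = t / u"
  have tr: "t = r * u" using u0 by (simp add: r_def)
  have r1: "\<bar>r\<bar> \<le> 1" using ut t u0 by (simp add: r_def)
  \<comment> \<open>The split point 28/100 is nearly the largest at which the numerator alone still
    reaches 94/100.\<close>
  have "94/100 \<le> (1 + e*r^2)^2 - 8/3*r^3 \<or> 94/100 \<le> 4*r*(1 - e*r^2 + r^3/3)"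
  proof (cases "r \<le> 28/100")
    case True
    have "r^3 \<le> (28/100)^3" using True by (intro power_mono_odd) auto
    then have "r^3 \<le> 21952/1000000" by (simp add: power_divide)
    moreover have "1 \<le> (1 + e*r^2)^2" using e by (simp add: one_le_power)
    ultimately have "94/100 \<le> (1 + e*r^2)^2 - 8/3*r^3" by linarith
    then show ?thesis ..
  next
    case False
    have r3: "0 \<le> r^3" using False by simp
    have "94/100 \<le> 4*r*(1 - e*r^2 + r^3/3)"
    proof (cases "r \<le> 1/2")
      case True
      have "r^2 \<le> (1/2)^2" using True False by (intro power_mono) auto
      then have "e*r^2 \<le> 191/1000*(1/4)" using e by (intro mult_mono) (auto simp: power_divide)
      then have "95/100 \<le> 1 - e*r^2 + r^3/3" using r3 by linarith
      then have "4*(28/100)*(95/100) \<le> 4*r*(1 - e*r^2 + r^3/3)" using False by (intro mult_mono) auto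
      then show ?thesis by simp
    next
      case r: False
      have "r^2 \<le> 1^2" using r1 False by (intro power_mono) auto
      then have "e*r^2 \<le> 191/1000*1" using e by (intro mult_mono) auto
      then have "8/10 \<le> 1 - e*r^2 + r^3/3" using r3 by linarith
      then have "4*(1/2)*(8/10) \<le> 4*r*(1 - e*r^2 + r^3/3)" using r by (intro mult_mono) auto
      then show ?thesis by simp
    qed
    then show ?thesis ..
  qed
  then have "94/100 \<le> \<bar>(1 + e*r^2)^2 - 8/3*r^3\<bar> \<or> 94/100 \<le> \<bar>4*r*(1 - e*r^2 + r^3/3)\<bar>"
    by (meson abs_ge_self order_trans)
  then have "94/100*u^4 \<le> \<bar>(1 + e*r^2)^2 - 8/3*r^3\<bar>*u^4 \<or> 94/100*u^4 \<le> \<bar>4*r*(1 - e*r^2 + r^3/3)\<bar>*u^4"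
    using mult_right_mono[of "94/100" _ "u^4"] by auto
  moreover have "\<bar>(1 + e*r^2)^2 - 8/3*r^3\<bar>*u^4 = \<bar>(u^2 + e*t^2)^2 - 8/3*u*t^3\<bar>"
  proof -
    have "((1 + e*r^2)^2 - 8/3*r^3)*u^4 = (u^2 + e*t^2)^2 - 8/3*u*t^3"
      unfolding tr by (simp add: eval_nat_numeral algebra_simps)
    then show ?thesis by (metis abs_mult abs_of_nonneg zero_le_even_power even_numeral)
  qed
  moreover have "\<bar>4*r*(1 - e*r^2 + r^3/3)\<bar>*u^4 = \<bar>4*t*(u^3 - e*u*t^2 + t^3/3)\<bar>"
  proof -
    have "(4*r*(1 - e*r^2 + r^3/3))*u^4 = 4*t*(u^3 - e*u*t^2 + t^3/3)"
      unfolding tr by (simp add: eval_nat_numeral algebra_simps)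
    then show ?thesis by (metis abs_mult abs_of_nonneg zero_le_even_power even_numeral)
  qed
  moreover have "(max \<bar>u\<bar> t)^4 = u^4" using ut by (simp add: max_def)
  ultimately show ?thesis by (simp only: le_max_iff_disj)
qed

text \<open>The constant 10 rounds up \<open>(1 + 4/10)^2 + 8 = 9.96\<close>; the denominator
  contributes at most \<open>4 * (1 + 4/10 + 1) = 9.6\<close>.\<close>

lemma dup_scaled_upper:
  fixes u t e :: real
  assumes e: "0 \<le> e" "e \<le> 4/10" and t: "t \<ge> 0"
  shows "max \<bar>(u^2 + e*t^2)^2 - 8*u*t^3\<bar> \<bar>4*t*(u^3 - e*u*t^2 + t^3)\<bar> \<le> 10 * (max \<bar>u\<bar> t)^4"
proof -
  define h where "h = max \<bar>u\<bar> t"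
  have h: "\<bar>u\<bar> \<le> h" "\<bar>t\<bar> \<le> h" "0 \<le> h" using t by (auto simp: h_def)
  have prod: "\<bar>a * b\<bar> \<le> A * B" if "\<bar>a\<bar> \<le> A" "\<bar>b\<bar> \<le> B" for a b A B :: real
    unfolding abs_mult using that by (intro mult_mono) auto
  have p: "\<bar>u*u\<bar> \<le> h*h" "\<bar>t*t\<bar> \<le> h*h" "\<bar>u*t\<bar> \<le> h*h" using prod h by blast+
  have ett: "\<bar>e*(t*t)\<bar> \<le> 4/10*(h*h)" by (rule prod[OF _ p(2)]) (use e in simp)
  have s: "\<bar>u*u + e*(t*t)\<bar> \<le> 14/10*(h*h)" using ett p by linarith
  have 1: "\<bar>(u*u + e*(t*t))*(u*u + e*(t*t))\<bar> \<le> (14/10*(h*h))*(14/10*(h*h))" by (rule prod[OF s s])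
  have 2: "\<bar>(u*t)*(t*t)\<bar> \<le> (h*h)*(h*h)" by (rule prod[OF p(3,2)])
  have 3: "\<bar>(u*u)*(u*t)\<bar> \<le> (h*h)*(h*h)" by (rule prod[OF p(1,3)])
  have 4: "\<bar>(e*(t*t))*(u*t)\<bar> \<le> (4/10*(h*h))*(h*h)" by (rule prod[OF ett p(3)])
  have 5: "\<bar>(t*t)*(t*t)\<bar> \<le> (h*h)*(h*h)" by (rule prod[OF p(2,2)])
  have h4: "h^4 = (h*h)*(h*h)" by (simp add: eval_nat_numeral)
  have h40: "0 \<le> (h*h)*(h*h)" by simp
  have "(14/10*(h*h))*(14/10*(h*h)) = 196/100*((h*h)*(h*h))" by simp
  then have "\<bar>(u*u + e*(t*t))*(u*u + e*(t*t)) - 8*((u*t)*(t*t))\<bar> \<le> 10*((h*h)*(h*h))"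
    using 1 2 h40 by linarith
  then have A: "\<bar>(u^2 + e*t^2)^2 - 8*u*t^3\<bar> \<le> 10 * h^4"
    unfolding h4 by (simp add: eval_nat_numeral mult_ac)
  have "(4/10*(h*h))*(h*h) = 4/10*((h*h)*(h*h))" by simp
  then have "\<bar>4*((u*u)*(u*t)) - 4*((e*(t*t))*(u*t)) + 4*((t*t)*(t*t))\<bar> \<le> 10*((h*h)*(h*h))"
    using 3 4 5 h40 by linarith
  moreover have "4*((u*u)*(u*t)) - 4*((e*(t*t))*(u*t)) + 4*((t*t)*(t*t)) = 4*t*(u^3 - e*u*t^2 + t^3)"
    by (simp add: eval_nat_numeral algebra_simps)
  ultimately have B: "\<bar>4*t*(u^3 - e*u*t^2 + t^3)\<bar> \<le> 10 * h^4" unfolding h4 by simp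
  show ?thesis using A B unfolding h_def by simp
qed


context squarefree_curve
begin

text \<open>The ratio \<open>k\<close> of \<open>n^2\<close> to \<open>c^3\<close> is 1/3 for the
  lower estimate and 1 for the upper one. The factor \<open>c\<close> before \<open>dup_den\<close>
  matches the weight in \<open>height_function_max\<close>.\<close>

lemma scaled_coords:
  fixes c :: real and u w :: int
  assumes c: "c > 0" "k * c^3 = (of_int n)^2" and w: "w \<ge> 0" and m1: "m = 1"
  defines "t \<equiv> c * of_int w" and "e \<equiv> 1 / c^2"
  shows "of_int (dup_num m n u w) = (of_int u^2 + e*t^2)^2 - 8*k* of_int u*t^3"
    and "c * of_int (dup_den m n u w) = 4*t*(of_int u^3 - e* of_int u*t^2 + k*t^3)"
proof -
  have et: "e*t^2 = of_int w^2" using c by (simp add: e_def t_def power_mult_distrib)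
  have kt: "k*t^3 = of_int n^2 * of_int w^3" using c(2) by (simp add: t_def power_mult_distrib flip: c(2))
  have "(of_int u^2 + e*t^2)^2 - 8* of_int u*(k*t^3) = of_int (dup_num m n u w)"
    unfolding et kt by (simp add: dup_num_def m1)
  then show "of_int (dup_num m n u w) = (of_int u^2 + e*t^2)^2 - 8*k* of_int u*t^3"
    by (simp add: mult_ac)
  have "4*t*(of_int u^3 - of_int u*(e*t^2) + k*t^3) = c * of_int (dup_den m n u w)"
    unfolding et kt by (simp add: dup_den_def cubic_def m1 t_def)
  then show "c * of_int (dup_den m n u w) = 4*t*(of_int u^3 - e* of_int u*t^2 + k*t^3)"
    by (simp add: mult_ac)
qed

text \<open>The heights are bounded through \<open>q P = q (2P) / 4\<close>, which divides the error
  \<open>ln 10 / 3\<close> by 4; bounding \<open>q P\<close> directly would be too weak for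
  \<open>n = 2\<close>.\<close>

lemma basis_one_left:
  assumes m1: "m = 1" and n2: "n \<ge> 2"
  shows "extends_to_z_basis (mordell_weil m n) {Point 0 (of_int n), Point (- of_int m) (of_int n)}"
proof -
  \<comment> \<open>A larger \<open>c\<close> raises \<open>ln c\<close> in the gap, but at
    \<open>u = 0\<close> the scaled denominator is \<open>4 * n^2 * t^4 / c^3\<close>, which limits
    the constant in \<open>low\<close>; the factor 3 is a compromise. The decimal bounds below are
    the cube roots of 12 and 4, rounded down, for \<open>n = 2\<close>.\<close>
  define c where "c = root 3 (3 * (of_int n)^2)"
  define d where "d = root 3 ((of_int n)^2)"
  have nn: "(of_int n :: real)^2 \<ge> 2^2" using n2 by (intro power_mono) auto
  have c3: "c^3 = 3 * (of_int n)^2" and d3: "d^3 = (of_int n)^2"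
    unfolding c_def d_def by (simp_all add: odd_real_root_pow)
  have pos: "c > 0" "d > 0" using nn unfolding c_def d_def by (auto intro!: real_root_gt_zero)
  have c_ge: "c \<ge> 2289/1000"
  proof (rule ccontr)
    assume "\<not> ?thesis"
    then have "c^3 \<le> (2289/1000)^3" using pos by (intro power_mono) auto
    then show False using c3 nn by (simp add: power_divide)
  qed
  have d_ge: "d \<ge> 1585/1000"
  proof (rule ccontr)
    assume "\<not> ?thesis"
    then have "d^3 \<le> (1585/1000)^3" using pos by (intro power_mono) auto
    then show False using d3 nn by (simp add: power_divide)
  qed
  have ec: "0 \<le> 1/c^2" "1/c^2 \<le> 191/1000"
  proof -
    have "(2289/1000)^2 \<le> c^2" using c_ge by (intro power_mono) auto
    then have "1000/191 \<le> c^2" by (simp add: power_divide)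
    then show "1/c^2 \<le> 191/1000" using pos by (simp add: field_simps)
  qed simp
  have ed: "0 \<le> 1/d^2" "1/d^2 \<le> 4/10"
  proof -
    have "(1585/1000)^2 \<le> d^2" using d_ge by (intro power_mono) auto
    then have "10/4 \<le> d^2" by (simp add: power_divide)
    then show "1/d^2 \<le> 4/10" using pos by (simp add: field_simps)
  qed simp
  define M where "M = (\<lambda>u w::int. max \<bar>of_int u\<bar> (c * \<bar>of_int w\<bar>))"
  define M' where "M' = (\<lambda>u w::int. max \<bar>of_int u\<bar> (d * \<bar>of_int w\<bar>))"
  have M: "height_function M" and M': "height_function M'"
    unfolding M_def M'_def using height_function_max pos by blast+
  have low: "94/100 * M (xnum P) (xden P)^4 \<le> M (dup_num m n (xnum P) (xden P)) (dup_den m n (xnum P) (xden P))"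
    if P: "P \<in> pts" for P
  proof -
    let ?t = "c * of_int (xden P)"
    have "1/3 * c^3 = (of_int n)^2" using c3 by simp
    note sc = scaled_coords[OF pos(1) this xden_nonneg[of P] m1, where u = "xnum P"]
    have 0: "0 \<le> ?t" using pos xden_nonneg[of P] by simp
    have t: "c * \<bar>of_int (xden P)\<bar> = ?t" "c * \<bar>of_int (dup_den m n (xnum P) (xden P))\<bar> = \<bar>c * of_int (dup_den m n (xnum P) (xden P))\<bar>"
      using xden_nonneg[of P] pos by (simp_all add: abs_mult)
    show ?thesis unfolding M_def t unfolding sc using dup_scaled_lower[OF ec 0, of "of_int (xnum P)"] by simp
  qed
  have up: "M' (dup_num m n (xnum P) (xden P)) (dup_den m n (xnum P) (xden P)) \<le> 10 * M' (xnum P) (xden P)^4"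
    if P: "P \<in> pts" for P
  proof -
    let ?t = "d * of_int (xden P)"
    have "1 * d^3 = (of_int n)^2" using d3 by simp
    note sc = scaled_coords[OF pos(2) this xden_nonneg[of P] m1, where u = "xnum P"]
    have 0: "0 \<le> ?t" using pos xden_nonneg[of P] by simp
    have t: "d * \<bar>of_int (xden P)\<bar> = ?t" "d * \<bar>of_int (dup_den m n (xnum P) (xden P))\<bar> = \<bar>d * of_int (dup_den m n (xnum P) (xden P))\<bar>"
      using xden_nonneg[of P] pos by (simp_all add: abs_mult)
    show ?thesis unfolding M'_def t unfolding sc using dup_scaled_upper[OF ed 0, of "of_int (xnum P)"] by simp
  qed
  obtain q C where q: "quadratic_form_group (mordell_weil m n) q" and C: "\<And>P. P \<in> pts \<Longrightarrow> \<bar>q P - ln (of_int (naive P))\<bar> \<le> C"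
    using canonical_height[OF M _ low] by auto
  have k0: "(0::real) < 94/100" "(0::real) < 10" by simp_all
  have ge: "ln (M (xnum P) (xden P)) - correction (xnum P) (xden P) + ln (94/100) / 3 \<le> q P" if "P \<in> pts" for P
    using height_ge[OF q C M k0(1) low that] by simp
  have le: "q P \<le> ln (M' (xnum P) (xden P)) + ln 10 / 3" if "P \<in> pts" for P
    using height_le(1)[OF q C M' k0(2) up that] by simp
  define gap where "gap = ln c - ln 4 / 3 + ln (94/100) / 3"
  have lnc: "ln c = ln (3 * (of_int n)^2) / 3"
    using ln_realpow[of c 3] c3 by simp
  have lnd: "ln d = ln ((of_int n)^2) / 3"
    using ln_realpow[of d 3] d3 by simp
  define R where "R = (ln (4 * d^4) + ln 10 / 3) / 4"
  have gapR: "R / 3 < gap"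
  proof -
    define L where "L = ln ((of_int n :: real)^2)"
    have "ln 4 \<le> L" unfolding L_def using nn by (intro ln_mono) auto
    have "R = (ln 4 + 4 * (L/3) + ln 10 / 3) / 4"
      using pos by (simp add: R_def ln_mult ln_realpow lnd L_def)
    moreover have "gap = (ln 3 + L - ln 4 + ln (94/100)) / 3"
      using n2 by (simp add: gap_def lnc L_def ln_mult)
    \<comment> \<open>The extreme case \<open>L = ln 4\<close>, that is \<open>n = 2\<close>,
      multiplied by 36; the difference of the two sides grows with \<open>L\<close>.\<close>
    moreover have "7 * ln 4 + ln 10 < 12 * (ln 3 + ln (94/100 :: real))"
    proof -
      have "ln (4^7 * 10 :: real) < ln ((3 * (94/100))^12)"
        by (intro ln_strict_mono) (simp_all add: power_divide)
      moreover have "ln (4^7 * 10 :: real) = 7 * ln 4 + ln 10" by (subst ln_mult) (simp_all add: ln_realpow del: power_numeral)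
      moreover have "ln ((3 * (94/100))^12 :: real) = 12 * (ln 3 + ln (94/100))"
      proof -
        have "ln (3 * (94/100) :: real) = ln 3 + ln (94/100)" by (subst ln_mult) simp_all
        then show ?thesis by (simp only: ln_realpow of_nat_numeral)
      qed
      ultimately show ?thesis by (simp only:)
    qed
    ultimately show ?thesis using \<open>ln 4 \<le> L\<close> by argo
  qed
  have gap_le: "gap \<le> q P" if P: "P \<in> pts" "P \<noteq> Infinity" for P
  proof -
    have "xden P \<ge> 1" using P(2) by (cases P) (use xden_Point_pos in \<open>auto simp: int_one_le_iff_zero_less\<close>)
    then have "c * 1 \<le> c * \<bar>of_int (xden P)\<bar>" using pos by (intro mult_left_mono) auto
    then have "c \<le> M (xnum P) (xden P)" by (simp add: M_def)
    then have "ln c \<le> ln (M (xnum P) (xden P))" using pos by (intro ln_mono)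
    moreover have "\<not> sing3 m (xnum P) (xden P)" by (simp add: sing3_def m1)
    then have "correction (xnum P) (xden P) \<le> ln 4 / 3" by (simp add: correction_def)
    ultimately show ?thesis using ge[OF P(1)] unfolding gap_def by linarith
  qed
  let ?P = "Point 0 (of_int n)" and ?Q = "Point (- of_int m) (of_int n)" and ?S = "Point 1 (- of_int n)"
  have on: "?P \<in> pts" "?Q \<in> pts" "?S \<in> pts" by (simp_all add: m1)
  have PQ: "ec_add coefA ?P ?Q = ?S" by (simp add: m1)
  have d4: "d^3 \<le> d^4"
    using d_ge by (intro power_increasing) auto
  have d31: "1 \<le> d^3" using nn d3 by simp
  have "0 \<le> ln (4 * d^4)" using d4 d31 by simp
  then have R0: "0 \<le> R" by (simp add: R_def)
  have gap0: "gap > 0" using gapR R0 by linarith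
  interpret gap_quadratic_group "mordell_weil m n" q gap
    by (rule gap_quadratic_group_mw[OF q C gap0 gap_le])
  have qle: "q P \<le> (ln (M' (xnum (ec_add coefA P P)) (xden (ec_add coefA P P))) + ln 10 / 3) / 4" if "P \<in> pts" for P
    using le[of "ec_add coefA P P"] q_double[of P] ec_add_closed[OF nonsingular that that] that by simp
  \<comment> \<open>At \<open>k = 0\<close> nothing cancels and \<open>d\<close> times the
    denominator is exactly \<open>4 * d^4\<close>. At \<open>k = 1\<close> and \<open>k = -1\<close>
    the numerator is larger, but a factor 4 cancels.\<close>
  have bound: "q P \<le> R" if P: "P = Point (of_int k) y" "P \<in> pts" "k \<in> {-1,0,1}" for P k y
  proof -
    have uw: "xnum P = k" "xden P = 1" unfolding P(1) by simp_all
    have nd: "(of_int n :: real)^2 = d^3" using d3 by simp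
    have dd: "d * \<bar>4 * d^3\<bar> = 4 * d^4" using pos by (simp add: abs_mult eval_nat_numeral)
    have "\<bar>real_of_int (dup_num m n k 1)\<bar> \<le> 4 * d^4 * of_int (cancel m k 1)"
      using P(3) d4 d31 by (auto simp: dup_num_def m1 nd cancel_def sing2_def sing3_def)
    moreover have "d * \<bar>real_of_int (dup_den m n k 1)\<bar> \<le> 4 * d^4 * of_int (cancel m k 1)"
      using P(3) d4 d31 by (auto simp: dup_den_def cubic_def m1 nd dd cancel_def sing2_def sing3_def)
    ultimately have "M' (dup_num m n k 1) (dup_den m n k 1) \<le> 4 * d^4 * of_int (cancel m k 1)"
      by (simp add: M'_def)
    then have "of_int (cancel m k 1) * M' (xnum (ec_add coefA P P)) (xden (ec_add coefA P P)) \<le> of_int (cancel m k 1) * (4 * d^4)"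
      using height_function_double[OF M' P(2)] by (simp add: uw mult.commute)
    then have "M' (xnum (ec_add coefA P P)) (xden (ec_add coefA P P)) \<le> 4 * d^4"
      using cancel_ge_1[of k 1] by simp
    then have "ln (M' (xnum (ec_add coefA P P)) (xden (ec_add coefA P P))) \<le> ln (4 * d^4)"
      using height_function_pos[OF M'] by (intro ln_mono)
    then show ?thesis using qle[OF P(2)] unfolding R_def by simp
  qed
  have "q ?P \<le> R" by (rule bound[OF _ on(1), of 0]) simp_all
  moreover have "q ?Q \<le> R" by (rule bound[OF _ on(2), of "-1"]) (simp_all add: m1)
  moreover have "q ?S \<le> R" by (rule bound[OF _ on(3), of 1]) simp_all
  ultimately show ?thesis
    using extends_to_z_basis_two[of ?P ?Q R] on gapR m_pos by (simp add: PQ del: ec_add.simps Point_on_curve)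
qed

end

section \<open>The case n = 1\<close>

lemma height_function_sqrt:
  assumes c: "c > 0"
  shows "height_function (\<lambda>u w. sqrt ((of_int u)^2 + (c * of_int w)^2))"
  unfolding height_function_def
proof (intro conjI allI)
  fix g u w :: int
  have "(of_int (g*u))^2 + (c * of_int (g*w))^2 = (of_int g)^2 * ((of_int u)^2 + (c * of_int w :: real)^2)"
    by (simp add: power2_eq_square algebra_simps)
  then show "sqrt ((of_int (g*u))^2 + (c * of_int (g*w))^2) = \<bar>of_int g\<bar> * sqrt ((of_int u)^2 + (c * of_int w)^2)"
    by (simp add: real_sqrt_mult)
next
  have "min 1 c * of_int (max \<bar>u\<bar> \<bar>w\<bar>) \<le> sqrt ((of_int u)^2 + (c * of_int w)^2)" for u w :: int
  proof (cases "\<bar>w\<bar> \<le> \<bar>u\<bar>")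
    case True
    have "min 1 c * of_int \<bar>u\<bar> \<le> 1 * of_int \<bar>u\<bar>" by (intro mult_right_mono) auto
    also have "\<dots> = sqrt ((of_int u)^2)" by simp
    also have "\<dots> \<le> sqrt ((of_int u)^2 + (c * of_int w)^2)" by (intro real_sqrt_le_mono) simp
    finally show ?thesis using True by simp
  next
    case False
    have "min 1 c * of_int \<bar>w\<bar> \<le> c * of_int \<bar>w\<bar>" by (intro mult_right_mono) auto
    also have "\<dots> = sqrt ((c * of_int w)^2)" using c by (simp add: abs_mult)
    also have "\<dots> \<le> sqrt ((of_int u)^2 + (c * of_int w)^2)" by (intro real_sqrt_le_mono) simp
    finally show ?thesis using False by simp
  qed
  then show "\<exists>d>0. \<forall>u w. d * of_int (max \<bar>u\<bar> \<bar>w\<bar>) \<le> sqrt ((of_int u)^2 + (c * of_int w)^2)"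
    using c by (intro exI[of _ "min 1 c"]) auto
next
  have "sqrt ((of_int u)^2 + (c * of_int w)^2) \<le> (1 + c) * of_int (max \<bar>u\<bar> \<bar>w\<bar>)" for u w :: int
  proof -
    have "sqrt ((of_int u)^2 + (c * of_int w)^2) \<le> \<bar>of_int u\<bar> + \<bar>c * of_int w\<bar>"
      by (rule sqrt_sum_squares_le_sum_abs)
    also have "\<dots> \<le> 1 * of_int (max \<bar>u\<bar> \<bar>w\<bar>) + c * of_int (max \<bar>u\<bar> \<bar>w\<bar>)"
      using c by (intro add_mono) (auto simp: abs_mult intro!: mult_left_mono)
    finally show ?thesis by (simp add: distrib_right)
  qed
  then show "\<exists>d>0. \<forall>u w. sqrt ((of_int u)^2 + (c * of_int w)^2) \<le> d * of_int (max \<bar>u\<bar> \<bar>w\<bar>)"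
    using c by (intro exI[of _ "1 + c"]) auto
qed

text \<open>At \<open>d = 0\<close>, the curve \<open>y^2 = x^3 - x\<close>, one has
  \<open>N = S^2\<close> and \<open>\<bar>D\<bar> \<le> S^2\<close>, whence the constants 1 and
  \<open>sqrt 2\<close> for the Euclidean norm; \<open>d\<close> is a perturbation.\<close>

lemma dup_sqrt_bounds:
  fixes u t d :: real
  defines "S \<equiv> u^2 + t^2"
  assumes d: "0 \<le> d" "d < 1"
    and N: "N = S^2 - 2*d*u*t^3" and D: "D = 4*t*u*(u^2 - t^2) + d*t^4"
  shows "(1 - d) * sqrt S^4 \<le> sqrt (N^2 + D^2)" and "sqrt (N^2 + D^2) \<le> sqrt 2 * (1 + d) * sqrt S^4"
proof -
  have S0: "0 \<le> S" by (simp add: S_def)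
  have S4: "sqrt S^4 = S^2"
    using S0 by (metis power_mult mult_2_right numeral_Bit0 real_sqrt_pow2 power2_eq_square power_even_eq)
  have tt: "t^2 \<le> S" by (simp add: S_def)
  have ut: "\<bar>2*(u*t)\<bar> \<le> S"
    using sum_squares_ge_zero[of "u-t" 0] sum_squares_ge_zero[of "u+t" 0]
    by (simp add: S_def abs_le_iff power2_eq_square algebra_simps)
  have "\<bar>2*(u*t)\<bar> * t^2 \<le> S * S" using ut tt by (intro mult_mono) auto
  then have "\<bar>2*u*t^3\<bar> \<le> S^2" by (simp add: abs_mult eval_nat_numeral mult_ac)
  then have "d * \<bar>2*u*t^3\<bar> \<le> d * S^2" using d by (intro mult_left_mono)
  then have ud: "\<bar>2*d*u*t^3\<bar> \<le> d * S^2" using d by (simp add: abs_mult mult_ac)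
  then have "S^2 - d*S^2 \<le> N" "N \<le> S^2 + d*S^2" unfolding N by linarith+
  then have N': "(1-d)*S^2 \<le> N" "N \<le> (1+d)*S^2" by (simp_all add: algebra_simps)
  have N0: "0 \<le> N" using N'(1) d by (smt (verit) mult_nonneg_nonneg zero_le_power2)
  show "(1 - d) * sqrt S^4 \<le> sqrt (N^2 + D^2)"
  proof -
    have "(1-d) * S^2 \<le> sqrt (N^2)" using N' N0 by simp
    also have "\<dots> \<le> sqrt (N^2 + D^2)" by (intro real_sqrt_le_mono) simp
    finally show ?thesis unfolding S4 .
  qed
  \<comment> \<open>Both combinations are squares, hence nonnegative.\<close>
  have "S^2 - 4*t*u*(u^2 - t^2) = (u^2 - 2*u*t - t^2)^2" "S^2 + 4*t*u*(u^2 - t^2) = (u^2 + 2*u*t - t^2)^2"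
    by (simp_all add: S_def power2_eq_square algebra_simps)
  then have 1: "\<bar>4*t*u*(u^2 - t^2)\<bar> \<le> S^2" using zero_le_power2 by (smt (verit))
  have "t^2 * t^2 \<le> S * S" using tt S0 by (intro mult_mono) auto
  then have "d * t^4 \<le> d * S^2" using d by (intro mult_left_mono) (auto simp: eval_nat_numeral)
  moreover have "0 \<le> d * t^4" using d by simp
  ultimately have "\<bar>D\<bar> \<le> S^2 + d*S^2" using 1 unfolding D by linarith
  then have D': "\<bar>D\<bar> \<le> (1+d)*S^2" by (simp add: algebra_simps)
  have "N^2 \<le> ((1+d)*S^2)^2" using N' N0 by (intro power_mono)
  moreover have "D^2 \<le> ((1+d)*S^2)^2" using power_mono[OF D', of 2] by simp
  ultimately have "sqrt (N^2 + D^2) \<le> sqrt (2 * ((1+d)*S^2)^2)" by (intro real_sqrt_le_mono) simp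
  also have "\<dots> = sqrt 2 * (1 + d) * S^2" using d by (simp add: real_sqrt_mult)
  finally show "sqrt (N^2 + D^2) \<le> sqrt 2 * (1 + d) * sqrt S^4" unfolding S4 .
qed

text \<open>Replacing \<open>p\<^sup>2\<close> by its tangent at \<open>1/3\<close> leaves an affine function of \<open>p\<close>, checked at both ends.\<close>

lemma quadratic_below:
  fixes p :: real
  assumes p: "0 \<le> p" "p \<le> 1/2" and X: "0 \<le> X"
    and A: "s/4 + X/9 < L" "s/4 + s/2 + X/9 - X/3 < L"
  shows "s/4 + s*p - X*p^2 < L"
proof -
  define A0 where "A0 = L - s/4 - X/9"
  define A1 where "A1 = L - s/4 - s/2 - X/9 + X/3"
  define M where "M = min A0 A1"
  have "M > 0" using A by (simp add: M_def A0_def A1_def)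
  have "M = (1-2*p)*M + 2*p*M" by (simp add: algebra_simps)
  also have "\<dots> \<le> (1-2*p)*A0 + 2*p*A1" using p by (intro add_mono mult_left_mono) (auto simp: M_def)
  also have "\<dots> = L - s/4 - s*p + X*p^2 - X*(p-1/3)^2"
    by (simp add: A0_def A1_def power2_eq_square field_simps)
  also have "\<dots> \<le> L - s/4 - s*p + X*p^2" using X by simp
  finally show ?thesis using \<open>M > 0\<close> by linarith
qed

context squarefree_curve
begin

text \<open>Substituting \<open>x = m X\<close> gives \<open>y^2 = m^3 (X^3 - X) + 1\<close>, so
  relative to the curve of \<open>d = 0\<close> the constant term is of order
  \<open>1/m^3\<close>.\<close>

lemma dup_scaled_one:
  fixes u w :: int
  assumes n1: "n = 1"
  defines "t \<equiv> of_int m * of_int w :: real" and "d \<equiv> 4 / of_int m^3 :: real"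
  shows "of_int (dup_num m n u w) = (of_int u^2 + t^2)^2 - 2*d* of_int u*t^3"
    and "of_int m * of_int (dup_den m n u w) = 4*t* of_int u*(of_int u^2 - t^2) + d*t^4"
proof -
  have 1: "d*t^3 = 4* of_int w^3" using m_pos by (simp add: d_def t_def power_mult_distrib)
  have 2: "t^2 = of_int m^2 * of_int w^2" by (simp add: t_def power_mult_distrib)
  have "(of_int u^2 + t^2)^2 - 2* of_int u*(d*t^3) = of_int (dup_num m n u w)"
    unfolding 1 2 by (simp add: dup_num_def n1)
  then show "of_int (dup_num m n u w) = (of_int u^2 + t^2)^2 - 2*d* of_int u*t^3" by (simp add: mult_ac)
  have "4*t* of_int u*(of_int u^2 - t^2) + t*(d*t^3) = of_int m * of_int (dup_den m n u w)"
    unfolding 1 2 by (simp add: dup_den_def cubic_def n1 t_def eval_nat_numeral algebra_simps)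
  then show "of_int m * of_int (dup_den m n u w) = 4*t* of_int u*(of_int u^2 - t^2) + d*t^4"
    by (simp add: eval_nat_numeral mult_ac)
qed

text \<open>\<open>\<epsilon>\<close> covers the perturbation in both directions:
  \<open>4 / (m^3 - 4)\<close> equals \<open>d / (1 - d)\<close>, which bounds
  \<open>- ln (1 - d)\<close> and \<open>ln (1 + d)\<close>.\<close>

lemma height_bounds_one:
  assumes n1: "n = 1" and m4: "m \<ge> 4"
    and \<epsilon>: "4 / (of_int m^3 - 4) \<le> 3 * \<epsilon>"
  defines "L \<equiv> ln (real_of_int m)"
  obtains q C where "quadratic_form_group (mordell_weil m n) q" "\<And>P. P \<in> pts \<Longrightarrow> \<bar>q P - ln (of_int (naive P))\<bar> \<le> C"
    and "\<And>P. P \<in> pts \<Longrightarrow> P \<noteq> Infinity \<Longrightarrow> L - 2/3 * ln 2 - (if 3 dvd m then ln 3 / 2 else 0) - \<epsilon> \<le> q P"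
    and "\<And>k y. Point (of_int k) y \<in> pts \<Longrightarrow> q (Point (of_int k) y)
      \<le> ln ((of_int k)^2 + (of_int m)^2) / 2 - (if sing2 m k 1 then 2/3 * ln 2 else 0)
        - (if sing3 m k 1 then ln 3 / 2 else 0) + ln 2 / 6 + \<epsilon>"
proof -
  define d where "d = 4 / (of_int m :: real)^3"
  have "(4::real)^3 \<le> of_int m^3" using m4 by (intro power_mono) auto
  then have m3: "64 \<le> (of_int m :: real)^3" by simp
  have mp: "(0::real) < of_int m" using m4 by simp
  have d: "0 \<le> d" "d < 1" using m3 mp by (auto simp: d_def)
  have lnd: "- \<epsilon> \<le> ln (1 - d) / 3" "ln (1 + d) / 3 \<le> \<epsilon>"
  proof -
    have "- ln (1 - d) = ln (1 / (1 - d))" using d by (simp add: ln_div)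
    also have "\<dots> \<le> 1 / (1 - d) - 1" using d by (intro ln_le_minus_one) simp
    also have "\<dots> = 4 / (of_int m^3 - 4)" using m3 m4 by (simp add: d_def field_simps)
    finally show "- \<epsilon> \<le> ln (1 - d) / 3" using \<epsilon> by linarith
    have "ln (1 + d) \<le> d" using d by (intro ln_add_one_self_le_self)
    also have "d \<le> 4 / (of_int m^3 - 4)" unfolding d_def using m3 by (intro frac_le) auto
    finally show "ln (1 + d) / 3 \<le> \<epsilon>" using \<epsilon> by linarith
  qed
  define M where "M = (\<lambda>u w::int. sqrt ((of_int u)^2 + (of_int m * of_int w)^2))"
  have M: "height_function M" unfolding M_def by (rule height_function_sqrt[OF mp])
  note sc = dup_scaled_one[OF n1, folded d_def]
  have low: "(1 - d) * M (xnum P) (xden P)^4 \<le> M (dup_num m n (xnum P) (xden P)) (dup_den m n (xnum P) (xden P))"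
    and up: "M (dup_num m n (xnum P) (xden P)) (dup_den m n (xnum P) (xden P)) \<le> sqrt 2 * (1 + d) * M (xnum P) (xden P)^4" for P
    unfolding M_def by (rule dup_sqrt_bounds[OF d sc])+
  have k0: "0 < 1 - d" "0 < sqrt 2 * (1 + d)" using d by simp_all
  obtain q C where q: "quadratic_form_group (mordell_weil m n) q" and C: "\<And>P. P \<in> pts \<Longrightarrow> \<bar>q P - ln (of_int (naive P))\<bar> \<le> C"
    using canonical_height[OF M k0(1) low] by blast
  have "ln (4::real) = ln (2^2)" "ln (9::real) = ln (3^2)" by simp_all
  then have ln49: "ln (4::real) = 2 * ln 2" "ln (9::real) = 2 * ln 3" by (simp_all only: ln_realpow of_nat_numeral)
  have cor: "correction u w = (if sing2 m u w then 2/3 * ln 2 else 0) + (if sing3 m u w then ln 3 / 2 else 0)" for u w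
    by (simp add: correction_def ln49)
  show ?thesis
  proof (rule that[OF q C])
    fix P assume P: "P \<in> pts" "P \<noteq> Infinity"
    have "xden P \<ge> 1" using P(2) by (cases P) (use xden_Point_pos in \<open>auto simp: int_one_le_iff_zero_less\<close>)
    then have "of_int m * 1 \<le> of_int m * \<bar>real_of_int (xden P)\<bar>" using mp by (intro mult_left_mono) auto
    also have "\<dots> = sqrt ((of_int m * of_int (xden P))^2)" using mp by (simp add: abs_mult)
    also have "\<dots> \<le> M (xnum P) (xden P)" unfolding M_def by (intro real_sqrt_le_mono) simp
    finally have "L \<le> ln (M (xnum P) (xden P))" unfolding L_def using mp by (intro ln_mono) auto
    moreover have "correction (xnum P) (xden P) \<le> 2/3 * ln 2 + (if 3 dvd m then ln 3 / 2 else 0)"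
      unfolding cor by (intro add_mono) (auto simp: sing3_def)
    ultimately show "L - 2/3 * ln 2 - (if 3 dvd m then ln 3 / 2 else 0) - \<epsilon> \<le> q P"
      using height_ge[OF q C M k0(1) low P(1)] lnd(1) by linarith
  next
    fix k y assume P: "Point (of_int k) y \<in> pts"
    have "odd n" using n1 by simp
    from height_le(2)[OF q C M k0(2) up P this]
    have "q (Point (of_int k) y) \<le> ln (M k 1) - correction k 1 + ln (sqrt 2 * (1 + d)) / 3" by simp
    moreover have "ln (M k 1) = ln ((of_int k)^2 + (of_int m)^2) / 2"
      unfolding M_def using mp by (simp add: ln_sqrt add_nonneg_pos)
    moreover have "ln (sqrt 2 * (1 + d)) = ln 2 / 2 + ln (1 + d)"
      using d by (simp add: ln_mult ln_sqrt)
    ultimately show "q (Point (of_int k) y)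
      \<le> ln ((of_int k)^2 + (of_int m)^2) / 2 - (if sing2 m k 1 then 2/3 * ln 2 else 0)
        - (if sing3 m k 1 then ln 3 / 2 else 0) + ln 2 / 6 + \<epsilon>"
      using lnd(2) unfolding cor by argo
  qed
qed


text \<open>The three points and their sums have x-coordinates of order at most \<open>m\<close> and
  heights near \<open>ln m\<close>, except the sum of the first and third, with
  \<open>x = m^2 - 2*m + 2\<close> and height near \<open>2 * ln m\<close>. It plays the long
  vector. If 3 divides \<open>m\<close> the gap is smaller, but so are the heights at the points
  with \<open>x = -1\<close> modulo 3.\<close>

lemma basis_one_right:
  assumes n1: "n = 1" and m4: "m \<ge> 4"
  shows "extends_to_z_basis (mordell_weil m n) {Point 0 1, Point (- of_int m) 1, Point (- 1) (of_int m)}"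
proof -
  define a b L where "a = ln (2::real)" and "b = ln (3::real)" and "L = ln (real_of_int m)"
  \<comment> \<open>Rounded up from \<open>4 / (3 * (m^3 - 4))\<close> at \<open>m = 6\<close> and
    \<open>m = 4\<close>, the smallest admissible values.\<close>
  define \<epsilon> :: real where "\<epsilon> = (if 3 dvd m then 63/10000 else 223/10000)"
  have a: "a \<ge> 2/3" unfolding a_def by (rule ln2_ge_two_thirds)
  have ba: "19 * a \<le> 12 * b"
  proof -
    have "ln ((2::real)^19) \<le> ln (3^12)" by (intro ln_mono) simp_all
    then show ?thesis by (simp only: ln_realpow of_nat_numeral a_def b_def)
  qed
  have m6: "m \<ge> 6" if "3 dvd m" using that m4 by presburger
  have m9: "m \<ge> 9" if "3 dvd m" "odd m" using that m4 by presburger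
  have "4 / (of_int m^3 - 4) \<le> 3 * \<epsilon>"
  proof (cases "3 dvd m")
    case True
    have "(6::real)^3 \<le> of_int m^3" using m6[OF True] by (intro power_mono) auto
    then have "4 / (of_int m^3 - 4) \<le> 4 / (212::real)" by (intro frac_le) auto
    then show ?thesis using True by (simp add: \<epsilon>_def)
  next
    case False
    have "(4::real)^3 \<le> of_int m^3" using m4 by (intro power_mono) auto
    then have "4 / (of_int m^3 - 4) \<le> 4 / (60::real)" by (intro frac_le) auto
    then show ?thesis using False by (simp add: \<epsilon>_def)
  qed
  from height_bounds_one[OF n1 m4 this] obtain q C
    where q: "quadratic_form_group (mordell_weil m n) q" and C: "\<And>P. P \<in> pts \<Longrightarrow> \<bar>q P - ln (of_int (naive P))\<bar> \<le> C"
    and low: "\<And>P. P \<in> pts \<Longrightarrow> P \<noteq> Infinity \<Longrightarrow> L - 2/3*a - (if 3 dvd m then b/2 else 0) - \<epsilon> \<le> q P"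
    and up: "\<And>k y. Point (of_int k) y \<in> pts \<Longrightarrow> q (Point (of_int k) y)
      \<le> ln ((of_int k)^2 + (of_int m)^2) / 2 - (if sing2 m k 1 then 2/3*a else 0) - (if sing3 m k 1 then b/2 else 0) + a/6 + \<epsilon>"
    unfolding a_def b_def L_def by metis
  define c where "c = (if 3 dvd m then b/2 else 0)"
  define gap where "gap = L - 2/3*a - c - \<epsilon>"
  have mp: "(0::real) < of_int m" using m4 by simp
  have lnm: "ln (x * (of_int m)^2) / 2 = ln x / 2 + L" if "x > 0" for x :: real
    using that mp by (simp add: ln_mult ln_realpow L_def)
  have ln_le: "ln ((of_int k)^2 + (of_int m)^2) / 2 \<le> ln x / 2 + L"
    if "(of_int k)^2 + (of_int m)^2 \<le> x * (of_int m :: real)^2" "x > 0" for k and x :: real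
  proof -
    have "0 < (of_int k)^2 + (of_int m :: real)^2" using mp by (simp add: add_nonneg_pos)
    then have "ln ((of_int k)^2 + (of_int m)^2) \<le> ln (x * (of_int m :: real)^2)" using that by (intro ln_mono)
    then show ?thesis using lnm[OF that(2)] by linarith
  qed
  let ?Pa = "Point 0 1" and ?Pb = "Point (- of_int m) 1" and ?Pc = "Point (- 1) (of_int m)"
  let ?Pab = "Point (of_int m) (- 1)" and ?Pbc = "Point (of_int m + 2) (- 2 * of_int m - 3)"
  let ?Pac = "ec_add coefA ?Pa ?Pc" and ?Pabc = "ec_add coefA (ec_add coefA ?Pa ?Pb) ?Pc"
  have on: "?Pa \<in> pts" "?Pb \<in> pts" "?Pc \<in> pts" by (simp_all add: n1 eval_nat_numeral)
  have mq: "(of_int m :: rat) \<noteq> 0" "(of_int m :: rat) \<noteq> 1" "(of_int m :: rat) \<noteq> -1" using m4 by auto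
  have P01: "ec_add coefA ?Pa ?Pb = ?Pab"
    using ec_add_distinct[of 0 "- of_int m" 1 1 0 coefA] mq by simp
  have P12: "ec_add coefA ?Pb ?Pc = ?Pbc"
    using ec_add_distinct[of "- of_int m" "- 1" "of_int m" 1 1 coefA] mq by simp
  have "(of_int m - 1) / (- 1 - 0) = (1 - of_int m :: rat)" by simp
  from ec_add_distinct[OF _ this, of coefA]
  have "?Pac = Point ((1 - of_int m)^2 - 0 - (- 1)) ((1 - of_int m) * (0 - ((1 - of_int m)^2 - 0 - (- 1))) - 1)" by simp
  moreover have "(1 - of_int m)^2 - 0 - (- 1) = (of_int (m^2 - 2*m + 2) :: rat)"
    by (simp add: power2_eq_square algebra_simps)
  ultimately obtain y02 where P02: "?Pac = Point (of_int (m^2 - 2*m + 2)) y02" by metis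
  have "(of_int m - (- 1)) / (- 1 - of_int m) = (- 1 :: rat)" using mq
    by (simp add: divide_eq_eq)
  from ec_add_distinct[OF _ this, of coefA] mq obtain y012 where P012: "?Pabc = Point (of_int (2 - m)) y012"
    unfolding P01 by simp
  note cl = ec_add_closed[OF nonsingular]
  have on': "?Pab \<in> pts" "?Pbc \<in> pts" "?Pac \<in> pts" "?Pabc \<in> pts"
    using cl[OF on(1,2)] cl[OF on(2,3)] cl[OF on(1,3)] cl[OF cl[OF on(1,2)] on(3)] by (simp_all only: P01 P12)
  have s3: "sing3 m k 1 \<longleftrightarrow> 3 dvd m" if "3 dvd m \<Longrightarrow> 3 dvd k + 1" for k
    using that by (auto simp: sing3_def)
  have e: "\<epsilon> \<ge> 0" by (simp add: \<epsilon>_def)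
  have u0: "q ?Pa \<le> L - (if even m then 2/3*a else 0) + a/6 + \<epsilon>"
  proof -
    have "sing2 m 0 1 \<longleftrightarrow> even m" "\<not> sing3 m 0 1" by (auto simp: sing2_def sing3_def)
    moreover have "ln ((of_int 0)^2 + (of_int m)^2) / 2 \<le> ln 1 / 2 + L" by (rule ln_le) simp_all
    ultimately show ?thesis using up[of 0 1] on(1) by simp
  qed
  \<comment> \<open>The constants cancel exactly: \<open>a/2\<close> from \<open>2 * m^2\<close>,
    \<open>- 2/3*a\<close> from singularity modulo 2, and \<open>a/6\<close>.\<close>
  have ul: "q P \<le> L + \<epsilon>" if "P = Point (of_int k) y" "P \<in> pts" "k = m \<or> k = - m" for P k y
  proof -
    have "sing2 m k 1" using that by (auto simp: sing2_def)
    moreover have "(if sing3 m k 1 then b/2 else 0) \<ge> 0" by (simp add: b_def)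
    moreover have "ln ((of_int k)^2 + (of_int m)^2) / 2 \<le> ln 2 / 2 + L" by (rule ln_le) (use that in auto)
    ultimately show ?thesis using up[of k y] that unfolding a_def[symmetric] by simp
  qed
  have u1: "q ?Pb \<le> L + \<epsilon>" by (rule ul[of _ "-m" 1]) (use on in simp_all)
  have u01: "q ?Pab \<le> L + \<epsilon>" by (rule ul[of _ m "-1"]) (use on' in simp_all)
  have mr4: "(4::real) \<le> of_int m" using m4 by simp
  have mm: "4 * of_int m \<le> (of_int m :: real)^2" using m4 by (simp add: power2_eq_square)
  have u2: "q ?Pc \<le> L + 1/32 - c + a/6 + \<epsilon>"
  proof -
    have "(if sing2 m (-1) 1 then 2/3*a else 0) \<ge> 0" by (simp add: a_def)
    moreover have "sing3 m (-1) 1 \<longleftrightarrow> 3 dvd m" by (rule s3) simp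
    moreover have "ln ((of_int (-1))^2 + (of_int m)^2) / 2 \<le> ln (17/16) / 2 + L" using mm m4 by (intro ln_le) auto
    moreover have "ln (17/16 :: real) \<le> 17/16 - 1" by (rule ln_le_minus_one) simp
    ultimately show ?thesis using up[of "-1" "of_int m"] on(3) by (simp add: c_def)
  qed
  have u12: "q ?Pbc \<le> L + 7/8*a - 2/3*a - c + a/6 + \<epsilon>"
  proof -
    have "sing2 m (m+2) 1" by (simp add: sing2_def)
    moreover have "sing3 m (m+2) 1 \<longleftrightarrow> 3 dvd m" by (rule s3) simp
    \<comment> \<open>The factor 13/4 is attained at \<open>m = 4\<close>.\<close>
    moreover have "ln ((of_int (m+2))^2 + (of_int m)^2) / 2 \<le> ln (13/4) / 2 + L"
    proof (rule ln_le)
      have "(of_int (m+2))^2 + (of_int m)^2 = 2 * (of_int m)^2 + 4 * of_int m + (4::real)"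
        by (simp add: power2_eq_square algebra_simps)
      then show "(of_int (m+2))^2 + (of_int m)^2 \<le> 13/4 * (of_int m :: real)^2" using mm mr4 by linarith
    qed simp
    moreover have "ln (13/4 :: real) \<le> 7/4*a"
    proof -
      have "ln ((13/4 :: real)^4) \<le> ln (2^7)" by (intro ln_mono) (simp_all add: power_divide)
      then have "4 * ln (13/4 :: real) \<le> 7 * a" by (simp only: ln_realpow of_nat_numeral a_def)
      then show ?thesis by simp
    qed
    ultimately show ?thesis using up[of "m+2" "- 2 * of_int m - 3"] on'(2) by (simp add: c_def)
  qed
  have u012: "q ?Pabc \<le> L - c + \<epsilon>"
  proof -
    have "sing2 m (2-m) 1" by (simp add: sing2_def)
    moreover have "sing3 m (2-m) 1 \<longleftrightarrow> 3 dvd m" by (rule s3) presburger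
    moreover have "ln ((of_int (2-m))^2 + (of_int m)^2) / 2 \<le> ln 2 / 2 + L"
    proof (rule ln_le)
      have "(of_int (2-m))^2 + (of_int m)^2 = 2 * (of_int m)^2 - 4 * of_int m + (4::real)"
        by (simp add: power2_eq_square algebra_simps)
      then show "(of_int (2-m))^2 + (of_int m)^2 \<le> 2 * (of_int m :: real)^2" using mr4 by linarith
    qed simp
    ultimately show ?thesis using up[of "2-m" y012] on'(4) unfolding P012 a_def[symmetric] c_def by simp
  qed
  have u02: "q ?Pac \<le> 2*L - a/2 - c + \<epsilon>"
  proof -
    let ?k = "m^2 - 2*m + 2"
    have "sing2 m ?k 1" by (simp add: sing2_def)
    moreover have "sing3 m ?k 1 \<longleftrightarrow> 3 dvd m"
    proof (rule s3)
      assume "3 dvd m"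
      then obtain j where "m = 3*j" by blast
      then have "?k + 1 = 3*(3*j^2 - 2*j + 1)" by (simp add: power2_eq_square)
      then show "3 dvd ?k + 1" by simp
    qed
    moreover have "ln ((of_int ?k)^2 + (of_int m)^2) / 2 \<le> ln ((of_int m)^2) / 2 + L"
    proof (rule ln_le)
      have "4 * (of_int m)^2 \<le> of_int m * (of_int m :: real)^2" using m4 by (intro mult_right_mono) auto
      then have "4 * (of_int m)^2 \<le> (of_int m :: real)^3" by (simp add: eval_nat_numeral)
      moreover have "(0::real) \<le> (of_int m)^2" by simp
      ultimately have "0 \<le> 4 * (of_int m)^3 - 9 * (of_int m)^2 + 8 * of_int m - (4::real)" using mp m4 by linarith
      then show "(of_int ?k)^2 + (of_int m)^2 \<le> (of_int m)^2 * (of_int m :: real)^2"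
        by (simp add: eval_nat_numeral algebra_simps)
    qed (use mp in simp)
    moreover have "ln ((of_int m)^2) = 2 * L" using mp by (simp add: ln_realpow L_def)
    ultimately show ?thesis using up[of ?k y02] on'(3) unfolding P02 c_def by simp
  qed
  \<comment> \<open>The largest of the short bounds: \<open>3/8*a\<close> stems from
    \<open>?Pbc\<close>, \<open>a/6\<close> from \<open>?Pa\<close> at odd \<open>m\<close>. If 3
    does not divide \<open>m\<close>, the cubic ratio \<open>l = 2 * s\<close> leaves enough room;
    otherwise the gap loses \<open>b/2\<close> and the sharper bound for \<open>?Pac\<close> is
    kept.\<close>
  define s where "s = (if 3 dvd m then (if even m then L + \<epsilon> else L + a/6 + \<epsilon>) else L + 3/8*a + \<epsilon>)"
  define l where "l = (if 3 dvd m then 2*L - a/2 - c + \<epsilon> else 2* s)"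
  have L4: "2*a \<le> L"
  proof -
    have "ln ((2::real)^2) \<le> L" unfolding L_def using m4 by (intro ln_mono) auto
    then show ?thesis by (simp only: ln_realpow of_nat_numeral a_def)
  qed
  have L6: "a + b \<le> L" if "3 dvd m"
  proof -
    have "ln (2 * 3 :: real) \<le> L" unfolding L_def using m6[OF that] by (intro ln_mono) auto
    then show ?thesis unfolding a_def b_def by (subst (asm) ln_mult) simp
  qed
  have L9: "2*b \<le> L" if "3 dvd m" "odd m"
  proof -
    have "ln ((3::real)^2) \<le> L" unfolding L_def using m9[OF that] by (intro ln_mono) auto
    then show ?thesis by (simp only: ln_realpow of_nat_numeral b_def)
  qed
  have bounds: "q ?Pa \<le> s \<and> q ?Pb \<le> s \<and> q ?Pc \<le> s \<and> q ?Pab \<le> s \<and> q ?Pbc \<le> s \<and> q ?Pabc \<le> s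
    \<and> q ?Pac \<le> l \<and> s \<le> l \<and> gap > 0 \<and> 0 \<le> X \<and> s/4 + X/9 < gap \<and> s/4 + s/2 + X/9 - X/3 < gap"
    if X: "X = 3 * s - l" for X
  proof -
    consider "\<not> 3 dvd m" | "3 dvd m" "even m" | "3 dvd m" "odd m" by blast
    then show ?thesis
    proof cases
      case 1
      then have v: "s = L + 3/8*a + \<epsilon>" "l = 2* s" "c = 0" "\<epsilon> = 223/10000"
        by (simp_all add: s_def l_def c_def \<epsilon>_def)
      have "q ?Pa \<le> L + a/6 + \<epsilon>" using u0 a by (auto split: if_splits)
      then show ?thesis using u1 u2 u01 u12 u012 u02 a ba L4 v X gap_def by (intro conjI; linarith)
    next
      case 2
      then have v: "s = L + \<epsilon>" "l = 2*L - a/2 - c + \<epsilon>" "c = b/2" "\<epsilon> = 63/10000"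
        by (simp_all add: s_def l_def c_def \<epsilon>_def)
      have "q ?Pa \<le> L - 2/3*a + a/6 + \<epsilon>" using u0 2 by simp
      then show ?thesis using u1 u2 u01 u12 u012 u02 a ba L6[OF 2(1)] v X gap_def by (intro conjI; linarith)
    next
      case 3
      then have v: "s = L + a/6 + \<epsilon>" "l = 2*L - a/2 - c + \<epsilon>" "c = b/2" "\<epsilon> = 63/10000"
        by (simp_all add: s_def l_def c_def \<epsilon>_def)
      have "q ?Pa \<le> L + a/6 + \<epsilon>" using u0 3 by simp
      then show ?thesis using u1 u2 u01 u12 u012 u02 a ba L9[OF 3] v X gap_def by (intro conjI; linarith)
    qed
  qed
  note bounds = bounds[OF refl]
  have K: "s/4 + s*p - (3 * s-l)*p^2 < gap" if "0 \<le> p" "p \<le> 1/2" for p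
    using quadratic_below[OF that] bounds by blast
  have gap0: "gap > 0" using bounds by blast
  interpret gap_quadratic_group "mordell_weil m n" q gap
    by (rule gap_quadratic_group_mw[OF q C gap0]) (use low in \<open>auto simp: gap_def c_def\<close>)
  show ?thesis
    using extends_to_z_basis_three[of ?Pa ?Pb ?Pc s l] bounds K on mq
    by (simp add: P01 P12 P02 P012[unfolded P01] del: ec_add.simps Point_on_curve)
qed

end

theorem theorem1p1:
  fixes m n :: int
  assumes "m > 0" and "n > 0" and "coprime m n"
    and "\<And>p :: int. prime p \<Longrightarrow> p > 3 \<Longrightarrow> \<not> p^2 dvd disc m n"
  shows "(m = 1 \<and> n \<ge> 2 \<longrightarrow>
            extends_to_z_basis (mordell_weil m n)
              {Point 0 (of_int n), Point (- of_int m) (of_int n)}) \<and>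
         (n = 1 \<and> m \<ge> 4 \<longrightarrow>
            extends_to_z_basis (mordell_weil m n)
              {Point 0 (of_int n), Point (- of_int m) (of_int n), Point (- 1) (of_int m)})"
proof (intro conjI impI)
  assume A: "m = 1 \<and> n \<ge> 2"
  then interpret squarefree_curve m n using assms by unfold_locales auto
  show "extends_to_z_basis (mordell_weil m n) {Point 0 (of_int n), Point (- of_int m) (of_int n)}"
    using basis_one_left A by blast
next
  assume A: "n = 1 \<and> m \<ge> 4"
  then interpret squarefree_curve m n using assms by unfold_locales auto
  show "extends_to_z_basis (mordell_weil m n)
      {Point 0 (of_int n), Point (- of_int m) (of_int n), Point (- 1) (of_int m)}"
    using basis_one_right A by simp
qed

end
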